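(* Let $A=\{a_1,\dots,a_s\}$ and $B=\{b_1,\dots,b_t\}$ be two sets with $|A|+|B|=s+t=n$, with a matching cost $\mathrm{Weight}(a_i,b_j)\in\mathbb{R}$ for every pair, demands $\alpha_i$ and capacities $\alpha'_i$ for each $a_i$, and demands $\beta_j$ and capacities $\beta'_j$ for each $b_j$. Then an MMDC matching between $A$ and $B$ can be computed in $O(n^4)$ time.
   Context: A many-to-many matching between $A$ and $B$ is a set $M\subseteq A\times B$ of pairs (each pair used at most once). A minimum many-to-many matching with demands and capacities (MMDC matching) is a many-to-many matching $M$ in which each $a_i\in A$ belongs to at least $\alpha_i$ and at most $\alpha'_i$ pairs of $M$ ($1\le i\le s$), each $b_j\in B$ belongs to at least $\beta_j$ and at most $\beta'_j$ pairs of $M$ ($1\le j\le t$), and among all such matchings the total cost $\sum_{(a_i,b_j)\in M}\mathrm{Weight}(a_i,b_j)$ is minimized. Here $0\le\alpha_i\le\alpha'_i$ and $0\le\beta_j\le\beta'_j$ are nonnegative integers.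
   Formalization: If no matching meets all demands and capacities (e.g. A={a}, B empty, demand 1), no MMDC matching exists; the algorithm halts in O(n^4) time on every instance, and its output is claimed to be an MMDC matching only when one exists. *)

theory Defs
  imports Complex_Main "HOL-Library.Landau_Symbols"
begin

section \<open>Many-to-many matchings with demands and capacities\<close>

definition feasible_matching ::
  "'a set \<Rightarrow> 'b set \<Rightarrow> ('a \<Rightarrow> nat) \<Rightarrow> ('a \<Rightarrow> nat) \<Rightarrow> ('b \<Rightarrow> nat) \<Rightarrow> ('b \<Rightarrow> nat) \<Rightarrow> ('a \<times> 'b) set \<Rightarrow> bool"
where
  "feasible_matching A B \<alpha> \<alpha>' \<beta> \<beta>' M \<longleftrightarrow>
     M \<subseteq> A \<times> B \<and>
     (\<forall>a\<in>A. \<alpha> a \<le> card {p \<in> M. fst p = a} \<and> card {p \<in> M. fst p = a} \<le> \<alpha>' a) \<and>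
     (\<forall>b\<in>B. \<beta> b \<le> card {p \<in> M. snd p = b} \<and> card {p \<in> M. snd p = b} \<le> \<beta>' b)"

definition matching_cost :: "('a \<Rightarrow> 'b \<Rightarrow> real) \<Rightarrow> ('a \<times> 'b) set \<Rightarrow> real" where
  "matching_cost Weight M = (\<Sum>(a, b)\<in>M. Weight a b)"

definition MMDC_matching ::
  "'a set \<Rightarrow> 'b set \<Rightarrow> ('a \<Rightarrow> 'b \<Rightarrow> real) \<Rightarrow> ('a \<Rightarrow> nat) \<Rightarrow> ('a \<Rightarrow> nat) \<Rightarrow> ('b \<Rightarrow> nat) \<Rightarrow> ('b \<Rightarrow> nat)
     \<Rightarrow> ('a \<times> 'b) set \<Rightarrow> bool"
where
  "MMDC_matching A B Weight \<alpha> \<alpha>' \<beta> \<beta>' M \<longleftrightarrow>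
     feasible_matching A B \<alpha> \<alpha>' \<beta> \<beta>' M \<and>
     (\<forall>M'. feasible_matching A B \<alpha> \<alpha>' \<beta> \<beta>' M' \<longrightarrow> matching_cost Weight M \<le> matching_cost Weight M')"


section \<open>The machine model\<close>

text \<open>
  Running time is counted on a unit-cost random access machine with exact real numbers, presented
  as a structured language. The memory consists of integer arrays and real arrays, selected by name
  and addressed by integers; a scalar variable is the cell with index 0 of an array. Addresses are
  integer expressions, so addressing is indirect. Each memory access, constant, addition,
  subtraction, comparison, connective and control step costs one unit.

  The instruction set is deliberately small. There is no multiplication or division on either sort,
  no rounding of reals to integers, and the only constants are integers, so neither large numbers
  nor real constants can be used to pack unbounded work into single steps. A program is a finite
  syntax tree, the same for all inputs.
\<close>

type_synonym name = string

datatype iexp =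
    IConst int
  | ICell name iexp
  | IPlus iexp iexp
  | IMinus iexp iexp

datatype rexp =
    RConst int
  | RCell name iexp
  | RPlus rexp rexp
  | RMinus rexp rexp

datatype bexp =
    ILess iexp iexp
  | RLess rexp rexp
  | BNot bexp
  | BAnd bexp bexp

datatype com =
    Skip
  | IAssign name iexp iexp
  | RAssign name iexp rexp
  | Seq com com
  | Cond bexp com com
  | While bexp com

record store =
  imem :: "name \<Rightarrow> int \<Rightarrow> int"
  rmem :: "name \<Rightarrow> int \<Rightarrow> real"

primrec ival :: "iexp \<Rightarrow> store \<Rightarrow> int" where
  "ival (IConst c) \<sigma> = c"
| "ival (ICell x e) \<sigma> = imem \<sigma> x (ival e \<sigma>)"
| "ival (IPlus e f) \<sigma> = ival e \<sigma> + ival f \<sigma>"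
| "ival (IMinus e f) \<sigma> = ival e \<sigma> - ival f \<sigma>"

primrec rval :: "rexp \<Rightarrow> store \<Rightarrow> real" where
  "rval (RConst c) \<sigma> = of_int c"
| "rval (RCell x e) \<sigma> = rmem \<sigma> x (ival e \<sigma>)"
| "rval (RPlus e f) \<sigma> = rval e \<sigma> + rval f \<sigma>"
| "rval (RMinus e f) \<sigma> = rval e \<sigma> - rval f \<sigma>"

primrec bval :: "bexp \<Rightarrow> store \<Rightarrow> bool" where
  "bval (ILess e f) \<sigma> \<longleftrightarrow> ival e \<sigma> < ival f \<sigma>"
| "bval (RLess e f) \<sigma> \<longleftrightarrow> rval e \<sigma> < rval f \<sigma>"
| "bval (BNot b) \<sigma> \<longleftrightarrow> \<not> bval b \<sigma>"
| "bval (BAnd b c) \<sigma> \<longleftrightarrow> bval b \<sigma> \<and> bval c \<sigma>"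

primrec icost :: "iexp \<Rightarrow> nat" where
  "icost (IConst c) = 1"
| "icost (ICell x e) = 1 + icost e"
| "icost (IPlus e f) = 1 + icost e + icost f"
| "icost (IMinus e f) = 1 + icost e + icost f"

primrec rcost :: "rexp \<Rightarrow> nat" where
  "rcost (RConst c) = 1"
| "rcost (RCell x e) = 1 + icost e"
| "rcost (RPlus e f) = 1 + rcost e + rcost f"
| "rcost (RMinus e f) = 1 + rcost e + rcost f"

primrec bcost :: "bexp \<Rightarrow> nat" where
  "bcost (ILess e f) = 1 + icost e + icost f"
| "bcost (RLess e f) = 1 + rcost e + rcost f"
| "bcost (BNot b) = 1 + bcost b"
| "bcost (BAnd b c) = 1 + bcost b + bcost c"

definition iupdate :: "name \<Rightarrow> int \<Rightarrow> int \<Rightarrow> store \<Rightarrow> store" where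
  "iupdate x k v \<sigma> = \<sigma>\<lparr>imem := (imem \<sigma>)(x := (imem \<sigma> x)(k := v))\<rparr>"

definition rupdate :: "name \<Rightarrow> int \<Rightarrow> real \<Rightarrow> store \<Rightarrow> store" where
  "rupdate x k v \<sigma> = \<sigma>\<lparr>rmem := (rmem \<sigma>)(x := (rmem \<sigma> x)(k := v))\<rparr>"

text \<open>\<open>exec P \<sigma> k \<sigma>'\<close>: started in \<open>\<sigma>\<close>, the program \<open>P\<close> halts in \<open>\<sigma>'\<close> after exactly \<open>k\<close> units of time.\<close>

inductive exec :: "com \<Rightarrow> store \<Rightarrow> nat \<Rightarrow> store \<Rightarrow> bool" where
  Skip: "exec Skip \<sigma> 1 \<sigma>"
| IAssign: "exec (IAssign x e f) \<sigma> (1 + icost e + icost f) (iupdate x (ival e \<sigma>) (ival f \<sigma>) \<sigma>)"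
| RAssign: "exec (RAssign x e f) \<sigma> (1 + icost e + rcost f) (rupdate x (ival e \<sigma>) (rval f \<sigma>) \<sigma>)"
| Seq: "exec P \<sigma> k \<sigma>' \<Longrightarrow> exec Q \<sigma>' l \<sigma>'' \<Longrightarrow> exec (Seq P Q) \<sigma> (k + l) \<sigma>''"
| CondTrue: "bval b \<sigma> \<Longrightarrow> exec P \<sigma> k \<sigma>' \<Longrightarrow> exec (Cond b P Q) \<sigma> (1 + bcost b + k) \<sigma>'"
| CondFalse: "\<not> bval b \<sigma> \<Longrightarrow> exec Q \<sigma> k \<sigma>' \<Longrightarrow> exec (Cond b P Q) \<sigma> (1 + bcost b + k) \<sigma>'"
| WhileFalse: "\<not> bval b \<sigma> \<Longrightarrow> exec (While b P) \<sigma> (1 + bcost b) \<sigma>"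
| WhileTrue: "bval b \<sigma> \<Longrightarrow> exec P \<sigma> k \<sigma>' \<Longrightarrow> exec (While b P) \<sigma>' l \<sigma>'' \<Longrightarrow>
    exec (While b P) \<sigma> (1 + bcost b + k + l) \<sigma>''"

inductive_cases exec_SkipE: "exec Skip \<sigma> k \<sigma>'"
inductive_cases exec_IAssignE: "exec (IAssign x e f) \<sigma> k \<sigma>'"
inductive_cases exec_RAssignE: "exec (RAssign x e f) \<sigma> k \<sigma>'"
inductive_cases exec_SeqE: "exec (Seq P Q) \<sigma> k \<sigma>'"
inductive_cases exec_CondE: "exec (Cond b P Q) \<sigma> k \<sigma>'"
inductive_cases exec_WhileE: "exec (While b P) \<sigma> k \<sigma>'"

lemma exec_deterministic:
  "exec P \<sigma> k \<sigma>' \<Longrightarrow> exec P \<sigma> l \<sigma>'' \<Longrightarrow> l = k \<and> \<sigma>'' = \<sigma>'"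
proof (induction arbitrary: l \<sigma>'' rule: exec.induct)
  case (Skip \<sigma>)
  then show ?case by (rule exec_SkipE) simp
next
  case (IAssign x e f \<sigma>)
  then show ?case by (rule exec_IAssignE) simp
next
  case (RAssign x e f \<sigma>)
  then show ?case by (rule exec_RAssignE) simp
next
  case (Seq P \<sigma> k \<sigma>' Q l' \<tau>)
  from Seq.prems show ?case by (rule exec_SeqE) (auto dest: Seq.IH)
next
  case (CondTrue b \<sigma> P k \<sigma>' Q)
  from CondTrue.prems show ?case by (rule exec_CondE) (use CondTrue.hyps in \<open>auto dest: CondTrue.IH\<close>)
next
  case (CondFalse b \<sigma> Q k \<sigma>' P)
  from CondFalse.prems show ?case by (rule exec_CondE) (use CondFalse.hyps in \<open>auto dest: CondFalse.IH\<close>)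
next
  case (WhileFalse b \<sigma> P)
  from WhileFalse.prems show ?case by (rule exec_WhileE) (use WhileFalse.hyps in simp_all)
next
  case (WhileTrue b \<sigma> P k \<sigma>' l' \<tau>)
  from WhileTrue.prems show ?case
    by (rule exec_WhileE) (use WhileTrue.hyps in \<open>auto dest: WhileTrue.IH\<close>)
qed


section \<open>Encoding of instances and results\<close>

text \<open>
  The sets \<open>A\<close> and \<open>B\<close> are given by duplicate-free enumerations \<open>as\<close> and \<open>bs\<close>. Indices start at 0,
  and the cost matrix and the resulting matching are stored row by row, with the entry of the
  \<open>i\<close>-th element of \<open>as\<close> and the \<open>j\<close>-th element of \<open>bs\<close> in the cell \<open>i * length bs + j\<close>.
  All cells that hold no input are 0.
\<close>

definition input_store ::
  "'a list \<Rightarrow> 'b list \<Rightarrow> ('a \<Rightarrow> 'b \<Rightarrow> real) \<Rightarrow> ('a \<Rightarrow> nat) \<Rightarrow> ('a \<Rightarrow> nat) \<Rightarrow> ('b \<Rightarrow> nat) \<Rightarrow> ('b \<Rightarrow> nat) \<Rightarrow> store"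
where
  "input_store as bs Weight \<alpha> \<alpha>' \<beta> \<beta>' =
    \<lparr>imem = (\<lambda>x k.
       if x = ''s'' \<and> k = 0 then int (length as)
       else if x = ''t'' \<and> k = 0 then int (length bs)
       else if x = ''alpha'' \<and> 0 \<le> k \<and> k < int (length as) then int (\<alpha> (as ! nat k))
       else if x = ''alpha_cap'' \<and> 0 \<le> k \<and> k < int (length as) then int (\<alpha>' (as ! nat k))
       else if x = ''beta'' \<and> 0 \<le> k \<and> k < int (length bs) then int (\<beta> (bs ! nat k))
       else if x = ''beta_cap'' \<and> 0 \<le> k \<and> k < int (length bs) then int (\<beta>' (bs ! nat k))
       else 0),
     rmem = (\<lambda>x k.
       if x = ''weight'' \<and> 0 \<le> k \<and> k < int (length as * length bs)
       then Weight (as ! (nat k div length bs)) (bs ! (nat k mod length bs))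
       else 0)\<rparr>"

definition output_matching :: "'a list \<Rightarrow> 'b list \<Rightarrow> store \<Rightarrow> ('a \<times> 'b) set" where
  "output_matching as bs \<sigma> =
     {(as ! i, bs ! j) | i j. i < length as \<and> j < length bs \<and>
        imem \<sigma> ''M'' (int (i * length bs + j)) = 1}"

lemma input_store_weight:
  assumes "i < length as" "j < length bs"
  shows "rmem (input_store as bs Weight \<alpha> \<alpha>' \<beta> \<beta>') ''weight'' (int (i * length bs + j)) =
    Weight (as ! i) (bs ! j)"
proof -
  have "i * length bs + j < Suc i * length bs" using assms by simp
  also have "\<dots> \<le> length as * length bs" using assms by (intro mult_right_mono) auto
  finally have "int (i * length bs + j) < int (length as * length bs)" by (simp only: of_nat_less_iff)
  moreover have "(i * length bs + j) div length bs = i" "(i * length bs + j) mod length bs = j"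
    using assms(2) by (auto simp: div_add1_eq[of "i * length bs"])
  ultimately show ?thesis unfolding input_store_def by (simp del: of_nat_add of_nat_mult)
qed

end

theory Submission
  imports Defs
begin

text \<open>
  The degree bounds are turned into a convex penalty: a matching costs its weight plus \<open>C\<close> times the total
  amount by which degrees leave their intervals, where \<open>C\<close> exceeds the sum of all \<open>\<bar>Weight\<bar>\<close>. A minimum of
  this unconstrained problem is an optimal feasible matching as soon as a feasible one exists. The penalized
  problem is a convex-cost circulation on the \<open>n\<close> elements and an extra root node. The pairs are admitted one
  at a time, keeping node potentials for which all residual arcs have nonnegative reduced cost. If a new pair
  \<open>(a, b)\<close> has reduced cost \<open>- K < 0\<close>, Dijkstra's algorithm with labels capped at \<open>K\<close> is run from \<open>b\<close> and the
  labels are added to the potentials; either \<open>a\<close> got the label \<open>K\<close> and the pair now has reduced cost \<open>0\<close>, or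
  one unit of flow is sent around the cycle formed by the shortest path and the new pair. Each of the at most
  \<open>n\<^sup>2\<close> admissions takes \<open>O(n\<^sup>2)\<close> steps.
\<close>

section \<open>Weakest preconditions with running time\<close>

text \<open>Two obstacles shape the proof. A feasible matching need not exist, and finding one to
  start from is itself a flow problem. Under the penalty every flow is admissible, so the zero flow
  can serve as the start, with potentials read off the penalty slopes. Nor may demands and
  capacities enter the running time: an admission changes the flow by at most one unit around one
  cycle, so the number of augmentations is bounded by the number of pairs, however large the bounds
  are. Admitting pairs singly confines negative reduced cost to the one new pair. This is why
  Dijkstra's algorithm applies although weights may have any sign. The cap limits the potential
  change to what the new pair needs: its reduced cost moves from \<open>- K\<close> to
  \<open>D a - K\<close>, which is never positive, so the pair can enter as matched, or, if the cap
  is reached, as unmatched. The optimality argument sees only a certificate of residual arcs, costs,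
  potentials and supplies. A total-correctness calculus, whose postconditions also bound the time,
  links the program to it. Since the machine cannot multiply, matrix addresses come from tables and
  counters filled by addition.\<close>

definition wp :: "com \<Rightarrow> (nat \<Rightarrow> store \<Rightarrow> bool) \<Rightarrow> store \<Rightarrow> bool" where
  "wp P Q \<sigma> \<longleftrightarrow> (\<exists>k \<tau>. exec P \<sigma> k \<tau> \<and> Q k \<tau>)"

lemma wp_mono: "wp P Q \<sigma> \<Longrightarrow> (\<And>k \<tau>. Q k \<tau> \<Longrightarrow> Q' k \<tau>) \<Longrightarrow> wp P Q' \<sigma>"
  by (auto simp: wp_def)

lemma wp_Skip [simp]: "wp Skip Q \<sigma> = Q 1 \<sigma>"
proof
  show "wp Skip Q \<sigma> \<Longrightarrow> Q 1 \<sigma>" unfolding wp_def by (auto elim: exec_SkipE)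
  show "Q 1 \<sigma> \<Longrightarrow> wp Skip Q \<sigma>" unfolding wp_def by (blast intro: exec.Skip)
qed

lemma wp_IAssign [simp]:
  "wp (IAssign x e f) Q \<sigma> = Q (1 + icost e + icost f) (iupdate x (ival e \<sigma>) (ival f \<sigma>) \<sigma>)"
    (is "?l = ?r")
proof
  show "?l \<Longrightarrow> ?r" unfolding wp_def by (auto elim: exec_IAssignE)
  show "?r \<Longrightarrow> ?l" unfolding wp_def by (blast intro: exec.IAssign)
qed

lemma wp_RAssign [simp]:
  "wp (RAssign x e f) Q \<sigma> = Q (1 + icost e + rcost f) (rupdate x (ival e \<sigma>) (rval f \<sigma>) \<sigma>)"
    (is "?l = ?r")
proof
  show "?l \<Longrightarrow> ?r" unfolding wp_def by (auto elim: exec_RAssignE)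
  show "?r \<Longrightarrow> ?l" unfolding wp_def by (blast intro: exec.RAssign)
qed

lemma wp_Seq: "wp (Seq P P') Q \<sigma> = wp P (\<lambda>k. wp P' (\<lambda>l. Q (k + l))) \<sigma>"
  by (auto simp: wp_def intro: exec.Seq elim!: exec_SeqE)

lemma wp_Cond [simp]:
  "wp (Cond b P P') Q \<sigma> =
    (if bval b \<sigma> then wp P (\<lambda>k. Q (1 + bcost b + k)) \<sigma> else wp P' (\<lambda>k. Q (1 + bcost b + k)) \<sigma>)"
    (is "?l = ?r")
proof
  show "?l \<Longrightarrow> ?r" unfolding wp_def by (auto elim!: exec_CondE)
next
  assume ?r
  then show ?l
  proof (cases "bval b \<sigma>")
    case True
    with \<open>?r\<close> obtain k \<tau> where "exec P \<sigma> k \<tau>" "Q (1 + bcost b + k) \<tau>" by (auto simp: wp_def)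
    then show ?thesis unfolding wp_def using exec.CondTrue[OF True] by blast
  next
    case False
    with \<open>?r\<close> obtain k \<tau> where "exec P' \<sigma> k \<tau>" "Q (1 + bcost b + k) \<tau>" by (auto simp: wp_def)
    then show ?thesis unfolding wp_def using exec.CondFalse[OF False] by blast
  qed
qed

text \<open>\<open>f\<close> bounds the number of iterations to come and \<open>B\<close> the time
  of each, so termination and running time follow from the same induction. The summand
  \<open>1 + bcost b\<close> pays for the final failing test.\<close>

lemma wp_While:
  assumes "I \<sigma>"
    and step: "\<And>\<tau>. I \<tau> \<Longrightarrow> bval b \<tau> \<Longrightarrow> wp P (\<lambda>k \<tau>'. k \<le> B \<and> I \<tau>' \<and> (f \<tau>' :: nat) < f \<tau>) \<tau>"
    and exit: "\<And>k \<tau>. I \<tau> \<Longrightarrow> \<not> bval b \<tau> \<Longrightarrow> k \<le> 1 + bcost b + f \<sigma> * (1 + bcost b + B) \<Longrightarrow> Q k \<tau>"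
  shows "wp (While b P) Q \<sigma>"
proof -
  have "\<exists>k \<tau>'. exec (While b P) \<tau> k \<tau>' \<and> I \<tau>' \<and> \<not> bval b \<tau>' \<and>
      k \<le> 1 + bcost b + f \<tau> * (1 + bcost b + B)" if "I \<tau>" for \<tau>
    using that
  proof (induction "f \<tau>" arbitrary: \<tau> rule: less_induct)
    case less
    show ?case
    proof (cases "bval b \<tau>")
      case False
      then show ?thesis using less.prems exec.WhileFalse[OF False, of P] by (intro exI[of _ "1 + bcost b"] exI[of _ \<tau>]) auto
    next
      case True
      from step[OF less.prems True] obtain k \<tau>1
        where 1: "exec P \<tau> k \<tau>1" "k \<le> B" "I \<tau>1" "f \<tau>1 < f \<tau>" by (auto simp: wp_def)
      from less.hyps[OF 1(4,3)] obtain l \<tau>2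
        where 2: "exec (While b P) \<tau>1 l \<tau>2" "I \<tau>2" "\<not> bval b \<tau>2"
          "l \<le> 1 + bcost b + f \<tau>1 * (1 + bcost b + B)" by blast
      have "(f \<tau>1 + 1) * (1 + bcost b + B) \<le> f \<tau> * (1 + bcost b + B)"
        using 1(4) by (intro mult_right_mono) auto
      then have "1 + bcost b + k + l \<le> 1 + bcost b + f \<tau> * (1 + bcost b + B)"
        using 1(2) 2(4) by simp
      then show ?thesis using exec.WhileTrue[OF True 1(1) 2(1)] 2(2,3) by blast
    qed
  qed
  then show ?thesis using assms(1) exit unfolding wp_def by blast
qed

section \<open>Syntactic footprints and counting loops\<close>

primrec iwrites :: "com \<Rightarrow> name set" where
  "iwrites Skip = {}"
| "iwrites (IAssign x e f) = {x}"
| "iwrites (RAssign x e f) = {}"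
| "iwrites (Seq P Q) = iwrites P \<union> iwrites Q"
| "iwrites (Cond b P Q) = iwrites P \<union> iwrites Q"
| "iwrites (While b P) = iwrites P"

primrec rwrites :: "com \<Rightarrow> name set" where
  "rwrites Skip = {}"
| "rwrites (IAssign x e f) = {}"
| "rwrites (RAssign x e f) = {x}"
| "rwrites (Seq P Q) = rwrites P \<union> rwrites Q"
| "rwrites (Cond b P Q) = rwrites P \<union> rwrites Q"
| "rwrites (While b P) = rwrites P"

text \<open>The frame relation: only arrays named in \<open>X\<close> or \<open>Y\<close> may
  differ. With the syntactic footprints it lets a specification mention just the cells that a
  command is meant to change.\<close>

definition agree :: "name set \<Rightarrow> name set \<Rightarrow> store \<Rightarrow> store \<Rightarrow> bool" where
  "agree X Y \<sigma> \<tau> \<longleftrightarrow> (\<forall>x. x \<notin> X \<longrightarrow> imem \<tau> x = imem \<sigma> x) \<and> (\<forall>y. y \<notin> Y \<longrightarrow> rmem \<tau> y = rmem \<sigma> y)"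

lemma agree_trans: "agree X Y \<sigma> \<tau> \<Longrightarrow> agree X Y \<tau> \<rho> \<Longrightarrow> agree X Y \<sigma> \<rho>"
  by (simp add: agree_def)

lemma agree_mono: "agree X Y \<sigma> \<tau> \<Longrightarrow> X \<subseteq> X' \<Longrightarrow> Y \<subseteq> Y' \<Longrightarrow> agree X' Y' \<sigma> \<tau>"
  by (auto simp: agree_def)

lemma agree_imem: "agree X Y \<sigma> \<tau> \<Longrightarrow> x \<notin> X \<Longrightarrow> imem \<tau> x = imem \<sigma> x"
  by (simp add: agree_def)

lemma imem_iupdate [simp]:
  "imem (iupdate x k v \<sigma>) y = (if y = x then (imem \<sigma> x)(k := v) else imem \<sigma> y)"
  by (simp add: iupdate_def)

lemma rmem_iupdate [simp]: "rmem (iupdate x k v \<sigma>) y = rmem \<sigma> y"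
  by (simp add: iupdate_def)

lemma rmem_rupdate [simp]:
  "rmem (rupdate x k v \<sigma>) y = (if y = x then (rmem \<sigma> x)(k := v) else rmem \<sigma> y)"
  by (simp add: rupdate_def)

lemma imem_rupdate [simp]: "imem (rupdate x k v \<sigma>) y = imem \<sigma> y"
  by (simp add: rupdate_def)

lemma exec_agree: "exec P \<sigma> k \<tau> \<Longrightarrow> agree (iwrites P) (rwrites P) \<sigma> \<tau>"
  by (induction rule: exec.induct) (auto simp: agree_def)

lemma wp_agree:
  "wp P Q \<sigma> \<Longrightarrow> wp P (\<lambda>k \<tau>. Q k \<tau> \<and> agree (iwrites P) (rwrites P) \<sigma> \<tau>) \<sigma>"
  by (auto simp: wp_def dest: exec_agree)

lemma wp_SeqI:
  assumes "wp P (\<lambda>k \<tau>. k \<le> B \<and> R \<tau>) \<sigma>"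
    and "\<And>k \<tau>. k \<le> B \<Longrightarrow> R \<tau> \<Longrightarrow> agree (iwrites P) (rwrites P) \<sigma> \<tau> \<Longrightarrow> wp P' (\<lambda>l. Q (k + l)) \<tau>"
  shows "wp (Seq P P') Q \<sigma>"
  unfolding wp_Seq by (rule wp_mono[OF wp_agree[OF assms(1)]]) (use assms(2) in auto)

abbreviation ivar :: "name \<Rightarrow> iexp" where "ivar x \<equiv> ICell x (IConst 0)"
abbreviation rvar :: "name \<Rightarrow> rexp" where "rvar x \<equiv> RCell x (IConst 0)"
abbreviation iset :: "name \<Rightarrow> iexp \<Rightarrow> com" where "iset x \<equiv> IAssign x (IConst 0)"
abbreviation rset :: "name \<Rightarrow> rexp \<Rightarrow> com" where "rset x \<equiv> RAssign x (IConst 0)"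

definition For :: "name \<Rightarrow> name \<Rightarrow> com \<Rightarrow> com" where
  "For x m P = Seq (iset x (IConst 0))
    (While (ILess (ivar x) (ivar m)) (Seq P (iset x (IPlus (ivar x) (IConst 1)))))"

lemma iwrites_For [simp]: "iwrites (For x m P) = insert x (iwrites P)"
  by (auto simp: For_def)

lemma rwrites_For [simp]: "rwrites (For x m P) = rwrites P"
  by (auto simp: For_def)

text \<open>The counter is set and incremented outside \<open>P\<close>, so \<open>stable\<close>
  asks that the invariant ignore its cell; the progress of the loop is passed as the argument
  \<open>i\<close> instead. In the bound, 9 is the initialization (3) plus the failing test (6), and
  12 is a test plus an increment, 6 units each.\<close>

lemma wp_For:
  assumes m: "imem \<sigma> m 0 = n" "0 \<le> n" "m \<noteq> x" "m \<notin> iwrites P" "x \<notin> iwrites P"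
    and stable: "\<And>i \<tau> v. I i \<tau> \<Longrightarrow> I i (iupdate x 0 v \<tau>)"
    and init: "I 0 \<sigma>"
    and step: "\<And>i \<tau>. 0 \<le> i \<Longrightarrow> i < n \<Longrightarrow> imem \<tau> x 0 = i \<Longrightarrow>
        agree (insert x (iwrites P)) (rwrites P) \<sigma> \<tau> \<Longrightarrow> I i \<tau> \<Longrightarrow> wp P (\<lambda>k \<tau>'. k \<le> B \<and> I (i + 1) \<tau>') \<tau>"
    and exit: "\<And>k \<tau>. I n \<tau> \<Longrightarrow> k \<le> 9 + nat n * (12 + B) \<Longrightarrow>
        agree (insert x (iwrites P)) (rwrites P) \<sigma> \<tau> \<Longrightarrow> Q k \<tau>"
  shows "wp (For x m P) Q \<sigma>"
proof -
  let ?J = "\<lambda>\<tau>. \<exists>i. 0 \<le> i \<and> i \<le> n \<and> imem \<tau> x 0 = i \<and>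
    agree (insert x (iwrites P)) (rwrites P) \<sigma> \<tau> \<and> I i \<tau>"
  let ?f = "\<lambda>\<tau>. nat (n - imem \<tau> x 0)"
  have "wp (While (ILess (ivar x) (ivar m)) (Seq P (iset x (IPlus (ivar x) (IConst 1)))))
     (\<lambda>k. Q (3 + k)) (iupdate x 0 0 \<sigma>)"
  proof (rule wp_While[where I = ?J and f = ?f and B = "B + 6"])
    show "?J (iupdate x 0 0 \<sigma>)"
      using m init stable by (intro exI[of _ 0]) (auto simp: agree_def)
  next
    fix \<tau> assume J: "?J \<tau>" and b: "bval (ILess (ivar x) (ivar m)) \<tau>"
    then obtain i where i: "0 \<le> i" "i \<le> n" "imem \<tau> x 0 = i"
      "agree (insert x (iwrites P)) (rwrites P) \<sigma> \<tau>" "I i \<tau>" by auto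
    have "imem \<tau> m = imem \<sigma> m" using agree_imem[OF i(4)] m by auto
    then have "i < n" using b i m by simp
    then have "wp P (\<lambda>k \<tau>'. k \<le> B \<and> I (i + 1) \<tau>') \<tau>" using step i by blast
    note w = wp_agree[OF this]
    show "wp (Seq P (iset x (IPlus (ivar x) (IConst 1))))
      (\<lambda>k \<tau>'. k \<le> B + 6 \<and> ?J \<tau>' \<and> ?f \<tau>' < ?f \<tau>) \<tau>"
      unfolding wp_Seq
    proof (rule wp_mono[OF w], elim conjE)
      fix k \<tau>'
      assume k: "k \<le> B" and I: "I (i + 1) \<tau>'" and a: "agree (iwrites P) (rwrites P) \<tau> \<tau>'"
      have "imem \<tau>' x = imem \<tau> x" using agree_imem[OF a] m by auto
      moreover have "agree (insert x (iwrites P)) (rwrites P) \<sigma> (iupdate x 0 (i + 1) \<tau>')"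
        using i(4) a by (auto simp: agree_def)
      ultimately show "wp (iset x (IPlus (ivar x) (IConst 1)))
         (\<lambda>l \<tau>'. k + l \<le> B + 6 \<and> ?J \<tau>' \<and> ?f \<tau>' < ?f \<tau>) \<tau>'"
        using k I i \<open>i < n\<close> stable by auto
    qed
  next
    fix k \<tau> assume J: "?J \<tau>" and b: "\<not> bval (ILess (ivar x) (ivar m)) \<tau>"
      and k: "k \<le> 1 + bcost (ILess (ivar x) (ivar m)) + ?f (iupdate x 0 0 \<sigma>) *
         (1 + bcost (ILess (ivar x) (ivar m)) + (B + 6))"
    then obtain i where i: "0 \<le> i" "i \<le> n" "imem \<tau> x 0 = i"
      "agree (insert x (iwrites P)) (rwrites P) \<sigma> \<tau>" "I i \<tau>" by auto
    have "imem \<tau> m = imem \<sigma> m" using agree_imem[OF i(4)] m by auto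
    then have "i = n" using b i m by simp
    then show "Q (3 + k) \<tau>" using exit[of \<tau> "3 + k"] i k by (simp add: algebra_simps)
  qed
  then show ?thesis by (simp add: For_def wp_Seq numeral_3_eq_3)
qed

section \<open>Residual networks and potentials\<close>

definition violation :: "int \<Rightarrow> int \<Rightarrow> int \<Rightarrow> int" where
  "violation l h z = max 0 (l - z) + max 0 (z - h)"

text \<open>\<open>slope C l h z\<close> is the last increment \<open>C * violation l h z - C * violation l h (z - 1)\<close> of the convex penalty.\<close>

definition slope :: "real \<Rightarrow> int \<Rightarrow> int \<Rightarrow> int \<Rightarrow> real" where
  "slope C l h z = (if z \<le> l then - C else if z \<le> h then 0 else C)"

lemma slope_mono: "0 \<le> C \<Longrightarrow> z \<le> z' \<Longrightarrow> slope C l h z \<le> slope C l h z'"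
  by (auto simp: slope_def)

text \<open>Convexity: if \<open>q\<close> lies between the increments on the two sides of
  \<open>z\<close>, the line of slope \<open>q\<close> through the point at \<open>z\<close> stays
  below the penalty. Potentials enter the optimality proof in this form.\<close>

lemma violation_subgradient:
  fixes C q :: real
  assumes "0 \<le> C" "l \<le> h" "slope C l h z \<le> q" "q \<le> slope C l h (z + 1)"
  shows "C * violation l h z + real_of_int (z' - z) * q \<le> C * violation l h z'"
proof (cases "z' \<le> z")
  case True
  have "real_of_int (z' - z) * q \<le> (z' - z) * slope C l h z"
    using True assms(3) by (intro mult_left_mono_neg) auto
  also have "\<dots> \<le> C * violation l h z' - C * violation l h z"
  proof -
    consider "z \<le> l" | "l < z" "z \<le> h" | "h < z" by linarith
    then show ?thesis
    proof cases
      case 1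
      have "violation l h z' - violation l h z = z - z'"
        using 1 True assms(2) by (simp add: violation_def)
      then have "real_of_int (violation l h z') - violation l h z = z - z'" by linarith
      then have "C * (real_of_int (violation l h z') - violation l h z) = C * (real_of_int z - z')" by simp
      then show ?thesis using 1 by (simp add: slope_def algebra_simps)
    next
      case 2
      then have "violation l h z = 0" "0 \<le> violation l h z'" by (simp_all add: violation_def)
      then show ?thesis using 2 assms(1) by (simp add: slope_def)
    next
      case 3
      have "z' - z \<le> violation l h z' - violation l h z"
        using 3 True assms(2) by (simp add: violation_def)
      then have "real_of_int z' - z \<le> real_of_int (violation l h z') - violation l h z" by linarith
      from mult_left_mono[OF this assms(1)]
      show ?thesis using 3 assms(2) by (simp add: slope_def algebra_simps)
    qed
  qed
  finally show ?thesis by simp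
next
  case False
  have "real_of_int (z' - z) * q \<le> (z' - z) * slope C l h (z + 1)"
    using False assms(4) by (intro mult_left_mono) auto
  also have "\<dots> \<le> C * violation l h z' - C * violation l h z"
  proof -
    consider "z + 1 \<le> l" | "l \<le> z" "z + 1 \<le> h" | "l \<le> z" "h \<le> z" by linarith
    then show ?thesis
    proof cases
      case 1
      have "z - z' \<le> violation l h z' - violation l h z"
        using 1 False assms(2) by (simp add: violation_def)
      then have "real_of_int z - z' \<le> real_of_int (violation l h z') - violation l h z" by linarith
      from mult_left_mono[OF this assms(1)]
      show ?thesis using 1 by (simp add: slope_def algebra_simps)
    next
      case 2
      then have "violation l h z = 0" "0 \<le> violation l h z'" by (simp_all add: violation_def)
      then show ?thesis using 2 assms(1) by (simp add: slope_def)
    next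
      case 3
      have "violation l h z' - violation l h z = z' - z"
        using 3 False assms(2) by (simp add: violation_def)
      then have "real_of_int (violation l h z') - violation l h z = z' - z" by linarith
      then show ?thesis using 3 by (simp add: slope_def flip: right_diff_distrib)
    qed
  qed
  finally show ?thesis by simp
qed

text \<open>
  State of Dijkstra's algorithm with \<open>k\<close> scanned nodes: \<open>D\<close> are the labels, capped at \<open>K\<close>, \<open>d v > 0\<close> is the
  position of a scanned node \<open>v\<close> in the scanning order, and \<open>pr\<close> the predecessor on the current path from \<open>b\<close>.
\<close>

definition dijkstra ::
  "int \<Rightarrow> (int \<Rightarrow> int \<Rightarrow> bool) \<Rightarrow> (int \<Rightarrow> int \<Rightarrow> real) \<Rightarrow> int \<Rightarrow> real \<Rightarrow>
    int \<Rightarrow> (int \<Rightarrow> real) \<Rightarrow> (int \<Rightarrow> int) \<Rightarrow> (int \<Rightarrow> int) \<Rightarrow> bool"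
where
  "dijkstra N E c b K k D d pr \<longleftrightarrow>
    int (card {v\<in>{0..<N}. 0 < d v}) = k \<and> (\<forall>v\<in>{0..<N}. 0 \<le> d v \<and> d v \<le> k) \<and>
    D b = 0 \<and> (\<forall>v\<in>{0..<N}. 0 \<le> D v \<and> D v \<le> K) \<and>
    (\<forall>u\<in>{0..<N}. \<forall>v\<in>{0..<N}. 0 < d u \<longrightarrow> E u v \<longrightarrow> D v \<le> D u + c u v) \<and>
    (\<forall>u\<in>{0..<N}. \<forall>v\<in>{0..<N}. 0 < d u \<longrightarrow> d v = 0 \<longrightarrow> D u \<le> D v) \<and>
    (\<forall>v\<in>{0..<N}. v \<noteq> b \<longrightarrow> D v < K \<longrightarrow> pr v \<in> {0..<N} \<and> 0 < d (pr v) \<and>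
       (0 < d v \<longrightarrow> d (pr v) < d v) \<and> E (pr v) v \<and> D v = D (pr v) + c (pr v) v)"

section \<open>Dijkstra's label invariant: start, step and outcome\<close>

lemma dijkstra_init:
  assumes "b \<in> {0..<N}" "0 < K" "\<And>v. v \<in> {0..<N} \<Longrightarrow> d v = 0 \<and> D v = (if v = b then 0 else K)"
  shows "dijkstra N E c b K 0 D d pr"
proof -
  have "{v\<in>{0..<N}. 0 < d v} = {}" using assms by auto
  then have "int (card {v\<in>{0..<N}. 0 < d v}) = 0" by (simp only: card.empty)
  then show ?thesis unfolding dijkstra_def using assms by auto
qed

lemma dijkstra_unscanned:
  assumes "dijkstra N E c b K k D d pr" "k < N"
  shows "\<exists>v\<in>{0..<N}. d v = 0"
proof (rule ccontr)
  assume "\<not> ?thesis"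
  moreover have "\<And>v. v \<in> {0..<N} \<Longrightarrow> 0 \<le> d v" using assms by (simp add: dijkstra_def)
  ultimately have "{v\<in>{0..<N}. 0 < d v} = {0..<N}" by force
  moreover have "int (card {v\<in>{0..<N}. 0 < d v}) = k" using assms unfolding dijkstra_def by blast
  ultimately have "int (card {0..<N}) = k" by simp
  then show False using assms(2) by (simp split: if_splits)
qed

lemma dijkstra_finished:
  assumes "dijkstra N E c b K N D d pr" "v \<in> {0..<N}"
  shows "0 < d v"
proof -
  have "int (card {v\<in>{0..<N}. 0 < d v}) = N" using assms unfolding dijkstra_def by blast
  from arg_cong[OF this, of nat] have "card {v\<in>{0..<N}. 0 < d v} = card {0..<N}"
    unfolding card_atLeastLessThan_int nat_int by simp
  then have "{v\<in>{0..<N}. 0 < d v} = {0..<N}" by (intro card_subset_eq) auto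
  then show ?thesis using assms(2) by blast
qed

text \<open>The triangle inequality serves the potential update, the predecessor facts serve the
  augmentation. Arcs of cost 0 may occur, so \<open>D\<close> alone would not show that predecessor
  chains end; the scanning position \<open>d\<close> strictly decreases. That
  \<open>D (pr v) < K\<close> keeps a chain below the cap until it reaches \<open>b\<close>.\<close>

lemma dijkstra_result:
  assumes dij: "dijkstra N E c b K N D d pr" and v: "v \<in> {0..<N}"
    and nonneg: "\<forall>x\<in>{0..<N}. \<forall>y\<in>{0..<N}. E x y \<longrightarrow> 0 \<le> c x y"
  shows "D b = 0" "0 < d v \<and> d v \<le> N" "D v \<le> K"
    "u \<in> {0..<N} \<Longrightarrow> E u v \<Longrightarrow> D v \<le> D u + c u v"
    "v \<noteq> b \<Longrightarrow> D v < K \<Longrightarrow> pr v \<in> {0..<N} \<and> d (pr v) < d v \<and> D (pr v) < K \<and>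
       E (pr v) v \<and> D v = D (pr v) + c (pr v) v"
proof -
  note pos = dijkstra_finished[OF dij]
  show "D b = 0" "0 < d v \<and> d v \<le> N" "D v \<le> K" using dij v pos by (simp_all add: dijkstra_def)
  show "u \<in> {0..<N} \<Longrightarrow> E u v \<Longrightarrow> D v \<le> D u + c u v"
    using dij v pos[of u] by (simp add: dijkstra_def)
  assume a: "v \<noteq> b" "D v < K"
  have "\<forall>v\<in>{0..<N}. v \<noteq> b \<longrightarrow> D v < K \<longrightarrow> pr v \<in> {0..<N} \<and> 0 < d (pr v) \<and>
       (0 < d v \<longrightarrow> d (pr v) < d v) \<and> E (pr v) v \<and> D v = D (pr v) + c (pr v) v"
    using dij unfolding dijkstra_def by blast
  with a v pos[OF v] have "pr v \<in> {0..<N} \<and> d (pr v) < d v \<and> E (pr v) v \<and> D v = D (pr v) + c (pr v) v"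
    by blast
  moreover from this have "0 \<le> c (pr v) v" using nonneg v by blast
  ultimately show "pr v \<in> {0..<N} \<and> d (pr v) < d v \<and> D (pr v) < K \<and>
       E (pr v) v \<and> D v = D (pr v) + c (pr v) v" using a by auto
qed

text \<open>With nonnegative costs and \<open>u\<close> of least label among the unscanned nodes, an
  improvement can only occur at an unscanned node other than \<open>u\<close> (fact
  \<open>imp\<close>). Labels and predecessors of scanned nodes are therefore final.\<close>

lemma dijkstra_step:
  assumes dij: "dijkstra N E c b K k D d pr"
    and nonneg: "\<And>x y. x \<in> {0..<N} \<Longrightarrow> y \<in> {0..<N} \<Longrightarrow> E x y \<Longrightarrow> 0 \<le> c x y"
    and b: "b \<in> {0..<N}"
    and u: "u \<in> {0..<N}" "d u = 0" "\<And>v. v \<in> {0..<N} \<Longrightarrow> d v = 0 \<Longrightarrow> D u \<le> D v"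
    and d': "\<And>v. v \<in> {0..<N} \<Longrightarrow> d' v = (if v = u then k + 1 else d v)"
    and D': "\<And>v. v \<in> {0..<N} \<Longrightarrow> D' v = (if E u v \<and> D u + c u v < D v then D u + c u v else D v)"
    and pr': "\<And>v. v \<in> {0..<N} \<Longrightarrow> pr' v = (if E u v \<and> D u + c u v < D v then u else pr v)"
  shows "dijkstra N E c b K (k + 1) D' d' pr'"
proof -
  let ?V = "{0..<N}"
  have k: "int (card {v\<in>?V. 0 < d v}) = k" and dk: "\<And>v. v \<in> ?V \<Longrightarrow> 0 \<le> d v \<and> d v \<le> k"
    and Db: "D b = 0" and DK: "\<And>v. v \<in> ?V \<Longrightarrow> 0 \<le> D v \<and> D v \<le> K"
    and relaxed: "\<And>x v. x \<in> ?V \<Longrightarrow> v \<in> ?V \<Longrightarrow> 0 < d x \<Longrightarrow> E x v \<Longrightarrow> D v \<le> D x + c x v"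
    and ord: "\<And>x v. x \<in> ?V \<Longrightarrow> v \<in> ?V \<Longrightarrow> 0 < d x \<Longrightarrow> d v = 0 \<Longrightarrow> D x \<le> D v"
    and tree: "\<And>v. v \<in> ?V \<Longrightarrow> v \<noteq> b \<Longrightarrow> D v < K \<Longrightarrow> pr v \<in> ?V \<and> 0 < d (pr v) \<and>
       (0 < d v \<longrightarrow> d (pr v) < d v) \<and> E (pr v) v \<and> D v = D (pr v) + c (pr v) v"
    using dij by (auto simp: dijkstra_def)
  have k0: "0 \<le> k" using k by linarith
  have imp: "d v = 0 \<and> v \<noteq> u" if "v \<in> ?V" "E u v" "D u + c u v < D v" for v
  proof -
    have "D u < D v" using that nonneg[OF u(1) that(1,2)] by linarith
    moreover have "d v = 0"
    proof (rule ccontr)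
      assume "d v \<noteq> 0"
      then have "0 < d v" using dk[OF that(1)] by linarith
      then have "D v \<le> D u" using ord[OF that(1) u(1)] u(2) by blast
      then show False using \<open>D u < D v\<close> by linarith
    qed
    ultimately show ?thesis by auto
  qed
  have same: "D' v = D v" if "v \<in> ?V" "0 < d v \<or> v = u" for v
    using imp[OF that(1)] that D'[OF that(1)] by auto
  have le: "D' v \<le> D v" if "v \<in> ?V" for v using D'[OF that] by auto
  have ge: "D u \<le> D' v" if "v \<in> ?V" "d v = 0" for v
    using D'[OF that(1)] u(3)[OF that] nonneg[OF u(1) that(1)] by auto
  have fin: "finite {v\<in>?V. 0 < d v}" by (rule finite_subset[of _ ?V]) auto
  have set: "{v\<in>?V. 0 < d' v} = insert u {v\<in>?V. 0 < d v}" using d' u k0 by auto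
  show ?thesis
    unfolding dijkstra_def
  proof (intro conjI ballI impI)
    show "int (card {v\<in>?V. 0 < d' v}) = k + 1" unfolding set using k u(2) by (subst card_insert_disjoint[OF fin]) auto
    show "D' b = 0"
    proof -
      have "D b \<le> D u" using Db DK[OF u(1)] by simp
      then show ?thesis using D'[OF b] nonneg[OF u(1) b] Db by auto
    qed
  next
    fix v assume v: "v \<in> ?V"
    show "0 \<le> d' v" "d' v \<le> k + 1" using d'[OF v] dk[OF v] k0 by auto
    show "0 \<le> D' v" using D'[OF v] DK[OF v] DK[OF u(1)] nonneg[OF u(1) v] by auto
    show "D' v \<le> K" using le[OF v] DK[OF v] by simp
  next
    fix x v assume x: "x \<in> ?V" and v: "v \<in> ?V" and dx: "0 < d' x" and e: "E x v"
    show "D' v \<le> D' x + c x v"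
    proof (cases "x = u")
      case True
      then show ?thesis using D'[OF v] same[OF u(1)] e by auto
    next
      case False
      then have "0 < d x" using dx d'[OF x] by simp
      then show ?thesis using relaxed[OF x v _ e] same[OF x] le[OF v] by auto
    qed
  next
    fix x v assume x: "x \<in> ?V" and v: "v \<in> ?V" and dx: "0 < d' x" and dv: "d' v = 0"
    have dv: "d v = 0" using dv d'[OF v] k0 by (auto split: if_splits)
    show "D' x \<le> D' v"
    proof (cases "x = u")
      case True
      then show ?thesis using ge[OF v dv] same[OF u(1)] by auto
    next
      case False
      then have "0 < d x" using dx d'[OF x] by simp
      then show ?thesis using ord[OF x u(1)] u(2) ge[OF v dv] same[OF x] by auto
    qed
  next
    fix v assume v: "v \<in> ?V" and vb: "v \<noteq> b" and vK: "D' v < K"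
    have "pr' v \<in> ?V \<and> 0 < d' (pr' v) \<and> (0 < d' v \<longrightarrow> d' (pr' v) < d' v) \<and> E (pr' v) v \<and>
        D' v = D' (pr' v) + c (pr' v) v"
    proof (cases "E u v \<and> D u + c u v < D v")
      case True
      then have "d v = 0 \<and> v \<noteq> u" using imp[OF v] by blast
      then show ?thesis using True pr'[OF v] D'[OF v] u(1) d'[OF u(1)] d'[OF v] k0 same[OF u(1)] by auto
    next
      case False
      then have eq: "D' v = D v" "pr' v = pr v" using D'[OF v] pr'[OF v] by auto
      then have "D v < K" using vK by simp
      note tr = tree[OF v vb this]
      have "pr v \<noteq> u" using tr u(2) by auto
      then have "d' (pr v) = d (pr v)" "D' (pr v) = D (pr v)" using tr d' same[of "pr v"] by auto
      \<comment> \<open>An old predecessor has position at most \<open>k\<close>, hence precedes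
        \<open>v\<close> even if \<open>v\<close> is the node that receives position
        \<open>k + 1\<close> now.\<close>
      moreover have "0 < d' v \<longrightarrow> d (pr v) < d' v" using tr d'[OF v] dk[of "pr v"] by auto
      ultimately show ?thesis using tr eq by auto
    qed
    then show "pr' v \<in> ?V" "0 < d' (pr' v)" "0 < d' v \<Longrightarrow> d' (pr' v) < d' v" "E (pr' v) v"
        "D' v = D' (pr' v) + c (pr' v) v"
      by blast+
  qed
qed

text \<open>
  Nodes \<open>0, \<dots>, s - 1\<close> are the rows, \<open>s, \<dots>, s + t - 1\<close> the columns, and \<open>s + t\<close> is the root that
  supplies \<open>z v\<close> units of flow to each other node \<open>v\<close>; a pair \<open>(i, j)\<close> of the matching is a unit of flow
  from row \<open>i\<close> to column \<open>s + j\<close>. \<open>E\<close> is the set of residual arcs, \<open>R\<close> their cost, \<open>p\<close> the potential,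
  \<open>X\<close> the set of pairs taken into account so far.
\<close>

locale network =
  fixes s t :: int and w :: "int \<Rightarrow> int \<Rightarrow> real" and L H :: "int \<Rightarrow> int" and C :: real
  assumes s_nonneg: "0 \<le> s" and t_nonneg: "0 \<le> t" and C_pos: "0 < C"
    and L_le_H: "0 \<le> v \<Longrightarrow> v < s + t \<Longrightarrow> L v \<le> H v"
begin

definition residual ::
  "(int \<Rightarrow> int \<Rightarrow> bool) \<Rightarrow> (int \<Rightarrow> int \<Rightarrow> real) \<Rightarrow> (int \<Rightarrow> real) \<Rightarrow> (int \<Rightarrow> int) \<Rightarrow> (int \<times> int) set \<Rightarrow> bool"
where
  "residual E R p z X \<longleftrightarrow>
    (\<forall>u\<in>{0..s+t}. \<forall>v\<in>{0..s+t}. E u v \<longrightarrow> 0 \<le> R u v + p u - p v) \<and>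
    (\<forall>v\<in>{0..<s+t}. E (s+t) v \<and> E v (s+t) \<and>
       R (s+t) v = slope C (L v) (H v) (z v + 1) \<and> R v (s+t) = - slope C (L v) (H v) (z v)) \<and>
    (\<forall>i\<in>{0..<s}. \<forall>j\<in>{s..<s+t}. R i j = w i (j - s) \<and> R j i = - w i (j - s) \<and>
       (if (i, j) \<in> X then E i j \<noteq> E j i else \<not> E i j \<and> \<not> E j i)) \<and>
    (\<forall>i\<in>{0..<s}. \<forall>j\<in>{0..<s}. \<not> E i j) \<and> (\<forall>i\<in>{s..<s+t}. \<forall>j\<in>{s..<s+t}. \<not> E i j) \<and> \<not> E (s+t) (s+t)"

text \<open>The flow is read off the column-to-row arcs, the residual arcs of matched pairs;
  row-to-column arcs carry none. The minus sign at columns makes conservation the same equation,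
  \<open>outflow E v = z v\<close>, on both sides.\<close>

definition outflow :: "(int \<Rightarrow> int \<Rightarrow> bool) \<Rightarrow> int \<Rightarrow> int" where
  "outflow E v = (if v < s then (\<Sum>j=s..<s+t. of_bool (E j v)) else - (\<Sum>i=0..<s. of_bool (E v i)))"

section \<open>Changing potentials, pair set and flow of a residual network\<close>

lemma residual_nonneg:
  "residual E R p z X \<Longrightarrow> E u v \<Longrightarrow> u \<in> {0..s+t} \<Longrightarrow> v \<in> {0..s+t} \<Longrightarrow> 0 \<le> R u v + p u - p v"
  by (simp add: residual_def)

lemma residual_root:
  assumes "residual E R p z X" "v \<in> {0..<s+t}"
  shows "E (s+t) v" "E v (s+t)" "R (s+t) v = slope C (L v) (H v) (z v + 1)"
    "R v (s+t) = - slope C (L v) (H v) (z v)"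
  using assms by (simp_all add: residual_def)

lemma residual_pair:
  assumes "residual E R p z X" "i \<in> {0..<s}" "j \<in> {s..<s+t}"
  shows "R i j = w i (j - s)" "R j i = - w i (j - s)"
    "if (i, j) \<in> X then E i j \<noteq> E j i else \<not> E i j \<and> \<not> E j i"
  using assms by (simp_all add: residual_def)

lemma residual_no_arc:
  assumes "residual E R p z X"
  shows "i \<in> {0..<s} \<Longrightarrow> j \<in> {0..<s} \<Longrightarrow> \<not> E i j"
    "i \<in> {s..<s+t} \<Longrightarrow> j \<in> {s..<s+t} \<Longrightarrow> \<not> E i j"
    "\<not> E (s+t) (s+t)"
  using assms by (simp_all add: residual_def)

lemma outflow_cong:
  assumes "\<And>u v. u \<in> {s..<s+t} \<Longrightarrow> v \<in> {0..<s} \<Longrightarrow> E' u v = E u v" "v \<in> {0..<s+t}"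
  shows "outflow E' v = outflow E v"
proof -
  have "(\<Sum>j=s..<s+t. of_bool (E' j v)) = (\<Sum>j=s..<s+t. of_bool (E j v) :: int)" if "v < s"
    by (rule sum.cong) (use assms that in auto)
  moreover have "(\<Sum>i=0..<s. of_bool (E' v i)) = (\<Sum>i=0..<s. of_bool (E v i) :: int)" if "\<not> v < s"
    by (rule sum.cong) (use assms that in auto)
  ultimately show ?thesis by (simp add: outflow_def)
qed

lemma outflow_flip:
  assumes "\<And>x y. x \<in> {0..<s+t} \<Longrightarrow> y \<in> {0..<s+t} \<Longrightarrow>
      E' x y = (if x = b \<and> y = a then q else E x y)"
    and "a \<in> {0..<s}" "b \<in> {s..<s+t}" "v \<in> {0..<s+t}"
  shows "outflow E' v = outflow E v +
    (if v = a then 1 else if v = b then -1 else 0) * (of_bool q - of_bool (E b a))"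
proof -
  note sum_of_bool_eq [simp del]
  have 1: "(\<Sum>j=s..<s+t. of_bool (E' j a)) =
      (\<Sum>j=s..<s+t. of_bool (E j a) :: int) + (of_bool q - of_bool (E b a))"
  proof -
    have "(\<Sum>j=s..<s+t. of_bool (E' j a) :: int) =
        (\<Sum>j=s..<s+t. of_bool (E j a) + (if j = b then of_bool q - of_bool (E b a) else 0))"
      by (rule sum.cong) (use assms s_nonneg in auto)
    then show ?thesis using assms by (simp add: sum.distrib)
  qed
  have 2: "(\<Sum>i=0..<s. of_bool (E' b i)) =
      (\<Sum>i=0..<s. of_bool (E b i) :: int) + (of_bool q - of_bool (E b a))"
  proof -
    have "(\<Sum>i=0..<s. of_bool (E' b i) :: int) =
        (\<Sum>i=0..<s. of_bool (E b i) + (if i = a then of_bool q - of_bool (E b a) else 0))"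
      by (rule sum.cong) (use assms t_nonneg in auto)
    then show ?thesis using assms by (simp add: sum.distrib)
  qed
  have 3: "(\<Sum>j=s..<s+t. of_bool (E' j v)) = (\<Sum>j=s..<s+t. of_bool (E j v) :: int)" if "v \<noteq> a" "v < s"
    by (rule sum.cong) (use assms that s_nonneg in auto)
  have 4: "(\<Sum>i=0..<s. of_bool (E' v i)) = (\<Sum>i=0..<s. of_bool (E v i) :: int)" if "v \<noteq> b"
    by (rule sum.cong) (use assms that t_nonneg in auto)
  show ?thesis
    using assms(2,3) 1 2 3 4 by (auto simp: outflow_def simp del: sum_of_bool_eq)
qed

text \<open>Adding \<open>D\<close> to the potential turns the triangle inequality for
  \<open>D\<close> into nonnegativity of the new reduced costs.\<close>

lemma residual_shift:
  assumes "residual E R p z X"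
    and "\<And>u v. u \<in> {0..s+t} \<Longrightarrow> v \<in> {0..s+t} \<Longrightarrow> E u v \<Longrightarrow> D v \<le> D u + (R u v + p u - p v)"
    and "\<And>v. v \<in> {0..s+t} \<Longrightarrow> p' v = p v + D v"
  shows "residual E R p' z X"
  using assms(1) unfolding residual_def
  by (elim conjE, intro conjI) (auto simp: assms(3) dest: assms(2)[rotated 2])

text \<open>A pair may enter unmatched (arc from row to column) or matched (the reverse arc). The
  two orientations have opposite reduced costs, so at least one of them is always possible.\<close>

lemma residual_insert:
  assumes res: "residual E R p z X"
    and ij: "i \<in> {0..<s}" "j \<in> {s..<s+t}" "(i, j) \<notin> X"
    and ab: "a = i \<and> b = j \<or> a = j \<and> b = i" "0 \<le> R a b + p a - p b"
    and E': "\<And>x y. x \<in> {0..s+t} \<Longrightarrow> y \<in> {0..s+t} \<Longrightarrow> E' x y = (x = a \<and> y = b \<or> E x y)"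
  shows "residual E' R p z (insert (i, j) X)"
proof -
  have st: "0 \<le> s" "0 \<le> t" by (rule s_nonneg t_nonneg)+
  show ?thesis
    unfolding residual_def
  proof (intro conjI ballI impI)
    fix u v assume uv: "u \<in> {0..s+t}" "v \<in> {0..s+t}" "E' u v"
    then show "0 \<le> R u v + p u - p v" using ab(2) residual_nonneg[OF res] E' by auto
  next
    fix v assume v: "v \<in> {0..<s+t}"
    note r = residual_root[OF res v]
    show "E' (s+t) v" "E' v (s+t)" using r v E' by auto
    show "R (s+t) v = slope C (L v) (H v) (z v + 1)" "R v (s+t) = - slope C (L v) (H v) (z v)"
      using r by auto
  next
    fix x y assume xy: "x \<in> {0..<s}" "y \<in> {s..<s+t}"
    note r = residual_pair[OF res xy] residual_pair(3)[OF res ij(1,2)]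
    show "R x y = w x (y - s)" "R y x = - w x (y - s)" using r by auto
    show "if (x, y) \<in> insert (i, j) X then E' x y \<noteq> E' y x else \<not> E' x y \<and> \<not> E' y x"
      using r xy ij ab(1) st by (auto simp: E' split: if_splits)
  next
    fix x y assume xy: "x \<in> {0..<s}" "y \<in> {0..<s}"
    then show "\<not> E' x y" using residual_no_arc(1)[OF res xy] ij ab(1) st by (auto simp: E')
  next
    fix x y assume xy: "x \<in> {s..<s+t}" "y \<in> {s..<s+t}"
    then show "\<not> E' x y" using residual_no_arc(2)[OF res xy] ij ab(1) st by (auto simp: E')
  next
    show "\<not> E' (s+t) (s+t)" using residual_no_arc(3)[OF res] ij ab(1) st by (auto simp: E')
  qed
qed

lemma residual_arc_cases:
  assumes "residual E R p z X" "E u v" "u \<in> {0..<s+t}" "v \<in> {0..<s+t}"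
  shows "u \<in> {0..<s} \<and> v \<in> {s..<s+t} \<and> (u, v) \<in> X \<and> \<not> E v u \<or>
    v \<in> {0..<s} \<and> u \<in> {s..<s+t} \<and> (v, u) \<in> X \<and> \<not> E v u"
proof -
  consider "u < s" "v < s" | "s \<le> u" "s \<le> v" | "u < s" "s \<le> v" | "v < s" "s \<le> u" by linarith
  then show ?thesis
  proof cases
    case 1
    then show ?thesis using residual_no_arc(1)[OF assms(1), of u v] assms by auto
  next
    case 2
    then show ?thesis using residual_no_arc(2)[OF assms(1), of u v] assms by auto
  next
    case 3
    then show ?thesis using residual_pair(3)[OF assms(1), of u v] assms by (auto split: if_splits)
  next
    case 4
    then show ?thesis using residual_pair(3)[OF assms(1), of v u] assms by (auto split: if_splits)
  qed
qed

text \<open>Costs of a pair are antisymmetric, so the reversal of a tight arc is tight again. The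
  change of \<open>outflow\<close> is the same whether the reversal matches the pair or releases
  it.\<close>

lemma residual_flip_pair:
  assumes res: "residual E R p z X" and uv: "E u v" "u \<in> {0..<s+t}" "v \<in> {0..<s+t}"
    and tight: "R u v + p u - p v = 0"
    and E': "\<And>x y. x \<in> {0..s+t} \<Longrightarrow> y \<in> {0..s+t} \<Longrightarrow>
      E' x y = (x = v \<and> y = u \<or> \<not> (x = u \<and> y = v) \<and> E x y)"
  shows "residual E' R p z X"
    and "x \<in> {0..<s+t} \<Longrightarrow> outflow E' x = outflow E x + of_bool (x = u) - of_bool (x = v)"
proof -
  have st: "0 \<le> s" "0 \<le> t" by (rule s_nonneg t_nonneg)+
  note cs = residual_arc_cases[OF res uv]
  have neg: "R v u = - R u v"
    using cs
  proof (elim disjE conjE)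
    assume 1: "u \<in> {0..<s}" "v \<in> {s..<s+t}" "(u, v) \<in> X" "\<not> E v u"
    show ?thesis using 1 residual_pair(1,2)[OF res, of u v] by simp
  next
    assume 2: "v \<in> {0..<s}" "u \<in> {s..<s+t}" "(v, u) \<in> X" "\<not> E v u"
    show ?thesis using 2 residual_pair(1,2)[OF res, of v u] by simp
  qed
  show "residual E' R p z X"
    unfolding residual_def
  proof (intro conjI ballI impI)
    fix x y assume xy: "x \<in> {0..s+t}" "y \<in> {0..s+t}" "E' x y"
    then show "0 \<le> R x y + p x - p y" using tight neg residual_nonneg[OF res] E' by auto
  next
    fix x assume x: "x \<in> {0..<s+t}"
    note r = residual_root[OF res x]
    show "E' (s+t) x" "E' x (s+t)" using r x uv E' by auto
    show "R (s+t) x = slope C (L x) (H x) (z x + 1)" "R x (s+t) = - slope C (L x) (H x) (z x)"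
      using r by auto
  next
    fix x y assume xy: "x \<in> {0..<s}" "y \<in> {s..<s+t}"
    note r = residual_pair[OF res xy]
    show "R x y = w x (y - s)" "R y x = - w x (y - s)" using r by auto
    show "if (x, y) \<in> X then E' x y \<noteq> E' y x else \<not> E' x y \<and> \<not> E' y x"
      using cs r xy st by (auto simp: E' split: if_splits)
  next
    fix x y assume xy: "x \<in> {0..<s}" "y \<in> {0..<s}"
    then show "\<not> E' x y" using residual_no_arc(1)[OF res xy] cs st by (auto simp: E')
  next
    fix x y assume xy: "x \<in> {s..<s+t}" "y \<in> {s..<s+t}"
    then show "\<not> E' x y" using residual_no_arc(2)[OF res xy] cs st by (auto simp: E')
  next
    show "\<not> E' (s+t) (s+t)" using residual_no_arc(3)[OF res] uv st by (auto simp: E')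
  qed
  assume x: "x \<in> {0..<s+t}"
  show "outflow E' x = outflow E x + of_bool (x = u) - of_bool (x = v)"
    using cs
  proof (elim disjE conjE)
    assume 1: "u \<in> {0..<s}" "v \<in> {s..<s+t}" "(u, v) \<in> X" "\<not> E v u"
    \<comment> \<open>\<open>outflow\<close> inspects column-to-row entries only, so just one of the
      two entries changed by \<open>E'\<close> is visible to it.\<close>
    let ?E = "\<lambda>x y. if x = v \<and> y = u then True else E x y"
    have "outflow E' x = outflow ?E x"
      unfolding outflow_def using 1 x st by (auto simp: E' intro!: sum.cong simp del: sum_of_bool_eq)
    also have "\<dots> = outflow E x + (if x = u then 1 else if x = v then -1 else 0) * (of_bool True - of_bool (E v u))"
      by (rule outflow_flip[OF refl]) (use 1 x in auto)
    finally show ?thesis using 1 by auto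
  next
    assume 2: "v \<in> {0..<s}" "u \<in> {s..<s+t}" "(v, u) \<in> X" "\<not> E v u"
    let ?E = "\<lambda>x y. if x = u \<and> y = v then False else E x y"
    have "outflow E' x = outflow ?E x"
      unfolding outflow_def using 2 x st by (auto simp: E' intro!: sum.cong simp del: sum_of_bool_eq)
    also have "\<dots> = outflow E x + (if x = v then 1 else if x = u then -1 else 0) * (of_bool False - of_bool (E u v))"
      by (rule outflow_flip[OF refl]) (use 2 x in auto)
    finally show ?thesis using 2 uv by auto
  qed
qed

text \<open>Here convexity of the penalty keeps the network consistent. After a unit has moved over
  a tight root arc, the opposite arc becomes tight, while the arc itself is repriced to the next
  slope, which by monotonicity is no cheaper.\<close>

lemma residual_flip_root:
  assumes res: "residual E R p z X" and v: "v \<in> {0..<s+t}"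
    and tight: "k = 1 \<and> R (s+t) v + p (s+t) - p v = 0 \<or> k = -1 \<and> R v (s+t) + p v - p (s+t) = 0"
    and z': "\<And>x. x \<in> {0..<s+t} \<Longrightarrow> z' x = (if x = v then z v + k else z x)"
    and R': "\<And>x y. x \<in> {0..s+t} \<Longrightarrow> y \<in> {0..s+t} \<Longrightarrow> R' x y =
      (if x = s + t \<and> y = v then slope C (L v) (H v) (z v + k + 1)
       else if x = v \<and> y = s + t then - slope C (L v) (H v) (z v + k) else R x y)"
  shows "residual E R' p z' X"
proof -
  have st: "0 \<le> s" "0 \<le> t" by (rule s_nonneg t_nonneg)+
  let ?g = "slope C (L v) (H v)"
  note rv = residual_root[OF res v]
  have mono: "?g (z v - 1) \<le> ?g (z v)" "?g (z v) \<le> ?g (z v + 1)" "?g (z v + 1) \<le> ?g (z v + 2)"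
    using C_pos by (auto intro: slope_mono)
  show ?thesis
    unfolding residual_def
  proof (intro conjI ballI impI)
    fix x y assume xy: "x \<in> {0..s+t}" "y \<in> {0..s+t}" "E x y"
    show "0 \<le> R' x y + p x - p y"
      using tight rv mono residual_nonneg[OF res xy(3,1,2)] v by (auto simp: R'[OF xy(1,2)] add.assoc)
  next
    fix x assume x: "x \<in> {0..<s+t}"
    note r = residual_root[OF res x]
    show "E (s+t) x" "E x (s+t)" using r by auto
    show "R' (s+t) x = slope C (L x) (H x) (z' x + 1)" "R' x (s+t) = - slope C (L x) (H x) (z' x)"
      using r x st by (auto simp: R' z')
  next
    fix x y assume xy: "x \<in> {0..<s}" "y \<in> {s..<s+t}"
    note r = residual_pair[OF res xy]
    show "R' x y = w x (y - s)" "R' y x = - w x (y - s)" using r xy by (auto simp: R')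
    show "if (x, y) \<in> X then E x y \<noteq> E y x else \<not> E x y \<and> \<not> E y x"
      using r by simp
  qed (use residual_no_arc[OF res] in auto)
qed

lemma sum_shift: "(\<Sum>j=s..<s+t. f j) = (\<Sum>j=0..<t. f (s + j))" for f :: "int \<Rightarrow> 'c::comm_monoid_add"
  by (rule sum.reindex_bij_witness[of _ "\<lambda>j. s + j" "\<lambda>j. j - s"]) auto

text \<open>
  Weak duality: the reduced cost certificate bounds the penalized cost of every other matching,
  since the root-relative potential of \<open>v\<close> is a subgradient of the penalty at \<open>z v\<close>.
\<close>

lemma penalized_optimal:
  fixes m' :: "int \<Rightarrow> int \<Rightarrow> bool"
  defines "row i \<equiv> \<Sum>j=0..<t. of_bool (m' i j) :: int"
    and "col j \<equiv> - (\<Sum>i=0..<s. of_bool (m' i j) :: int)"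
  assumes res: "residual E R p z ({0..<s} \<times> {s..<s+t})"
    and sup: "\<And>v. v \<in> {0..<s+t} \<Longrightarrow> outflow E v = z v"
  shows "(\<Sum>i=0..<s. \<Sum>j=0..<t. of_bool (E (s + j) i) * w i j)
      + C * ((\<Sum>i=0..<s. violation (L i) (H i) (z i)) + (\<Sum>j=0..<t. violation (L (s+j)) (H (s+j)) (z (s+j))))
    \<le> (\<Sum>i=0..<s. \<Sum>j=0..<t. of_bool (m' i j) * w i j)
      + C * ((\<Sum>i=0..<s. violation (L i) (H i) (row i)) + (\<Sum>j=0..<t. violation (L (s+j)) (H (s+j)) (col j)))"
proof -
  define q where "q v = p v - p (s+t)" for v
  define d :: "int \<Rightarrow> int \<Rightarrow> real" where "d i j = of_bool (m' i j) - of_bool (E (s + j) i)" for i j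
  have zrow: "z i = (\<Sum>j=0..<t. of_bool (E (s + j) i))" if "i \<in> {0..<s}" for i
    using sup[of i] that t_nonneg by (simp add: outflow_def sum_shift)
  have zcol: "z (s + j) = - (\<Sum>i=0..<s. of_bool (E (s + j) i))" if "j \<in> {0..<t}" for j
    using sup[of "s + j"] that s_nonneg by (simp add: outflow_def)
  have sub: "C * violation (L v) (H v) (z v) + real_of_int (z' - z v) * q v \<le> C * violation (L v) (H v) z'"
    if "v \<in> {0..<s+t}" for v z'
  proof (rule violation_subgradient)
    note r = residual_root[OF res that]
    show "slope C (L v) (H v) (z v) \<le> q v"
      using residual_nonneg[OF res r(2)] r that by (auto simp: q_def)
    show "q v \<le> slope C (L v) (H v) (z v + 1)"
      using residual_nonneg[OF res r(1)] r that by (auto simp: q_def)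
  qed (use C_pos L_le_H that in auto)
  \<comment> \<open>Complementary slackness: an unmatched pair has \<open>d i j \<ge> 0\<close> and
    a nonnegative reduced cost from row to column; for a matched pair both signs are
    reversed.\<close>
  have pair: "d i j * (q (s + j) - q i) \<le> d i j * w i j" if ij: "i \<in> {0..<s}" "j \<in> {0..<t}" for i j
  proof -
    have m: "s + j \<in> {s..<s+t}" "i \<in> {0..s+t}" "s + j \<in> {0..s+t}" using ij s_nonneg by auto
    note * = residual_pair[OF res ij(1) m(1)]
    have x: "E i (s+j) \<noteq> E (s+j) i" using *(3) ij by simp
    have "E i (s+j) \<Longrightarrow> 0 \<le> w i j + p i - p (s+j)"
      using residual_nonneg[OF res _ m(2,3)] * by simp
    moreover have "E (s+j) i \<Longrightarrow> 0 \<le> - w i j + p (s+j) - p i"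
      using residual_nonneg[OF res _ m(3,2)] * by simp
    ultimately show ?thesis using x by (auto simp: d_def q_def)
  qed
  have "(\<Sum>i=0..<s. \<Sum>j=0..<t. d i j * (q (s + j) - q i)) \<le> (\<Sum>i=0..<s. \<Sum>j=0..<t. d i j * w i j)"
    by (intro sum_mono pair)
  \<comment> \<open>Summation by parts: regrouped by nodes, the potential differences are weighted
    with the changes of the degrees, which is what \<open>sub\<close> speaks about.\<close>
  also have "(\<Sum>i=0..<s. \<Sum>j=0..<t. d i j * (q (s + j) - q i)) =
      (\<Sum>j=0..<t. (\<Sum>i=0..<s. d i j) * q (s + j)) - (\<Sum>i=0..<s. (\<Sum>j=0..<t. d i j) * q i)"
    by (subst sum.swap)
      (simp add: sum_subtractf right_diff_distrib sum_distrib_right sum.swap[of _ "{0..<s}" "{0..<t}"])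
  also have "(\<Sum>j=0..<t. (\<Sum>i=0..<s. d i j) * q (s + j)) =
      - (\<Sum>j=0..<t. real_of_int (col j - z (s + j)) * q (s + j))"
    unfolding sum_negf[symmetric]
  proof (rule sum.cong[OF refl])
    fix j assume "j \<in> {0..<t}"
    from zcol[OF this] have "real_of_int (z (s + j)) = - (\<Sum>i=0..<s. of_bool (E (s + j) i))"
      by (simp del: sum_of_bool_eq)
    then show "(\<Sum>i=0..<s. d i j) * q (s + j) = - (real_of_int (col j - z (s + j)) * q (s + j))"
      by (simp add: col_def d_def sum_subtractf left_diff_distrib del: sum_of_bool_eq)
  qed
  also have "(\<Sum>i=0..<s. (\<Sum>j=0..<t. d i j) * q i) = (\<Sum>i=0..<s. real_of_int (row i - z i) * q i)"
    by (rule sum.cong) (simp_all add: zrow row_def d_def sum_subtractf del: sum_of_bool_eq)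
  finally have A: "- (\<Sum>j=0..<t. real_of_int (col j - z (s + j)) * q (s + j))
      - (\<Sum>i=0..<s. real_of_int (row i - z i) * q i) \<le> (\<Sum>i=0..<s. \<Sum>j=0..<t. d i j * w i j)" .
  have B: "(\<Sum>i=0..<s. C * violation (L i) (H i) (z i)) + (\<Sum>i=0..<s. real_of_int (row i - z i) * q i)
      \<le> (\<Sum>i=0..<s. C * violation (L i) (H i) (row i))"
    unfolding sum.distrib[symmetric] by (intro sum_mono sub) (use t_nonneg in auto)
  have D: "(\<Sum>j=0..<t. C * violation (L (s+j)) (H (s+j)) (z (s+j)))
        + (\<Sum>j=0..<t. real_of_int (col j - z (s + j)) * q (s + j))
      \<le> (\<Sum>j=0..<t. C * violation (L (s+j)) (H (s+j)) (col j))"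
    unfolding sum.distrib[symmetric] by (intro sum_mono sub) (use s_nonneg in auto)
  have "(\<Sum>i=0..<s. \<Sum>j=0..<t. d i j * w i j) =
      (\<Sum>i=0..<s. \<Sum>j=0..<t. of_bool (m' i j) * w i j) - (\<Sum>i=0..<s. \<Sum>j=0..<t. of_bool (E (s + j) i) * w i j)"
    by (simp add: d_def left_diff_distrib sum_subtractf)
  with A B D show ?thesis by (simp add: distrib_left sum_distrib_left)
qed

end

section \<open>Shortest paths and augmentation\<close>

definition Pairs :: "com \<Rightarrow> com" where
  "Pairs P = Seq (iset ''q'' (IConst 0)) (For ''i'' ''s'' (For ''j'' ''t''
     (Seq P (iset ''q'' (IPlus (ivar ''q'') (IConst 1))))))"

lemma iwrites_Pairs [simp]: "iwrites (Pairs P) = {''i'', ''j'', ''q''} \<union> iwrites P"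
  by (auto simp: Pairs_def)

lemma rwrites_Pairs [simp]: "rwrites (Pairs P) = rwrites P"
  by (auto simp: Pairs_def)

text \<open>\<open>q\<close> runs through the addresses \<open>i * t + j\<close> by increments
  alone. \<open>wrap\<close> identifies the end of a row with the start of the next, so one
  invariant serves both loops.\<close>

lemma wp_Pairs:
  assumes st: "imem \<sigma> ''s'' 0 = s" "imem \<sigma> ''t'' 0 = t" "0 \<le> s" "0 \<le> t"
    and names: "iwrites P \<inter> {''i'', ''j'', ''q'', ''s'', ''t''} = {}"
    and stable: "\<And>i j \<tau> x v. I i j \<tau> \<Longrightarrow> x \<in> {''i'', ''j'', ''q''} \<Longrightarrow> I i j (iupdate x 0 v \<tau>)"
    and wrap: "\<And>i \<tau>. 0 \<le> i \<Longrightarrow> i < s \<Longrightarrow> I i t \<tau> \<Longrightarrow> I (i + 1) 0 \<tau>"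
    and init: "I 0 0 \<sigma>"
    and step: "\<And>i j \<tau>. 0 \<le> i \<Longrightarrow> i < s \<Longrightarrow> 0 \<le> j \<Longrightarrow> j < t \<Longrightarrow> imem \<tau> ''i'' 0 = i \<Longrightarrow> imem \<tau> ''j'' 0 = j \<Longrightarrow>
        imem \<tau> ''q'' 0 = i * t + j \<Longrightarrow> agree ({''i'', ''j'', ''q''} \<union> iwrites P) (rwrites P) \<sigma> \<tau> \<Longrightarrow>
        I i j \<tau> \<Longrightarrow> wp P (\<lambda>k \<tau>'. k \<le> B \<and> I i (j + 1) \<tau>') \<tau>"
    and exit: "\<And>k \<tau>. I s 0 \<tau> \<Longrightarrow> k \<le> 12 + nat s * (21 + nat t * (18 + B)) \<Longrightarrow>
        agree ({''i'', ''j'', ''q''} \<union> iwrites P) (rwrites P) \<sigma> \<tau> \<Longrightarrow> Q k \<tau>"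
  shows "wp (Pairs P) Q \<sigma>"
proof -
  let ?P = "Seq P (iset ''q'' (IPlus (ivar ''q'') (IConst 1)))"
  let ?X = "{''i'', ''j'', ''q''} \<union> iwrites P"
  let ?\<sigma> = "iupdate ''q'' 0 0 \<sigma>"
  have nm: "''i'' \<notin> iwrites P" "''j'' \<notin> iwrites P" "''q'' \<notin> iwrites P" "''s'' \<notin> iwrites P" "''t'' \<notin> iwrites P"
    using names by auto
  have "wp (For ''i'' ''s'' (For ''j'' ''t'' ?P)) (\<lambda>k. Q (3 + k)) ?\<sigma>"
  proof (rule wp_For[where n = s and I = "\<lambda>i \<tau>. I i 0 \<tau> \<and> imem \<tau> ''q'' 0 = i * t" and B = "9 + nat t * (18 + B)"])
    fix i \<tau> assume i: "0 \<le> i" "i < s" "imem \<tau> ''i'' 0 = i"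
      and a: "agree (insert ''i'' (iwrites (For ''j'' ''t'' ?P))) (rwrites (For ''j'' ''t'' ?P)) ?\<sigma> \<tau>"
      and I: "I i 0 \<tau> \<and> imem \<tau> ''q'' 0 = i * t"
    show "wp (For ''j'' ''t'' ?P) (\<lambda>k \<tau>'. k \<le> 9 + nat t * (18 + B) \<and>
        I (i + 1) 0 \<tau>' \<and> imem \<tau>' ''q'' 0 = (i + 1) * t) \<tau>"
    proof (rule wp_For[where n = t and I = "\<lambda>j \<tau>. I i j \<tau> \<and> imem \<tau> ''q'' 0 = i * t + j" and B = "6 + B"])
      show "imem \<tau> ''t'' 0 = t" using agree_imem[OF a, of "''t''"] nm st by simp
    next
      fix j \<tau>' assume j: "0 \<le> j" "j < t" "imem \<tau>' ''j'' 0 = j"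
        and a': "agree (insert ''j'' (iwrites ?P)) (rwrites ?P) \<tau> \<tau>'"
        and J: "I i j \<tau>' \<and> imem \<tau>' ''q'' 0 = i * t + j"
      have "agree ?X (rwrites P) ?\<sigma> \<tau>'"
        by (rule agree_trans[OF agree_mono[OF a] agree_mono[OF a']]) auto
      then have aa: "agree ?X (rwrites P) \<sigma> \<tau>'" by (auto simp: agree_def)
      have "imem \<tau>' ''i'' 0 = i" using agree_imem[OF a', of "''i''"] nm i by simp
      from wp_agree[OF step[OF i(1,2) j(1,2) this j(3) _ aa]] J
      have w: "wp P (\<lambda>k \<tau>''. (k \<le> B \<and> I i (j + 1) \<tau>'') \<and> agree (iwrites P) (rwrites P) \<tau>' \<tau>'') \<tau>'" by simp
      show "wp ?P (\<lambda>k \<tau>'. k \<le> 6 + B \<and> I i (j + 1) \<tau>' \<and> imem \<tau>' ''q'' 0 = i * t + (j + 1)) \<tau>'"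
        unfolding wp_Seq
      proof (rule wp_mono[OF w], elim conjE)
        fix k \<tau>'' assume k: "k \<le> B" "I i (j + 1) \<tau>''" "agree (iwrites P) (rwrites P) \<tau>' \<tau>''"
        have "imem \<tau>'' ''q'' 0 = i * t + j" using agree_imem[OF k(3), of "''q''"] nm J by simp
        then show "wp (iset ''q'' (IPlus (ivar ''q'') (IConst 1)))
             (\<lambda>l \<tau>'. k + l \<le> 6 + B \<and> I i (j + 1) \<tau>' \<and> imem \<tau>' ''q'' 0 = i * t + (j + 1)) \<tau>''"
          using k stable by simp
      qed
    next
      fix k \<tau>' assume "I i t \<tau>' \<and> imem \<tau>' ''q'' 0 = i * t + t" "k \<le> 9 + nat t * (12 + (6 + B))"
      then show "k \<le> 9 + nat t * (18 + B) \<and> I (i + 1) 0 \<tau>' \<and> imem \<tau>' ''q'' 0 = (i + 1) * t"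
        using wrap[OF i(1,2), of \<tau>'] by (simp add: algebra_simps)
    qed (use I nm st stable in auto)
  next
    fix k \<tau> assume "I s 0 \<tau> \<and> imem \<tau> ''q'' 0 = s * t" "k \<le> 9 + nat s * (12 + (9 + nat t * (18 + B)))"
      and a: "agree (insert ''i'' (iwrites (For ''j'' ''t'' ?P))) (rwrites (For ''j'' ''t'' ?P)) ?\<sigma> \<tau>"
    moreover have "agree ?X (rwrites P) \<sigma> \<tau>" using a by (auto simp: agree_def)
    ultimately show "Q (3 + k) \<tau>" using exit by (simp add: algebra_simps)
  qed (use st nm init stable in auto)
  then show ?thesis by (simp add: Pairs_def wp_Seq numeral_3_eq_3)
qed

text \<open>\<open>-1\<close> in \<open>u\<close> says that there is no candidate yet. The inner
  negations spell a disjunction: no candidate, or a label smaller than the candidate's. The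
  comparison is total even then, because every integer is a valid address.\<close>

definition scan :: com where
  "scan = Seq (iset ''u'' (IConst (-1))) (For ''v'' ''N''
     (Cond (BAnd (BNot (ILess (IConst 0) (ICell ''d'' (ivar ''v''))))
        (BNot (BAnd (BNot (ILess (ivar ''u'') (IConst 0)))
           (BNot (RLess (RCell ''D'' (ivar ''v'')) (RCell ''D'' (ivar ''u'')))))))
       (iset ''u'' (ivar ''v'')) Skip))"

lemma iwrites_scan [simp]: "iwrites scan = {''u'', ''v''}" and rwrites_scan [simp]: "rwrites scan = {}"
  by (auto simp: scan_def)

lemma wp_scan:
  assumes N: "imem \<sigma> ''N'' 0 = N" and d: "\<And>v. v \<in> {0..<N} \<Longrightarrow> 0 \<le> imem \<sigma> ''d'' v"
    and ex: "\<exists>v\<in>{0..<N}. imem \<sigma> ''d'' v = 0"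
  shows "wp scan (\<lambda>k \<tau>. k \<le> 12 + 52 * nat N \<and> imem \<tau> ''u'' 0 \<in> {0..<N} \<and> imem \<sigma> ''d'' (imem \<tau> ''u'' 0) = 0 \<and>
      (\<forall>v\<in>{0..<N}. imem \<sigma> ''d'' v = 0 \<longrightarrow> rmem \<sigma> ''D'' (imem \<tau> ''u'' 0) \<le> rmem \<sigma> ''D'' v)) \<sigma>"
proof -
  let ?u = "\<lambda>\<tau>. imem \<tau> ''u'' 0" and ?d = "imem \<sigma> ''d''" and ?D = "rmem \<sigma> ''D''"
  have "0 \<le> N" using ex by auto
  show ?thesis
    unfolding scan_def wp_Seq wp_IAssign
  proof (rule wp_For[where n = N and B = 40 and I = "\<lambda>i \<tau>.
        ?u \<tau> = -1 \<and> (\<forall>v\<in>{0..<i}. ?d v \<noteq> 0) \<or>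
        ?u \<tau> \<in> {0..<i} \<and> ?d (?u \<tau>) = 0 \<and> (\<forall>v\<in>{0..<i}. ?d v = 0 \<longrightarrow> ?D (?u \<tau>) \<le> ?D v)"], goal_cases)
    case (8 i \<tau>)
    have e: "imem \<tau> ''d'' = ?d" "rmem \<tau> ''D'' = ?D" using 8(4) by (simp_all add: agree_def)
    have di: "0 < ?d i \<longleftrightarrow> ?d i \<noteq> 0" using d[of i] 8 by auto
    have S: "{0..<i+1} = insert i {0..<i}" using 8(1) by auto
    show ?case
      using 8(5,1,3) by (auto simp: e di S not_less)
  next
    case (9 k \<tau>)
    then show ?case using ex by auto
  qed (use N \<open>0 \<le> N\<close> in auto)
qed

definition residual_cost :: "iexp \<Rightarrow> iexp \<Rightarrow> rexp" where
  "residual_cost u v = RMinus (RPlus (RCell ''R'' (IPlus (ICell ''off'' u) v)) (RCell ''p'' u)) (RCell ''p'' v)"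

definition relax :: com where
  "relax = For ''v'' ''N''
     (Cond (BAnd (ILess (IConst 0) (ICell ''E'' (IPlus (ICell ''off'' (ivar ''u'')) (ivar ''v''))))
         (RLess (RPlus (RCell ''D'' (ivar ''u'')) (residual_cost (ivar ''u'') (ivar ''v''))) (RCell ''D'' (ivar ''v''))))
       (Seq (RAssign ''D'' (ivar ''v'') (RPlus (RCell ''D'' (ivar ''u'')) (residual_cost (ivar ''u'') (ivar ''v''))))
          (IAssign ''pr'' (ivar ''v'') (ivar ''u''))) Skip)"

lemma iwrites_relax [simp]: "iwrites relax = {''v'', ''pr''}" and rwrites_relax [simp]: "rwrites relax = {''D''}"
  by (auto simp: relax_def)

text \<open>Filling all labels with \<open>K\<close> at the start already implements the cap: a path
  of length \<open>K\<close> or more never improves a label.\<close>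

definition search :: com where
  "search = Seq (For ''v'' ''N'' (Seq (RAssign ''D'' (ivar ''v'') (rvar ''K'')) (IAssign ''d'' (ivar ''v'') (IConst 0))))
     (Seq (RAssign ''D'' (ivar ''b'') (RConst 0))
     (For ''k'' ''N'' (Seq scan
        (Seq (IAssign ''d'' (ivar ''u'') (IPlus (ivar ''k'') (IConst 1))) relax))))"

lemma iwrites_search [simp]: "iwrites search = {''v'', ''d'', ''k'', ''u'', ''pr''}"
  and rwrites_search [simp]: "rwrites search = {''D''}"
  by (auto simp: search_def)

context network
begin

definition cell :: "int \<Rightarrow> int \<Rightarrow> int" where "cell u v = u * (s + t + 1) + v"

lemma cell_0_add [simp]: "cell u 0 + v = cell u v"
  by (simp add: cell_def)

lemma cell_eq_iff [simp]:
  assumes "v \<in> {0..s+t}" "y \<in> {0..s+t}"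
  shows "cell u v = cell x y \<longleftrightarrow> u = x \<and> v = y"
proof
  assume "cell u v = cell x y"
  then have "cell u v div (s+t+1) = cell x y div (s+t+1)" "cell u v mod (s+t+1) = cell x y mod (s+t+1)"
    by simp_all
  then show "u = x \<and> v = y" using assms by (simp_all add: cell_def)
qed simp

text \<open>The part of the store that stays fixed once setup is over: sizes, address table, penalty
  weight and degree intervals. Later commands preserve it by their footprints.\<close>

definition ready :: "store \<Rightarrow> bool" where
  "ready \<sigma> \<longleftrightarrow> imem \<sigma> ''s'' 0 = s \<and> imem \<sigma> ''t'' 0 = t \<and> imem \<sigma> ''N'' 0 = s + t + 1 \<and> imem \<sigma> ''r'' 0 = s + t \<and>
    (\<forall>v\<in>{0..s+t}. imem \<sigma> ''off'' v = cell v 0) \<and> rmem \<sigma> ''big'' 0 = C \<and>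
    (\<forall>v\<in>{0..<s+t}. imem \<sigma> ''L'' v = L v \<and> imem \<sigma> ''H'' v = H v)"

lemma ready_agree:
  assumes "ready \<sigma>" "agree X Y \<sigma> \<tau>" "X \<inter> {''s'', ''t'', ''N'', ''r'', ''off'', ''L'', ''H''} = {}" "''big'' \<notin> Y"
  shows "ready \<tau>"
proof -
  have "imem \<tau> x = imem \<sigma> x" if "x \<in> {''s'', ''t'', ''N'', ''r'', ''off'', ''L'', ''H''}" for x
    using assms(2,3) that by (auto simp: agree_def)
  moreover have "rmem \<tau> ''big'' = rmem \<sigma> ''big''" using assms by (simp add: agree_def)
  ultimately show ?thesis using assms(1) by (simp add: ready_def)
qed

abbreviation arc :: "store \<Rightarrow> int \<Rightarrow> int \<Rightarrow> bool" where
  "arc \<sigma> u v \<equiv> 0 < imem \<sigma> ''E'' (cell u v)"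

abbreviation arc_cost :: "store \<Rightarrow> int \<Rightarrow> int \<Rightarrow> real" where
  "arc_cost \<sigma> u v \<equiv> rmem \<sigma> ''R'' (cell u v)"

abbreviation reduced :: "store \<Rightarrow> int \<Rightarrow> int \<Rightarrow> real" where
  "reduced \<sigma> u v \<equiv> arc_cost \<sigma> u v + rmem \<sigma> ''p'' u - rmem \<sigma> ''p'' v"

text \<open>The loop rereads \<open>D u\<close> at every \<open>v\<close>. Hypothesis
  \<open>loop\<close> prevents \<open>u\<close> from improving its own label, so all comparisons
  refer to the same value and the updates act as if simultaneous.\<close>

lemma wp_relax:
  assumes ready: "ready \<sigma>" and u: "imem \<sigma> ''u'' 0 = u" "u \<in> {0..s+t}"
    and loop: "arc \<sigma> u u \<Longrightarrow> 0 \<le> reduced \<sigma> u u"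
  shows "wp relax (\<lambda>k \<tau>. k \<le> 9 + 92 * nat (s+t+1) \<and> (\<forall>v\<in>{0..s+t}.
     rmem \<tau> ''D'' v = (if arc \<sigma> u v \<and> rmem \<sigma> ''D'' u + reduced \<sigma> u v < rmem \<sigma> ''D'' v
       then rmem \<sigma> ''D'' u + reduced \<sigma> u v else rmem \<sigma> ''D'' v) \<and>
     imem \<tau> ''pr'' v = (if arc \<sigma> u v \<and> rmem \<sigma> ''D'' u + reduced \<sigma> u v < rmem \<sigma> ''D'' v
       then u else imem \<sigma> ''pr'' v))) \<sigma>"
proof -
  let ?b = "\<lambda>v. arc \<sigma> u v \<and> rmem \<sigma> ''D'' u + reduced \<sigma> u v < rmem \<sigma> ''D'' v"
  show ?thesis
    unfolding relax_def
  proof (rule wp_For[where n = "s+t+1" and B = 80 and I = "\<lambda>i \<tau>. \<forall>v\<in>{0..s+t}.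
      rmem \<tau> ''D'' v = (if v < i \<and> ?b v then rmem \<sigma> ''D'' u + reduced \<sigma> u v else rmem \<sigma> ''D'' v) \<and>
      imem \<tau> ''pr'' v = (if v < i \<and> ?b v then u else imem \<sigma> ''pr'' v)"], goal_cases)
    case (8 i \<tau>)
    have i: "i \<in> {0..s+t}" using 8 by auto
    have e: "imem \<tau> ''E'' = imem \<sigma> ''E''" "imem \<tau> ''u'' 0 = u" "imem \<tau> ''off'' u = cell u 0"
      "rmem \<tau> ''R'' = rmem \<sigma> ''R''" "rmem \<tau> ''p'' = rmem \<sigma> ''p''"
      using 8(4) u ready by (simp_all add: agree_def ready_def)
    have Du: "rmem \<tau> ''D'' u = rmem \<sigma> ''D'' u" using bspec[OF 8(5) u(2)] loop by auto
    have Di: "rmem \<tau> ''D'' i = rmem \<sigma> ''D'' i" using bspec[OF 8(5) i] by simp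
    show ?case
      using 8(5) by (auto simp: wp_Seq residual_cost_def e 8(3) Du Di)
  next
    case (9 k \<tau>)
    then show ?case by (simp add: algebra_simps)
  qed (use ready s_nonneg t_nonneg in \<open>auto simp: ready_def\<close>)
qed

lemma wp_search:
  assumes ready: "ready \<sigma>" and b: "imem \<sigma> ''b'' 0 = b" "b \<in> {0..s+t}" and K: "rmem \<sigma> ''K'' 0 = K" "0 < K"
    and nonneg: "\<And>x y. x \<in> {0..s+t} \<Longrightarrow> y \<in> {0..s+t} \<Longrightarrow> arc \<sigma> x y \<Longrightarrow> 0 \<le> reduced \<sigma> x y"
  shows "wp search (\<lambda>k \<tau>. k \<le> 300 * (nat (s+t+1) + 1)^2 \<and>
    dijkstra (s+t+1) (arc \<sigma>) (reduced \<sigma>) b K (s+t+1) (rmem \<tau> ''D'') (imem \<tau> ''d'') (imem \<tau> ''pr'')) \<sigma>"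
proof -
  let ?N = "s+t+1"
  have V: "{0..<?N} = {0..s+t}" by auto
  have N0: "0 \<le> ?N" using s_nonneg t_nonneg by simp
  let ?body = "Seq scan (Seq (IAssign ''d'' (ivar ''u'') (IPlus (ivar ''k'') (IConst 1))) relax)"
  have body: "wp ?body (\<lambda>l \<tau>'. l \<le> 30 + 150 * nat ?N \<and>
      dijkstra ?N (arc \<sigma>) (reduced \<sigma>) b K (i + 1) (rmem \<tau>' ''D'') (imem \<tau>' ''d'') (imem \<tau>' ''pr'')) \<tau>"
    if i: "0 \<le> i" "i < ?N" "imem \<tau> ''k'' 0 = i"
      and a: "agree {''v'', ''d'', ''k'', ''u'', ''pr''} {''D''} \<sigma> \<tau>"
      and dij: "dijkstra ?N (arc \<sigma>) (reduced \<sigma>) b K i (rmem \<tau> ''D'') (imem \<tau> ''d'') (imem \<tau> ''pr'')" for i \<tau>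
  proof (rule wp_SeqI[OF wp_scan[of _ ?N]])
    have ready': "ready \<tau>" by (rule ready_agree[OF ready a]) auto
    then show "imem \<tau> ''N'' 0 = ?N" by (simp add: ready_def)
    show "\<And>v. v \<in> {0..<?N} \<Longrightarrow> 0 \<le> imem \<tau> ''d'' v" using dij by (simp add: dijkstra_def)
    show "\<exists>v\<in>{0..<?N}. imem \<tau> ''d'' v = 0" using dijkstra_unscanned[OF dij i(2)] .
    fix k1 \<tau>1
    assume k1: "k1 \<le> 12 + 52 * nat ?N"
      and u: "imem \<tau>1 ''u'' 0 \<in> {0..<?N} \<and> imem \<tau> ''d'' (imem \<tau>1 ''u'' 0) = 0 \<and>
      (\<forall>v\<in>{0..<?N}. imem \<tau> ''d'' v = 0 \<longrightarrow> rmem \<tau> ''D'' (imem \<tau>1 ''u'' 0) \<le> rmem \<tau> ''D'' v)"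
      and a1: "agree (iwrites scan) (rwrites scan) \<tau> \<tau>1"
    define u where "u = imem \<tau>1 ''u'' 0"
    \<comment> \<open>Scanning positions start at 1, since 0 marks an unscanned node.\<close>
    define \<tau>2 where "\<tau>2 = iupdate ''d'' u (i + 1) \<tau>1"
    have k_eq: "imem \<tau>1 ''k'' 0 = i" using a1 i by (simp add: agree_def)
    have a2: "agree {''v'', ''d'', ''k'', ''u'', ''pr''} {''D''} \<sigma> \<tau>2"
      using a a1 by (simp add: agree_def \<tau>2_def)
    have e: "imem \<tau>2 ''E'' = imem \<sigma> ''E''" "rmem \<tau>2 ''R'' = rmem \<sigma> ''R''" "rmem \<tau>2 ''p'' = rmem \<sigma> ''p''"
      "rmem \<tau>2 ''D'' = rmem \<tau> ''D''" "imem \<tau>2 ''pr'' = imem \<tau> ''pr''"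
      "imem \<tau>2 ''d'' = (imem \<tau> ''d'')(u := i + 1)" "imem \<tau>2 ''u'' 0 = u"
      using a a1 by (simp_all add: agree_def \<tau>2_def u_def)
    have uV: "u \<in> {0..<?N}" "u \<in> {0..s+t}" using u by (auto simp: u_def)
    have "wp relax (\<lambda>l \<tau>'. (l \<le> 9 + 92 * nat ?N \<and> (\<forall>v\<in>{0..s+t}.
       rmem \<tau>' ''D'' v = (if arc \<tau>2 u v \<and> rmem \<tau>2 ''D'' u + reduced \<tau>2 u v < rmem \<tau>2 ''D'' v
         then rmem \<tau>2 ''D'' u + reduced \<tau>2 u v else rmem \<tau>2 ''D'' v) \<and>
       imem \<tau>' ''pr'' v = (if arc \<tau>2 u v \<and> rmem \<tau>2 ''D'' u + reduced \<tau>2 u v < rmem \<tau>2 ''D'' v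
         then u else imem \<tau>2 ''pr'' v))) \<and> agree (iwrites relax) (rwrites relax) \<tau>2 \<tau>') \<tau>2"
      by (rule wp_agree, rule wp_relax) (use ready_agree[OF ready a2] e nonneg[OF uV(2) uV(2)] uV in auto)
    then have "wp relax (\<lambda>l \<tau>'. k1 + (7 + l) \<le> 30 + 150 * nat ?N \<and>
      dijkstra ?N (arc \<sigma>) (reduced \<sigma>) b K (i + 1) (rmem \<tau>' ''D'') (imem \<tau>' ''d'') (imem \<tau>' ''pr'')) \<tau>2"
    proof (rule wp_mono, elim conjE, intro conjI)
      fix l \<tau>' assume l: "l \<le> 9 + 92 * nat ?N"
      then show "k1 + (7 + l) \<le> 30 + 150 * nat ?N" using k1 by simp
    next
      fix l \<tau>'
      assume new: "\<forall>v\<in>{0..s+t}.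
       rmem \<tau>' ''D'' v = (if arc \<tau>2 u v \<and> rmem \<tau>2 ''D'' u + reduced \<tau>2 u v < rmem \<tau>2 ''D'' v
         then rmem \<tau>2 ''D'' u + reduced \<tau>2 u v else rmem \<tau>2 ''D'' v) \<and>
       imem \<tau>' ''pr'' v = (if arc \<tau>2 u v \<and> rmem \<tau>2 ''D'' u + reduced \<tau>2 u v < rmem \<tau>2 ''D'' v
         then u else imem \<tau>2 ''pr'' v)"
        and a': "agree (iwrites relax) (rwrites relax) \<tau>2 \<tau>'"
      have d': "imem \<tau>' ''d'' = (imem \<tau> ''d'')(u := i + 1)" using a' e by (simp add: agree_def)
      show "dijkstra ?N (arc \<sigma>) (reduced \<sigma>) b K (i + 1) (rmem \<tau>' ''D'') (imem \<tau>' ''d'') (imem \<tau>' ''pr'')"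
      proof (rule dijkstra_step[OF dij, where u = u])
        show "\<And>v. v \<in> {0..<?N} \<Longrightarrow> imem \<tau> ''d'' v = 0 \<Longrightarrow> rmem \<tau> ''D'' u \<le> rmem \<tau> ''D'' v"
          "imem \<tau> ''d'' u = 0" using u by (auto simp: u_def)
        show "\<And>x y. x \<in> {0..<?N} \<Longrightarrow> y \<in> {0..<?N} \<Longrightarrow> arc \<sigma> x y \<Longrightarrow> 0 \<le> reduced \<sigma> x y"
          using nonneg unfolding V .
        show "b \<in> {0..<?N}" using b V by simp
      qed (use uV d' new e in \<open>auto simp: V\<close>)
    qed
    then show "wp (Seq (IAssign ''d'' (ivar ''u'') (IPlus (ivar ''k'') (IConst 1))) relax) (\<lambda>l \<tau>'.
      k1 + l \<le> 30 + 150 * nat ?N \<and>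
      dijkstra ?N (arc \<sigma>) (reduced \<sigma>) b K (i + 1) (rmem \<tau>' ''D'') (imem \<tau>' ''d'') (imem \<tau>' ''pr'')) \<tau>1"
      by (simp add: wp_Seq k_eq \<tau>2_def u_def)
  qed
  show ?thesis
    unfolding search_def
  proof (rule wp_SeqI[where B = "9 + 32 * nat ?N" and R = "\<lambda>\<tau>.
       \<forall>v\<in>{0..s+t}. rmem \<tau> ''D'' v = K \<and> imem \<tau> ''d'' v = 0"])
    show "wp (For ''v'' ''N'' (Seq (RAssign ''D'' (ivar ''v'') (rvar ''K'')) (IAssign ''d'' (ivar ''v'') (IConst 0))))
      (\<lambda>k \<tau>. k \<le> 9 + 32 * nat ?N \<and> (\<forall>v\<in>{0..s+t}. rmem \<tau> ''D'' v = K \<and> imem \<tau> ''d'' v = 0)) \<sigma>"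
    proof (rule wp_For[where n = ?N and B = 20 and I = "\<lambda>i \<tau>.
        \<forall>v\<in>{0..<i}. rmem \<tau> ''D'' v = K \<and> imem \<tau> ''d'' v = 0"], goal_cases)
      case (8 i \<tau>)
      have "rmem \<tau> ''K'' 0 = K" using 8(4) K by (simp add: agree_def)
      then show ?case using 8(3,5) by (simp add: wp_Seq)
    qed (use ready N0 in \<open>auto simp: ready_def\<close>)
  next
    fix k1 \<tau>1 assume k1: "k1 \<le> 9 + 32 * nat ?N"
      and init: "\<forall>v\<in>{0..s+t}. rmem \<tau>1 ''D'' v = K \<and> imem \<tau>1 ''d'' v = 0"
      and a1: "agree (iwrites (For ''v'' ''N'' (Seq (RAssign ''D'' (ivar ''v'') (rvar ''K'')) (IAssign ''d'' (ivar ''v'') (IConst 0)))))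
         (rwrites (For ''v'' ''N'' (Seq (RAssign ''D'' (ivar ''v'') (rvar ''K'')) (IAssign ''d'' (ivar ''v'') (IConst 0))))) \<sigma> \<tau>1"
    have b1: "imem \<tau>1 ''b'' 0 = b" "imem \<tau>1 ''N'' 0 = ?N" using a1 b ready by (simp_all add: agree_def ready_def)
    define \<tau>2 where "\<tau>2 = rupdate ''D'' b 0 \<tau>1"
    have a2: "agree {''v'', ''d'', ''k'', ''u'', ''pr''} {''D''} \<sigma> \<tau>2"
      using a1 by (simp add: agree_def \<tau>2_def)
    have "wp (For ''k'' ''N'' ?body) (\<lambda>l \<tau>. k1 + (4 + l) \<le> 300 * (nat ?N + 1)^2 \<and>
       dijkstra ?N (arc \<sigma>) (reduced \<sigma>) b K ?N (rmem \<tau> ''D'') (imem \<tau> ''d'') (imem \<tau> ''pr'')) \<tau>2"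
    proof (rule wp_For[where n = ?N and B = "30 + 150 * nat ?N" and I = "\<lambda>i \<tau>.
        dijkstra ?N (arc \<sigma>) (reduced \<sigma>) b K i (rmem \<tau> ''D'') (imem \<tau> ''d'') (imem \<tau> ''pr'')"], goal_cases)
      case (7)
      show ?case by (rule dijkstra_init) (use b K init in \<open>auto simp: \<tau>2_def\<close>)
    next
      case (8 i \<tau>)
      have "agree {''v'', ''d'', ''k'', ''u'', ''pr''} {''D''} \<sigma> \<tau>"
        using a2 8(4) by (simp add: agree_def)
      then show ?case using body 8 by blast
    next
      case (9 k \<tau>)
      then show ?case using k1 by (simp add: power2_eq_square algebra_simps)
    qed (use b1 N0 in \<open>auto simp: \<tau>2_def\<close>)
    then show "wp (Seq (RAssign ''D'' (ivar ''b'') (RConst 0)) (For ''k'' ''N'' ?body))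
      (\<lambda>l \<tau>. k1 + l \<le> 300 * (nat ?N + 1)^2 \<and>
       dijkstra ?N (arc \<sigma>) (reduced \<sigma>) b K ?N (rmem \<tau> ''D'') (imem \<tau> ''d'') (imem \<tau> ''pr'')) \<tau>1"
      by (auto simp: wp_Seq b1 \<tau>2_def elim!: wp_mono)
  qed
qed

end

section \<open>Sending one unit of flow along the path tree\<close>

definition update_root_costs :: com where
  "update_root_costs = Seq
    (Cond (ILess (ICell ''z'' (ivar ''x'')) (ICell ''L'' (ivar ''x'')))
       (RAssign ''R'' (IPlus (ICell ''off'' (ivar ''r'')) (ivar ''x'')) (RMinus (RConst 0) (rvar ''big'')))
       (Cond (ILess (ICell ''z'' (ivar ''x'')) (ICell ''H'' (ivar ''x'')))
          (RAssign ''R'' (IPlus (ICell ''off'' (ivar ''r'')) (ivar ''x'')) (RConst 0))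
          (RAssign ''R'' (IPlus (ICell ''off'' (ivar ''r'')) (ivar ''x'')) (rvar ''big''))))
    (Cond (ILess (ICell ''L'' (ivar ''x'')) (ICell ''z'' (ivar ''x'')))
       (Cond (ILess (ICell ''H'' (ivar ''x'')) (ICell ''z'' (ivar ''x'')))
          (RAssign ''R'' (IPlus (ICell ''off'' (ivar ''x'')) (ivar ''r'')) (RMinus (RConst 0) (rvar ''big'')))
          (RAssign ''R'' (IPlus (ICell ''off'' (ivar ''x'')) (ivar ''r'')) (RConst 0)))
       (RAssign ''R'' (IPlus (ICell ''off'' (ivar ''x'')) (ivar ''r'')) (rvar ''big'')))"

lemma iwrites_update_root_costs [simp]: "iwrites update_root_costs = {}"
  and rwrites_update_root_costs [simp]: "rwrites update_root_costs = {''R''}"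
  by (auto simp: update_root_costs_def)

text \<open>Moves a unit over the arc from \<open>u\<close> to \<open>c\<close>. The arc of a pair
  is reversed; a root arc stays residual in both directions, and only the supply and the two slopes
  at its other end change.\<close>

definition flip :: com where
  "flip = Cond (BAnd (ILess (ivar ''u'') (ivar ''r'')) (ILess (ivar ''c'') (ivar ''r'')))
    (Seq (IAssign ''E'' (IPlus (ICell ''off'' (ivar ''u'')) (ivar ''c'')) (IConst 0))
       (IAssign ''E'' (IPlus (ICell ''off'' (ivar ''c'')) (ivar ''u'')) (IConst 1)))
    (Seq (Cond (ILess (ivar ''c'') (ivar ''r''))
         (Seq (iset ''x'' (ivar ''c'')) (IAssign ''z'' (ivar ''x'') (IPlus (ICell ''z'' (ivar ''x'')) (IConst 1))))
         (Seq (iset ''x'' (ivar ''u'')) (IAssign ''z'' (ivar ''x'') (IMinus (ICell ''z'' (ivar ''x'')) (IConst 1)))))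
       update_root_costs)"

lemma iwrites_flip [simp]: "iwrites flip = {''E'', ''x'', ''z''}" and rwrites_flip [simp]: "rwrites flip = {''R''}"
  by (auto simp: flip_def)

text \<open>Follows the predecessors from \<open>i\<close> back to \<open>b\<close>. The guard is
  \<open>c \<noteq> b\<close>, expressed by order tests.\<close>

definition augment :: com where
  "augment = Seq (iset ''c'' (ivar ''i''))
    (While (BNot (BAnd (BNot (ILess (ivar ''c'') (ivar ''b''))) (BNot (ILess (ivar ''b'') (ivar ''c'')))))
      (Seq (iset ''u'' (ICell ''pr'' (ivar ''c''))) (Seq flip (iset ''c'' (ivar ''u'')))))"

lemma iwrites_augment [simp]: "iwrites augment = {''c'', ''u'', ''E'', ''x'', ''z''}"
  and rwrites_augment [simp]: "rwrites augment = {''R''}"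
  by (auto simp: augment_def)

context network
begin

abbreviation consistent :: "store \<Rightarrow> (int \<times> int) set \<Rightarrow> bool" where
  "consistent \<sigma> X \<equiv> residual (arc \<sigma>) (arc_cost \<sigma>) (rmem \<sigma> ''p'') (imem \<sigma> ''z'') X"

abbreviation excess :: "store \<Rightarrow> int \<Rightarrow> int" where
  "excess \<sigma> v \<equiv> outflow (arc \<sigma>) v - imem \<sigma> ''z'' v"

text \<open>Off-by-one between the two arcs: over integers the strict tests \<open>z < L\<close> and
  \<open>z < H\<close> decide \<open>z + 1 \<le> L\<close> and \<open>z + 1 \<le> H\<close>, giving
  the slope at \<open>z + 1\<close> for the arc out of the root, while the arc into it negates the
  slope at \<open>z\<close> itself.\<close>

lemma wp_update_root_costs:
  assumes ready: "ready \<sigma>" and x: "imem \<sigma> ''x'' 0 = x" "x \<in> {0..<s+t}"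
  shows "wp update_root_costs (\<lambda>k \<tau>. k \<le> 60 \<and> (\<forall>u\<in>{0..s+t}. \<forall>v\<in>{0..s+t}. arc_cost \<tau> u v =
     (if u = s+t \<and> v = x then slope C (L x) (H x) (imem \<sigma> ''z'' x + 1)
      else if u = x \<and> v = s+t then - slope C (L x) (H x) (imem \<sigma> ''z'' x)
      else arc_cost \<sigma> u v))) \<sigma>"
proof -
  have e: "imem \<sigma> ''r'' 0 = s + t" "imem \<sigma> ''L'' x = L x" "imem \<sigma> ''H'' x = H x"
     "imem \<sigma> ''off'' x = cell x 0" "imem \<sigma> ''off'' (s+t) = cell (s+t) 0" "rmem \<sigma> ''big'' 0 = C"
    using ready x s_nonneg t_nonneg by (auto simp: ready_def)
  have LH: "L x \<le> H x" using L_le_H x by auto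
  show ?thesis
    using x(2) LH s_nonneg t_nonneg
    by (auto simp: update_root_costs_def wp_Seq e x(1) slope_def)
qed

text \<open>One unit of excess passes from \<open>c\<close> to \<open>u\<close>. On a root arc the
  supply changes instead of the outflow, with the same effect on the excess; the root's own balance
  is not tracked. The last clause protects the remaining arcs of the path.\<close>

lemma wp_flip:
  assumes ready: "ready \<sigma>" and u: "imem \<sigma> ''u'' 0 = u" "u \<in> {0..s+t}"
    and c: "imem \<sigma> ''c'' 0 = c" "c \<in> {0..s+t}" and res: "consistent \<sigma> X"
    and arc: "arc \<sigma> u c" "reduced \<sigma> u c = 0"
  shows "wp flip (\<lambda>k \<tau>. k \<le> 100 \<and> consistent \<tau> X \<and>
     (\<forall>x\<in>{0..<s+t}. excess \<tau> x = excess \<sigma> x + of_bool (x = u) - of_bool (x = c)) \<and>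
     (\<forall>x\<in>{0..s+t}. \<forall>y\<in>{0..s+t}. \<not> (x = u \<and> y = c \<or> x = c \<and> y = u) \<longrightarrow>
        (arc \<tau> x y \<longleftrightarrow> arc \<sigma> x y) \<and> arc_cost \<tau> x y = arc_cost \<sigma> x y)) \<sigma>"
proof -
  have st: "0 \<le> s" "0 \<le> t" by (rule s_nonneg t_nonneg)+
  have r: "imem \<sigma> ''r'' 0 = s + t" using ready by (simp add: ready_def)
  have off: "imem \<sigma> ''off'' u = cell u 0" "imem \<sigma> ''off'' c = cell c 0"
    using ready u c by (auto simp: ready_def)
  have uc: "u \<noteq> c"
  proof
    assume "u = c"
    then consider "u < s" | "s \<le> u" "u < s + t" | "u = s + t" using u(2) by force
    then show False
    proof cases
      case 1
      then show ?thesis using residual_no_arc(1)[OF res, of u u] u arc \<open>u = c\<close> by auto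
    next
      case 2
      then show ?thesis using residual_no_arc(2)[OF res, of u u] u arc \<open>u = c\<close> by auto
    next
      case 3
      then show ?thesis using residual_no_arc(3)[OF res] arc \<open>u = c\<close> by auto
    qed
  qed
  \<comment> \<open>Both directions at once: \<open>h = 1\<close> sends a unit from the root to
    \<open>v\<close>, \<open>h = -1\<close> returns one.\<close>
  have root: "wp (Seq (iset ''x'' e) (Seq (IAssign ''z'' (ivar ''x'') f) update_root_costs))
      (\<lambda>k \<tau>. k \<le> 80 \<and> consistent \<tau> X \<and>
       (\<forall>x\<in>{0..<s+t}. excess \<tau> x = excess \<sigma> x - (if x = v then h else 0)) \<and>
       (\<forall>x\<in>{0..s+t}. \<forall>y\<in>{0..s+t}. \<not> (x = s+t \<and> y = v \<or> x = v \<and> y = s+t) \<longrightarrow>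
        (arc \<tau> x y \<longleftrightarrow> arc \<sigma> x y) \<and> arc_cost \<tau> x y = arc_cost \<sigma> x y)) \<sigma>"
    if v: "v \<in> {0..<s+t}" and e: "ival e \<sigma> = v" "icost e \<le> 2"
      and f: "ival f (iupdate ''x'' 0 v \<sigma>) = imem \<sigma> ''z'' v + h" "icost f \<le> 10"
      and tight: "h = 1 \<and> reduced \<sigma> (s+t) v = 0 \<or> h = -1 \<and> reduced \<sigma> v (s+t) = 0" for v e f h
  proof -
    define \<sigma>1 where "\<sigma>1 = iupdate ''z'' v (imem \<sigma> ''z'' v + h) (iupdate ''x'' 0 v \<sigma>)"
    have r1: "ready \<sigma>1" by (rule ready_agree[OF ready, of "{''x'', ''z''}" "{}"]) (auto simp: agree_def \<sigma>1_def)
    have w: "wp update_root_costs (\<lambda>k \<tau>. (k \<le> 60 \<and> (\<forall>x\<in>{0..s+t}. \<forall>y\<in>{0..s+t}. arc_cost \<tau> x y =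
       (if x = s+t \<and> y = v then slope C (L v) (H v) (imem \<sigma>1 ''z'' v + 1)
        else if x = v \<and> y = s+t then - slope C (L v) (H v) (imem \<sigma>1 ''z'' v)
        else arc_cost \<sigma>1 x y))) \<and> agree {} {''R''} \<sigma>1 \<tau>) \<sigma>1"
      using wp_agree[OF wp_update_root_costs[OF r1, of v]] v by (simp add: \<sigma>1_def)
    have "wp update_root_costs (\<lambda>k \<tau>. 20 + k \<le> 80 \<and> consistent \<tau> X \<and>
       (\<forall>x\<in>{0..<s+t}. excess \<tau> x = excess \<sigma> x - (if x = v then h else 0)) \<and>
       (\<forall>x\<in>{0..s+t}. \<forall>y\<in>{0..s+t}. \<not> (x = s+t \<and> y = v \<or> x = v \<and> y = s+t) \<longrightarrow>
        (arc \<tau> x y \<longleftrightarrow> arc \<sigma> x y) \<and> arc_cost \<tau> x y = arc_cost \<sigma> x y)) \<sigma>1"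
    proof (rule wp_mono[OF w], elim conjE, intro conjI)
      fix k \<tau> assume R: "\<forall>x\<in>{0..s+t}. \<forall>y\<in>{0..s+t}. arc_cost \<tau> x y =
       (if x = s+t \<and> y = v then slope C (L v) (H v) (imem \<sigma>1 ''z'' v + 1)
        else if x = v \<and> y = s+t then - slope C (L v) (H v) (imem \<sigma>1 ''z'' v)
        else arc_cost \<sigma>1 x y)" and a: "agree {} {''R''} \<sigma>1 \<tau>"
      have e: "imem \<tau> ''E'' = imem \<sigma> ''E''" "rmem \<tau> ''p'' = rmem \<sigma> ''p''"
        "imem \<tau> ''z'' = (imem \<sigma> ''z'')(v := imem \<sigma> ''z'' v + h)"
        using a by (simp_all add: agree_def \<sigma>1_def)
      show "consistent \<tau> X"
        unfolding e(1,2)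
        by (rule residual_flip_root[OF res v tight]) (use R in \<open>auto simp: e \<sigma>1_def\<close>)
      show "\<forall>x\<in>{0..<s+t}. excess \<tau> x = excess \<sigma> x - (if x = v then h else 0)"
        by (simp add: e)
      show "\<forall>x\<in>{0..s+t}. \<forall>y\<in>{0..s+t}. \<not> (x = s+t \<and> y = v \<or> x = v \<and> y = s+t) \<longrightarrow>
        (arc \<tau> x y \<longleftrightarrow> arc \<sigma> x y) \<and> arc_cost \<tau> x y = arc_cost \<sigma> x y"
        using R by (auto simp: e \<sigma>1_def)
    qed simp
    then show ?thesis
      using e(2) f(2) by (auto simp: wp_Seq e(1) f(1) \<sigma>1_def elim!: wp_mono)
  qed
  consider "u < s + t" "c < s + t" | "u = s + t" "c < s + t" | "u < s + t" "c = s + t"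
    using u(2) c(2) uc by force
  then show ?thesis
  proof cases
    case 1
    define \<sigma>1 where "\<sigma>1 = iupdate ''E'' (cell c u) 1 (iupdate ''E'' (cell u c) 0 \<sigma>)"
    have m: "u \<in> {0..<s+t}" "c \<in> {0..<s+t}" using 1 u c by auto
    have E: "arc \<sigma>1 x y = (x = c \<and> y = u \<or> \<not> (x = u \<and> y = c) \<and> arc \<sigma> x y)"
      if "x \<in> {0..s+t}" "y \<in> {0..s+t}" for x y
      using that u(2) c(2) uc by (auto simp: \<sigma>1_def)
    have e: "rmem \<sigma>1 ''R'' = rmem \<sigma> ''R''" "rmem \<sigma>1 ''p'' = rmem \<sigma> ''p''" "imem \<sigma>1 ''z'' = imem \<sigma> ''z''"
      by (simp_all add: \<sigma>1_def)
    have "consistent \<sigma>1 X" unfolding e by (rule residual_flip_pair(1)[OF res arc(1) m arc(2) E])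
    moreover have "\<forall>x\<in>{0..<s+t}. excess \<sigma>1 x = excess \<sigma> x + of_bool (x = u) - of_bool (x = c)"
      using residual_flip_pair(2)[OF res arc(1) m arc(2) E] by (simp add: e)
    ultimately show ?thesis
      using 1 E by (auto simp: flip_def wp_Seq u(1) c(1) r off e simp flip: \<sigma>1_def)
  next
    case 2
    then show ?thesis
      using root[of c "ivar ''c''" "IPlus (ICell ''z'' (ivar ''x'')) (IConst 1)" 1] arc c u uc st
      by (auto simp: flip_def wp_Seq r elim!: wp_mono)
  next
    case 3
    then show ?thesis
      using root[of u "ivar ''u''" "IMinus (ICell ''z'' (ivar ''x'')) (IConst 1)" "-1"] arc c u uc st
      by (auto simp: flip_def wp_Seq r elim!: wp_mono)
  qed
qed

text \<open>The surplus at \<open>i\<close> is carried back along the predecessor chain until it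
  cancels the deficit at \<open>b\<close>. The scanning position of the current node decreases at
  every step and bounds the number of steps by the number of nodes.\<close>

lemma wp_augment:
  assumes ready: "ready \<sigma>" and i: "imem \<sigma> ''i'' 0 = i" "i \<in> {0..s+t}" and b: "imem \<sigma> ''b'' 0 = b"
    and res: "consistent \<sigma> X" and i_K: "rmem \<sigma> ''D'' i < K"
    and bal: "\<And>x. x \<in> {0..<s+t} \<Longrightarrow> excess \<sigma> x = of_bool (x = i) - of_bool (x = b)"
    and d: "\<And>v. v \<in> {0..s+t} \<Longrightarrow> 0 < imem \<sigma> ''d'' v \<and> imem \<sigma> ''d'' v \<le> s+t+1"
    and tree: "\<And>v. v \<in> {0..s+t} \<Longrightarrow> v \<noteq> b \<Longrightarrow> rmem \<sigma> ''D'' v < K \<Longrightarrow>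
      imem \<sigma> ''pr'' v \<in> {0..s+t} \<and> imem \<sigma> ''d'' (imem \<sigma> ''pr'' v) < imem \<sigma> ''d'' v \<and>
      rmem \<sigma> ''D'' (imem \<sigma> ''pr'' v) < K \<and> arc \<sigma> (imem \<sigma> ''pr'' v) v \<and> reduced \<sigma> (imem \<sigma> ''pr'' v) v = 0"
  shows "wp augment (\<lambda>k \<tau>. k \<le> 30 + 200 * nat (s+t+1) \<and> consistent \<tau> X \<and>
     (\<forall>x\<in>{0..<s+t}. excess \<tau> x = 0)) \<sigma>"
proof -
  let ?d = "imem \<sigma> ''d''" and ?D = "rmem \<sigma> ''D''" and ?pr = "imem \<sigma> ''pr''" and ?c = "\<lambda>\<tau>. imem \<tau> ''c'' 0"
  \<comment> \<open>Tree arcs need to be intact only for heads scanned no later than the current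
    node; those reversed so far have heads scanned later.\<close>
  let ?I = "\<lambda>\<tau>. ?c \<tau> \<in> {0..s+t} \<and> ?D (?c \<tau>) < K \<and> agree {''c'', ''u'', ''E'', ''x'', ''z''} {''R''} \<sigma> \<tau> \<and>
    consistent \<tau> X \<and>
    (\<forall>x\<in>{0..s+t}. x \<noteq> b \<longrightarrow> ?D x < K \<longrightarrow> ?d x \<le> ?d (?c \<tau>) \<longrightarrow> arc \<tau> (?pr x) x \<and> reduced \<tau> (?pr x) x = 0) \<and>
    (\<forall>x\<in>{0..<s+t}. excess \<tau> x = of_bool (x = ?c \<tau>) - of_bool (x = b))"
  show ?thesis
    unfolding augment_def wp_Seq wp_IAssign
  proof (rule wp_While[where I = ?I and f = "\<lambda>\<tau>. nat (?d (?c \<tau>))" and B = 130], goal_cases)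
    case 1
    show ?case using i i_K res bal tree by (simp add: agree_def)
  next
    case (2 \<tau>)
    define c where "c = ?c \<tau>"
    define u where "u = ?pr c"
    define \<tau>1 where "\<tau>1 = iupdate ''u'' 0 u \<tau>"
    have a: "agree {''c'', ''u'', ''E'', ''x'', ''z''} {''R''} \<sigma> \<tau>" using 2 by blast
    have a1: "agree {''c'', ''u'', ''E'', ''x'', ''z''} {''R''} \<sigma> \<tau>1" using a by (simp add: \<tau>1_def agree_def)
    have e: "imem \<tau> ''b'' 0 = b" "imem \<tau> ''pr'' = ?pr" using a b by (simp_all add: agree_def)
    have cV: "c \<in> {0..s+t}" "?D c < K" using 2 by (simp_all add: c_def)
    have cb: "c \<noteq> b" using 2(2) e by (auto simp: c_def)
    have tr: "u \<in> {0..s+t}" "?d u < ?d c" "?D u < K" using tree[OF cV(1) cb cV(2)] by (auto simp: u_def)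
    have ar: "arc \<tau> u c" "reduced \<tau> u c = 0" using 2(1) cV cb by (auto simp: u_def c_def)
    have "wp flip (\<lambda>k \<tau>'. (k \<le> 100 \<and> consistent \<tau>' X \<and>
     (\<forall>x\<in>{0..<s+t}. excess \<tau>' x = excess \<tau>1 x + of_bool (x = u) - of_bool (x = c)) \<and>
     (\<forall>x\<in>{0..s+t}. \<forall>y\<in>{0..s+t}. \<not> (x = u \<and> y = c \<or> x = c \<and> y = u) \<longrightarrow>
        (arc \<tau>' x y \<longleftrightarrow> arc \<tau>1 x y) \<and> arc_cost \<tau>' x y = arc_cost \<tau>1 x y)) \<and>
        agree {''E'', ''x'', ''z''} {''R''} \<tau>1 \<tau>') \<tau>1"
      unfolding iwrites_flip[symmetric] rwrites_flip[symmetric]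
      by (rule wp_agree, rule wp_flip) (use ready_agree[OF ready a1] tr cV ar 2(1) in \<open>auto simp: \<tau>1_def c_def\<close>)
    then have "wp flip (\<lambda>k \<tau>'. k + 15 \<le> 130 \<and> imem \<tau>' ''u'' 0 = u \<and> ?I (iupdate ''c'' 0 u \<tau>')) \<tau>1"
    proof (rule wp_mono, elim conjE, goal_cases)
      case (1 k \<tau>')
      have a': "agree {''c'', ''u'', ''E'', ''x'', ''z''} {''R''} \<sigma> (iupdate ''c'' 0 u \<tau>')"
        using a1 1 by (simp add: agree_def)
      have e': "imem \<tau>' ''u'' 0 = u" "rmem \<tau>' ''p'' = rmem \<tau> ''p''"
        using 1 by (simp_all add: agree_def \<tau>1_def)
      have arcs: "arc \<tau>' (?pr x) x \<and> reduced \<tau>' (?pr x) x = 0"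
        if x: "x \<in> {0..s+t}" "x \<noteq> b" "?D x < K" "?d x \<le> ?d u" for x
      proof -
        note tx = tree[OF x(1-3)]
        \<comment> \<open>Positions strictly decrease along chains, so neither end of a remaining
          tree arc is \<open>c\<close>; the flip leaves the arc alone.\<close>
        have "x \<noteq> c" "?pr x \<noteq> c" using tx x tr by auto
        moreover have "arc \<tau> (?pr x) x \<and> reduced \<tau> (?pr x) x = 0"
          using 2(1) x tr by (auto simp: c_def)
        moreover have "\<forall>x\<in>{0..s+t}. \<forall>y\<in>{0..s+t}. \<not> (x = u \<and> y = c \<or> x = c \<and> y = u) \<longrightarrow>
          (arc \<tau>' x y \<longleftrightarrow> arc \<tau>1 x y) \<and> arc_cost \<tau>' x y = arc_cost \<tau>1 x y" by (rule 1)
        ultimately show ?thesis using tx x by (simp add: e' \<tau>1_def)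
      qed
      have ex: "excess \<tau>1 x = of_bool (x = c) - of_bool (x = b)" if "x \<in> {0..<s+t}" for x
        using 2(1) that by (simp add: c_def \<tau>1_def)
      show ?case using 1 a' e' tr arcs ex by simp
    qed
    moreover define J where "J = ?I"
    ultimately have "wp flip (\<lambda>k \<tau>'. k + 15 \<le> 130 \<and> imem \<tau>' ''u'' 0 = u \<and> J (iupdate ''c'' 0 u \<tau>')) \<tau>1"
      by simp
    moreover have "nat (?d u) < nat (?d c)" using tr d[OF cV(1)] by simp
    moreover have "\<tau>1 = iupdate ''u'' 0 (?pr (?c \<tau>)) \<tau>" by (simp add: \<tau>1_def u_def c_def)
    ultimately have "wp (Seq (iset ''u'' (ICell ''pr'' (ivar ''c''))) (Seq flip (iset ''c'' (ivar ''u''))))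
      (\<lambda>k \<tau>'. k \<le> 130 \<and> J \<tau>' \<and> nat (?d (?c \<tau>')) < nat (?d c)) \<tau>"
      by (auto simp: wp_Seq e elim!: wp_mono)
    then show ?case by (simp add: J_def c_def)
  next
    case (3 k \<tau>)
    have a: "agree {''c'', ''u'', ''E'', ''x'', ''z''} {''R''} \<sigma> \<tau>" using 3 by blast
    then have "imem \<tau> ''b'' 0 = b" using b by (simp add: agree_def)
    then have "?c \<tau> = b" using 3(2) by auto
    then have "consistent \<tau> X" "\<forall>x\<in>{0..<s+t}. excess \<tau> x = 0" using 3(1) by simp_all
    moreover have "nat (?d i) \<le> nat (s+t+1)" using d[OF i(2)] by (intro nat_mono) simp
    \<comment> \<open>\<open>145\<close> is 130 for the body and 15 for the test.\<close>
    then have "nat (?d i) * 145 \<le> nat (s+t+1) * 145" by simp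
    then have "k + 10 \<le> 30 + 200 * nat (s+t+1)" using 3(3) i by (simp add: agree_def)
    ultimately show ?case by simp
  qed
qed

end

section \<open>Admitting a pair\<close>

definition shift_potential :: com where
  "shift_potential = For ''v'' ''N'' (RAssign ''p'' (ivar ''v'') (RPlus (RCell ''p'' (ivar ''v'')) (RCell ''D'' (ivar ''v''))))"

lemma iwrites_shift_potential [simp]: "iwrites shift_potential = {''v''}"
  and rwrites_shift_potential [simp]: "rwrites shift_potential = {''p''}"
  by (auto simp: shift_potential_def)

definition insert_pair :: com where
  "insert_pair = Seq (iset ''b'' (IPlus (ivar ''s'') (ivar ''j'')))
    (Seq (rset ''K'' (RMinus (RMinus (RCell ''p'' (ivar ''b'')) (RCell ''p'' (ivar ''i'')))
        (RCell ''R'' (IPlus (ICell ''off'' (ivar ''i'')) (ivar ''b'')))))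
    (Cond (RLess (RConst 0) (rvar ''K''))
      (Seq search (Seq shift_potential
        (Cond (RLess (RCell ''D'' (ivar ''i'')) (rvar ''K''))
          (Seq (IAssign ''E'' (IPlus (ICell ''off'' (ivar ''b'')) (ivar ''i'')) (IConst 1)) augment)
          (IAssign ''E'' (IPlus (ICell ''off'' (ivar ''i'')) (ivar ''b'')) (IConst 1)))))
      (IAssign ''E'' (IPlus (ICell ''off'' (ivar ''i'')) (ivar ''b'')) (IConst 1))))"

lemma iwrites_insert_pair [simp]:
    "iwrites insert_pair = {''b'', ''v'', ''d'', ''k'', ''u'', ''pr'', ''c'', ''E'', ''x'', ''z''}"
  and rwrites_insert_pair [simp]: "rwrites insert_pair = {''K'', ''D'', ''p'', ''R''}"
  by (auto simp: insert_pair_def)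

context network
begin

lemma wp_shift_potential:
  assumes "ready \<sigma>"
  shows "wp shift_potential (\<lambda>k \<tau>. k \<le> 9 + 32 * nat (s+t+1) \<and>
    (\<forall>v\<in>{0..s+t}. rmem \<tau> ''p'' v = rmem \<sigma> ''p'' v + rmem \<sigma> ''D'' v)) \<sigma>"
  unfolding shift_potential_def
proof (rule wp_For[where n = "s+t+1" and B = 20 and I = "\<lambda>i \<tau>. \<forall>v\<in>{0..s+t}.
    rmem \<tau> ''p'' v = rmem \<sigma> ''p'' v + (if v < i then rmem \<sigma> ''D'' v else 0)"], goal_cases)
  case (8 i \<tau>)
  have "rmem \<tau> ''D'' = rmem \<sigma> ''D''" using 8(4) by (simp add: agree_def)
  then show ?case using 8 by auto
qed (use assms s_nonneg t_nonneg in \<open>auto simp: ready_def\<close>)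

text \<open>A row-to-column arc carries no flow and is invisible to \<open>outflow\<close>, so
  balance persists.\<close>

lemma consistent_add_forward:
  assumes res: "consistent \<sigma> X" and ij: "i \<in> {0..<s}" "b \<in> {s..<s+t}" "(i, b) \<notin> X"
    and le: "0 \<le> reduced \<sigma> i b" and bal: "\<forall>x\<in>{0..<s+t}. excess \<sigma> x = 0"
  defines "\<tau> \<equiv> iupdate ''E'' (cell i b) 1 \<sigma>"
  shows "consistent \<tau> (insert (i, b) X)" "\<forall>x\<in>{0..<s+t}. excess \<tau> x = 0"
proof -
  have st: "0 \<le> s" "0 \<le> t" by (rule s_nonneg t_nonneg)+
  have E: "arc \<tau> x y = (x = i \<and> y = b \<or> arc \<sigma> x y)" if "x \<in> {0..s+t}" "y \<in> {0..s+t}" for x y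
    using that ij st by (auto simp: \<tau>_def)
  have e: "rmem \<tau> = rmem \<sigma>" "imem \<tau> ''z'' = imem \<sigma> ''z''" by (auto simp: \<tau>_def)
  show "consistent \<tau> (insert (i, b) X)"
    unfolding e by (rule residual_insert[OF res ij _ le E]) auto
  have "outflow (arc \<tau>) x = outflow (arc \<sigma>) x" if "x \<in> {0..<s+t}" for x
    by (rule outflow_cong[OF _ that]) (use E ij st in auto)
  then show "\<forall>x\<in>{0..<s+t}. excess \<tau> x = 0" using bal e by simp
qed

text \<open>Entering the pair as matched adds a unit of flow from \<open>i\<close> to
  \<open>b\<close>. This creates exactly the imbalance from which \<open>wp_augment\<close>
  starts.\<close>

lemma consistent_add_backward:
  assumes res: "consistent \<sigma> X" and ij: "i \<in> {0..<s}" "b \<in> {s..<s+t}" "(i, b) \<notin> X"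
    and le: "reduced \<sigma> i b \<le> 0" and bal: "\<forall>x\<in>{0..<s+t}. excess \<sigma> x = 0"
  defines "\<tau> \<equiv> iupdate ''E'' (cell b i) 1 \<sigma>"
  shows "consistent \<tau> (insert (i, b) X)"
    "\<And>x. x \<in> {0..<s+t} \<Longrightarrow> excess \<tau> x = of_bool (x = i) - of_bool (x = b)"
proof -
  have st: "0 \<le> s" "0 \<le> t" by (rule s_nonneg t_nonneg)+
  have E: "arc \<tau> x y = (x = b \<and> y = i \<or> arc \<sigma> x y)" if "x \<in> {0..s+t}" "y \<in> {0..s+t}" for x y
    using that ij st by (auto simp: \<tau>_def)
  have e: "rmem \<tau> = rmem \<sigma>" "imem \<tau> ''z'' = imem \<sigma> ''z''" by (auto simp: \<tau>_def)
  note pair = residual_pair[OF res ij(1,2)]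
  have "0 \<le> reduced \<sigma> b i" using pair(1,2) le by simp
  then show "consistent \<tau> (insert (i, b) X)"
    unfolding e by (intro residual_insert[OF res ij _ _ E]) auto
  fix x assume x: "x \<in> {0..<s+t}"
  have "outflow (arc \<tau>) x = outflow (arc \<sigma>) x +
    (if x = i then 1 else if x = b then -1 else 0) * (of_bool True - of_bool (arc \<sigma> b i))"
    by (rule outflow_flip[OF _ ij(1,2) x]) (use E in auto)
  moreover have "\<not> arc \<sigma> b i" using pair(3) ij(3) by simp
  ultimately show "excess \<tau> x = of_bool (x = i) - of_bool (x = b)" using bal x e ij by auto
qed

lemma wp_insert_pair:
  assumes ready: "ready \<sigma>" and i: "imem \<sigma> ''i'' 0 = i" "i \<in> {0..<s}" and j: "imem \<sigma> ''j'' 0 = j" "j \<in> {0..<t}"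
    and res: "consistent \<sigma> X" and new: "(i, s + j) \<notin> X" and bal: "\<forall>x\<in>{0..<s+t}. excess \<sigma> x = 0"
  shows "wp insert_pair (\<lambda>k \<tau>. k \<le> 700 * (nat (s+t+1) + 1)^2 \<and> consistent \<tau> (insert (i, s + j) X) \<and>
    (\<forall>x\<in>{0..<s+t}. excess \<tau> x = 0)) \<sigma>"
proof -
  have st: "0 \<le> s" "0 \<le> t" by (rule s_nonneg t_nonneg)+
  let ?N = "nat (s+t+1)"
  define b where "b = s + j"
  define K where "K = - reduced \<sigma> i b"
  define \<sigma>1 where "\<sigma>1 = rupdate ''K'' 0 K (iupdate ''b'' 0 b \<sigma>)"
  have b: "b \<in> {s..<s+t}" "b \<in> {0..s+t}" "(i, b) \<notin> X" using j new st by (auto simp: b_def)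
  have iV: "i \<in> {0..s+t}" using i st by auto
  have V: "{0..<s+t+1} = {0..s+t}" by auto
  have e1: "imem \<sigma>1 ''i'' 0 = i" "imem \<sigma>1 ''b'' 0 = b" "imem \<sigma>1 ''off'' i = cell i 0" "rmem \<sigma>1 ''K'' 0 = K"
    using ready i st by (simp_all add: \<sigma>1_def ready_def)
  have ready1: "ready \<sigma>1"
    by (rule ready_agree[OF ready, of "{''b''}" "{''K''}"]) (auto simp: \<sigma>1_def agree_def)
  have same: "imem \<sigma>1 ''E'' = imem \<sigma> ''E''" "imem \<sigma>1 ''z'' = imem \<sigma> ''z''"
      "rmem \<sigma>1 ''R'' = rmem \<sigma> ''R''" "rmem \<sigma>1 ''p'' = rmem \<sigma> ''p''"
    by (simp_all add: \<sigma>1_def)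
  have res1: "consistent \<sigma>1 X" and bal1: "\<forall>x\<in>{0..<s+t}. excess \<sigma>1 x = 0"
    using res bal by (simp_all add: same)
  have K1: "K = - reduced \<sigma>1 i b" by (simp add: K_def same)
  have pos: "1 \<le> (?N + 1)^2" "?N + 1 \<le> (?N + 1)^2" using self_le_power[of "?N + 1" 2] by auto
  let ?Q = "\<lambda>\<tau>. consistent \<tau> (insert (i, b) X) \<and> (\<forall>x\<in>{0..<s+t}. excess \<tau> x = 0)"
  let ?body = "Seq search (Seq shift_potential
        (Cond (RLess (RCell ''D'' (ivar ''i'')) (rvar ''K''))
          (Seq (IAssign ''E'' (IPlus (ICell ''off'' (ivar ''b'')) (ivar ''i'')) (IConst 1)) augment)
          (IAssign ''E'' (IPlus (ICell ''off'' (ivar ''i'')) (ivar ''b'')) (IConst 1))))"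
  have body: "wp ?body (\<lambda>k \<tau>. k \<le> 650 * (?N + 1)^2 \<and> ?Q \<tau>) \<sigma>1" if K: "0 < K"
  proof (rule wp_SeqI)
    show "wp search (\<lambda>k \<tau>. k \<le> 300 * (?N + 1)^2 \<and> dijkstra (s+t+1) (arc \<sigma>1) (reduced \<sigma>1) b K (s+t+1)
        (rmem \<tau> ''D'') (imem \<tau> ''d'') (imem \<tau> ''pr'')) \<sigma>1"
      by (rule wp_search[OF ready1 e1(2) b(2) e1(4) K]) (rule residual_nonneg[OF res1])
    fix k1 \<tau>1 assume k1: "k1 \<le> 300 * (?N + 1)^2"
      and dij: "dijkstra (s+t+1) (arc \<sigma>1) (reduced \<sigma>1) b K (s+t+1) (rmem \<tau>1 ''D'') (imem \<tau>1 ''d'') (imem \<tau>1 ''pr'')"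
      and a1: "agree (iwrites search) (rwrites search) \<sigma>1 \<tau>1"
    have rd1: "ready \<tau>1" by (rule ready_agree[OF ready1 a1]) auto
    let ?D = "rmem \<tau>1 ''D''" and ?d = "imem \<tau>1 ''d''" and ?pr = "imem \<tau>1 ''pr''"
    have nn: "\<forall>x\<in>{0..s+t}. \<forall>y\<in>{0..s+t}. arc \<sigma>1 x y \<longrightarrow> 0 \<le> reduced \<sigma>1 x y"
      using residual_nonneg[OF res1] by blast
    note dr = dijkstra_result[OF dij, unfolded V, OF _ nn]
    show "wp (Seq shift_potential
        (Cond (RLess (RCell ''D'' (ivar ''i'')) (rvar ''K''))
          (Seq (IAssign ''E'' (IPlus (ICell ''off'' (ivar ''b'')) (ivar ''i'')) (IConst 1)) augment)
          (IAssign ''E'' (IPlus (ICell ''off'' (ivar ''i'')) (ivar ''b'')) (IConst 1))))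
       (\<lambda>l \<tau>. k1 + l \<le> 650 * (?N + 1)^2 \<and> ?Q \<tau>) \<tau>1"
    proof (rule wp_SeqI[OF wp_shift_potential[OF rd1]])
      fix k2 \<tau>2 assume k2: "k2 \<le> 9 + 32 * ?N" and p: "\<forall>v\<in>{0..s+t}. rmem \<tau>2 ''p'' v = rmem \<tau>1 ''p'' v + ?D v"
        and a2: "agree (iwrites shift_potential) (rwrites shift_potential) \<tau>1 \<tau>2"
      have rd2: "ready \<tau>2" by (rule ready_agree[OF rd1 a2]) auto
      have e: "imem \<tau>2 ''E'' = imem \<sigma>1 ''E''" "imem \<tau>2 ''z'' = imem \<sigma>1 ''z''" "rmem \<tau>2 ''R'' = rmem \<sigma>1 ''R''"
         "rmem \<tau>2 ''D'' = ?D" "imem \<tau>2 ''d'' = ?d" "imem \<tau>2 ''pr'' = ?pr" "rmem \<tau>1 ''p'' = rmem \<sigma>1 ''p''"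
         "imem \<tau>2 ''i'' 0 = i" "imem \<tau>2 ''b'' 0 = b" "rmem \<tau>2 ''K'' 0 = K"
        using a1 a2 e1 by (simp_all add: agree_def)
      have off: "imem \<tau>2 ''off'' i = cell i 0" "imem \<tau>2 ''off'' b = cell b 0"
        using rd2 iV b(2) by (auto simp: ready_def)
      have p2: "rmem \<tau>2 ''p'' v = rmem \<sigma>1 ''p'' v + ?D v" if "v \<in> {0..s+t}" for v using p that e(7) by simp
      have res2: "consistent \<tau>2 X"
        unfolding e(1,2,3)
        by (rule residual_shift[OF res1, where D = ?D]) (use dr(4) p2 in auto)
      have bal2: "\<forall>x\<in>{0..<s+t}. excess \<tau>2 x = 0" using bal1 by (simp add: e)
      have Db: "?D b = 0" using dr(1)[OF b(2)] .
      \<comment> \<open>\<open>b\<close> keeps its potential and \<open>i\<close> gains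
        \<open>D i\<close>, so the reduced cost of the pair rises from \<open>- K\<close> to
        \<open>D i - K\<close>.\<close>
      have red: "reduced \<tau>2 i b = ?D i - K" using p2[OF iV] p2[OF b(2)] K1 Db by (simp add: e)
      show "wp (Cond (RLess (RCell ''D'' (ivar ''i'')) (rvar ''K''))
          (Seq (IAssign ''E'' (IPlus (ICell ''off'' (ivar ''b'')) (ivar ''i'')) (IConst 1)) augment)
          (IAssign ''E'' (IPlus (ICell ''off'' (ivar ''i'')) (ivar ''b'')) (IConst 1)))
        (\<lambda>l \<tau>. k1 + (k2 + l) \<le> 650 * (?N + 1)^2 \<and> ?Q \<tau>) \<tau>2"
      proof (cases "?D i < K")
        case False
        \<comment> \<open>The cap is reached: the pair has become tight and may enter unmatched,
          without any change of flow.\<close>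
        then have "?D i = K" using dr(3)[OF iV] by simp
        then have "0 \<le> reduced \<tau>2 i b" using red by simp
        note ad = consistent_add_forward[OF res2 i(2) b(1,3) this bal2]
        have "k1 + (k2 + 30) \<le> 650 * (?N + 1)^2" using k1 k2 pos by linarith
        then show ?thesis using False ad by (simp add: e off)
      next
        case True
        then have le: "reduced \<tau>2 i b \<le> 0" using red by simp
        note ad = consistent_add_backward[OF res2 i(2) b(1,3) le bal2]
        define \<tau>3 where "\<tau>3 = iupdate ''E'' (cell b i) 1 \<tau>2"
        have rd3: "ready \<tau>3" by (rule ready_agree[OF rd2, of "{''E''}" "{}"]) (auto simp: agree_def \<tau>3_def)
        have e3: "rmem \<tau>3 = rmem \<tau>2" "imem \<tau>3 ''d'' = ?d" "imem \<tau>3 ''pr'' = ?pr" "imem \<tau>3 ''i'' 0 = i" "imem \<tau>3 ''b'' 0 = b"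
          by (auto simp: \<tau>3_def e)
        have "wp augment (\<lambda>k \<tau>. k \<le> 30 + 200 * ?N \<and> consistent \<tau> (insert (i, b) X) \<and>
           (\<forall>x\<in>{0..<s+t}. excess \<tau> x = 0)) \<tau>3"
        proof (rule wp_augment[OF rd3 e3(4) iV e3(5)])
          show "consistent \<tau>3 (insert (i, b) X)" using ad(1) by (simp add: \<tau>3_def)
          show "rmem \<tau>3 ''D'' i < K" using True by (simp add: e3 e)
          show "\<And>x. x \<in> {0..<s+t} \<Longrightarrow> excess \<tau>3 x = of_bool (x = i) - of_bool (x = b)"
            using ad(2) by (simp add: \<tau>3_def)
          show "\<And>v. v \<in> {0..s+t} \<Longrightarrow> 0 < imem \<tau>3 ''d'' v \<and> imem \<tau>3 ''d'' v \<le> s+t+1"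
            using dr(2) by (simp add: e3)
          fix v assume v: "v \<in> {0..s+t}" "v \<noteq> b" "rmem \<tau>3 ''D'' v < K"
          note q = dr(5)[OF v(1,2)]
          have q: "?pr v \<in> {0..s+t}" "?d (?pr v) < ?d v" "?D (?pr v) < K" "arc \<sigma>1 (?pr v) v"
             "?D v = ?D (?pr v) + reduced \<sigma>1 (?pr v) v"
            using q v(3) by (auto simp: e3 e)
          have "arc \<tau>3 (?pr v) v" using q(4) by (simp add: \<tau>3_def e)
          \<comment> \<open>On a tree arc the labels differ by the old reduced cost, so the shift of
            the potential makes the arc tight.\<close>
          moreover have "reduced \<tau>3 (?pr v) v = 0"
            using q(5) p2[OF v(1)] p2[OF q(1)] by (simp add: e3 e)
          ultimately show "imem \<tau>3 ''pr'' v \<in> {0..s+t} \<and> imem \<tau>3 ''d'' (imem \<tau>3 ''pr'' v) < imem \<tau>3 ''d'' v \<and>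
            rmem \<tau>3 ''D'' (imem \<tau>3 ''pr'' v) < K \<and> arc \<tau>3 (imem \<tau>3 ''pr'' v) v \<and> reduced \<tau>3 (imem \<tau>3 ''pr'' v) v = 0"
            using q by (simp add: e3 e)
        qed
        then have "wp augment (\<lambda>k \<tau>. k1 + (k2 + (30 + k)) \<le> 650 * (?N + 1)^2 \<and> ?Q \<tau>) \<tau>3"
        proof (rule wp_mono, elim conjE, intro conjI)
          fix k3 assume "k3 \<le> 30 + 200 * ?N"
          then show "k1 + (k2 + (30 + k3)) \<le> 650 * (?N + 1)^2" using k1 k2 pos by linarith
        qed auto
        then show ?thesis using True by (auto simp: wp_Seq e off simp flip: \<tau>3_def elim!: wp_mono)
      qed
    qed
  qed
  have e0: "rmem \<sigma> ''p'' b - rmem \<sigma> ''p'' i - arc_cost \<sigma> i b = K" "imem \<sigma> ''off'' i = cell i 0" "imem \<sigma> ''s'' 0 = s"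
    using ready iV by (simp_all add: ready_def K_def)
  show ?thesis
  proof (cases "0 < K")
    case True
    have "k1 + 50 \<le> 700 * (?N + 1)^2" if "k1 \<le> 650 * (?N + 1)^2" for k1 using that pos by linarith
    then have "wp ?body (\<lambda>k \<tau>. k + 50 \<le> 700 * (?N + 1)^2 \<and> ?Q \<tau>) \<sigma>1"
      by (intro wp_mono[OF body[OF True]]) auto
    then show ?thesis
      using True unfolding insert_pair_def wp_Seq[of "iset _ _"] wp_Seq[of "rset _ _"]
      by (auto simp: i(1) j(1) e0 e1 simp flip: b_def \<sigma>1_def elim!: wp_mono)
  next
    case False
    then have "0 \<le> reduced \<sigma>1 i b" using K1 by simp
    note ad = consistent_add_forward[OF res1 i(2) b(1,3) this bal1]
    moreover define B where "B = 700 * (?N + 1)^2"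
    moreover from pos have "50 \<le> B" unfolding B_def by linarith
    ultimately show ?thesis
      using False unfolding insert_pair_def wp_Seq B_def[symmetric]
      by (simp add: i(1) j(1) e0 e1 flip: b_def \<sigma>1_def)
  qed
qed

end

section \<open>Initialization and the complete program\<close>

definition read_weight :: com where
  "read_weight = Seq (iset ''b'' (IPlus (ivar ''s'') (ivar ''j'')))
    (Seq (Cond (RLess (RCell ''weight'' (ivar ''q'')) (RConst 0))
        (rset ''big'' (RMinus (rvar ''big'') (RCell ''weight'' (ivar ''q''))))
        (rset ''big'' (RPlus (rvar ''big'') (RCell ''weight'' (ivar ''q'')))))
    (Seq (RAssign ''R'' (IPlus (ICell ''off'' (ivar ''i'')) (ivar ''b'')) (RCell ''weight'' (ivar ''q'')))
      (RAssign ''R'' (IPlus (ICell ''off'' (ivar ''b'')) (ivar ''i'')) (RMinus (RConst 0) (RCell ''weight'' (ivar ''q''))))))"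

definition link_root :: com where
  "link_root = Seq (IAssign ''E'' (IPlus (ICell ''off'' (ivar ''x'')) (ivar ''r'')) (IConst 1))
    (Seq (IAssign ''E'' (IPlus (ICell ''off'' (ivar ''r'')) (ivar ''x'')) (IConst 1))
    (Seq update_root_costs
      (RAssign ''p'' (ivar ''x'') (RCell ''R'' (IPlus (ICell ''off'' (ivar ''r'')) (ivar ''x''))))))"

text \<open>Columns receive flow, so a degree between \<open>\<beta>\<close> and
  \<open>\<beta>'\<close> is a supply between \<open>- \<beta>'\<close> and
  \<open>- \<beta>\<close>: the bounds change sign and are exchanged.\<close>

definition read_bounds :: com where
  "read_bounds = Seq
    (For ''i'' ''s'' (Seq (IAssign ''L'' (ivar ''i'') (ICell ''alpha'' (ivar ''i'')))
      (IAssign ''H'' (ivar ''i'') (ICell ''alpha_cap'' (ivar ''i'')))))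
    (For ''j'' ''t'' (Seq (IAssign ''L'' (IPlus (ivar ''s'') (ivar ''j'')) (IMinus (IConst 0) (ICell ''beta_cap'' (ivar ''j''))))
      (IAssign ''H'' (IPlus (ivar ''s'') (ivar ''j'')) (IMinus (IConst 0) (ICell ''beta'' (ivar ''j''))))))"

text \<open>\<open>off\<close> collects the multiples of \<open>N\<close> by repeated addition,
  starting from the input value 0 of its first cell. \<open>big\<close> starts at 1, the amount by
  which the penalty weight is to exceed the sum of the absolute weights.\<close>

definition read_size :: com where
  "read_size = Seq (iset ''N'' (IPlus (IPlus (ivar ''s'') (ivar ''t'')) (IConst 1)))
    (Seq (iset ''r'' (IPlus (ivar ''s'') (ivar ''t'')))
    (Seq (rset ''big'' (RConst 1))
    (For ''v'' ''N'' (IAssign ''off'' (IPlus (ivar ''v'') (IConst 1)) (IPlus (ICell ''off'' (ivar ''v'')) (ivar ''N''))))))"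

definition setup_network :: com where
  "setup_network = Seq read_size (Seq (Pairs read_weight) (Seq read_bounds (For ''x'' ''r'' link_root)))"

definition extract_matching :: com where
  "extract_matching = Pairs (Cond
    (ILess (IConst 0) (ICell ''E'' (IPlus (ICell ''off'' (IPlus (ivar ''s'') (ivar ''j''))) (ivar ''i''))))
    (IAssign ''M'' (ivar ''q'') (IConst 1)) Skip)"

definition mmdc_program :: com where
  "mmdc_program = Seq setup_network (Seq (Pairs insert_pair) extract_matching)"

lemma iwrites_read_weight [simp]: "iwrites read_weight = {''b''}"
  and rwrites_read_weight [simp]: "rwrites read_weight = {''big'', ''R''}"
  by (auto simp: read_weight_def)

lemma iwrites_link_root [simp]: "iwrites link_root = {''E''}"
  and rwrites_link_root [simp]: "rwrites link_root = {''p'', ''R''}"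
  by (auto simp: link_root_def)

lemma iwrites_read_bounds [simp]: "iwrites read_bounds = {''i'', ''j'', ''L'', ''H''}"
  and rwrites_read_bounds [simp]: "rwrites read_bounds = {}"
  by (auto simp: read_bounds_def)

lemma iwrites_read_size [simp]: "iwrites read_size = {''N'', ''r'', ''off'', ''v''}"
  and rwrites_read_size [simp]: "rwrites read_size = {''big''}"
  by (auto simp: read_size_def)

lemma iwrites_setup_network [simp]:
    "iwrites setup_network = {''N'', ''r'', ''off'', ''v'', ''i'', ''j'', ''q'', ''b'', ''L'', ''H'', ''x'', ''E''}"
  and rwrites_setup_network [simp]: "rwrites setup_network = {''big'', ''R'', ''p''}"
  by (auto simp: setup_network_def)

lemma row_major_eq_iff:
  fixes t i j :: int
  assumes "0 \<le> j" "j < t" "0 \<le> y" "y < t"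
  shows "i * t + j = x * t + y \<longleftrightarrow> i = x \<and> j = y"
proof
  assume "i * t + j = x * t + y"
  then have "(i * t + j) div t = (x * t + y) div t" "(i * t + j) mod t = (x * t + y) mod t"
    by simp_all
  then show "i = x \<and> j = y" using assms by simp_all
qed simp

lemma sum_atLeastLessThan_int_Suc:
  fixes f :: "int \<Rightarrow> 'a :: comm_monoid_add"
  assumes "0 \<le> i"
  shows "(\<Sum>x=0..<i+1. f x) = (\<Sum>x=0..<i. f x) + f i"
proof -
  have "{0..<i+1} = insert i {0..<i}" using assms by auto
  then show ?thesis by (simp add: add.commute)
qed

context network
begin

lemma wp_read_size:
  assumes "imem \<sigma> ''s'' 0 = s" "imem \<sigma> ''t'' 0 = t" "imem \<sigma> ''off'' 0 = 0"
  shows "wp read_size (\<lambda>k \<tau>. k \<le> 30 + 40 * nat (s+t+1) \<and> imem \<tau> ''N'' 0 = s+t+1 \<and> imem \<tau> ''r'' 0 = s+t \<and>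
    rmem \<tau> ''big'' 0 = 1 \<and> (\<forall>v\<in>{0..s+t}. imem \<tau> ''off'' v = cell v 0)) \<sigma>"
  unfolding read_size_def wp_Seq wp_IAssign wp_RAssign
proof (rule wp_For[where n = "s+t+1" and B = 20 and I = "\<lambda>i \<tau>. rmem \<tau> ''big'' 0 = 1 \<and> imem \<tau> ''r'' 0 = s+t \<and>
    (\<forall>v\<in>{0..i}. imem \<tau> ''off'' v = cell v 0)"], goal_cases)
  case (8 i \<tau>)
  have "imem \<tau> ''N'' 0 = s+t+1" using 8(4) assms by (simp add: agree_def)
  moreover have "cell i (s+t+1) = cell (i+1) 0" by (simp add: cell_def algebra_simps)
  ultimately show ?case using 8(1,3,5) by simp
next
  case (9 k \<tau>)
  have "imem \<tau> ''N'' 0 = s+t+1" using 9(3) assms by (simp add: agree_def)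
  then show ?case using 9 by simp
qed (use assms s_nonneg t_nonneg in \<open>auto simp: cell_def\<close>)

text \<open>The costs of all pairs are written in advance, in both directions. Only \<open>E\<close>
  decides which of these arcs exist, so an admission need not initialize any cost.\<close>

lemma wp_read_weight_pairs:
  assumes st: "imem \<sigma> ''s'' 0 = s" "imem \<sigma> ''t'' 0 = t" and big: "rmem \<sigma> ''big'' 0 = 1"
    and off: "\<And>v. v \<in> {0..s+t} \<Longrightarrow> imem \<sigma> ''off'' v = cell v 0"
    and weight: "\<And>i j. i \<in> {0..<s} \<Longrightarrow> j \<in> {0..<t} \<Longrightarrow> rmem \<sigma> ''weight'' (i * t + j) = w i j"
  shows "wp (Pairs read_weight) (\<lambda>k \<tau>. k \<le> 12 + nat s * (21 + nat t * 78) \<and>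
    rmem \<tau> ''big'' 0 = 1 + (\<Sum>i=0..<s. \<Sum>j=0..<t. \<bar>w i j\<bar>) \<and>
    (\<forall>x\<in>{0..<s}. \<forall>y\<in>{s..<s+t}. arc_cost \<tau> x y = w x (y - s) \<and> arc_cost \<tau> y x = - w x (y - s))) \<sigma>"
proof (rule wp_Pairs[where s = s and t = t and B = 60 and I = "\<lambda>i j \<tau>.
    rmem \<tau> ''big'' 0 = 1 + (\<Sum>x=0..<i. \<Sum>y=0..<t. \<bar>w x y\<bar>) + (\<Sum>y=0..<j. \<bar>w i y\<bar>) \<and>
    (\<forall>x\<in>{0..<s}. \<forall>y\<in>{s..<s+t}. x < i \<or> x = i \<and> y < s + j \<longrightarrow>
      arc_cost \<tau> x y = w x (y - s) \<and> arc_cost \<tau> y x = - w x (y - s))"], goal_cases)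
  case (7 i \<tau>)
  show ?case
  proof (intro conjI ballI impI)
    show "rmem \<tau> ''big'' 0 = 1 + (\<Sum>x=0..<i+1. \<Sum>y=0..<t. \<bar>w x y\<bar>) + (\<Sum>y=0..<0. \<bar>w (i+1) y\<bar>)"
      using 7 by (simp add: sum_atLeastLessThan_int_Suc)
    fix x y assume xy: "x \<in> {0..<s}" "y \<in> {s..<s+t}" "x < i + 1 \<or> x = i + 1 \<and> y < s + 0"
    then have "x < i \<or> x = i \<and> y < s + t" by auto
    then show "arc_cost \<tau> x y = w x (y - s)" "arc_cost \<tau> y x = - w x (y - s)"
      using bspec[OF bspec[OF conjunct2[OF 7(3)] xy(1)] xy(2)] by auto
  qed
next
  case (9 i j \<tau>)
  have e: "imem \<tau> ''s'' 0 = s" "imem \<tau> ''off'' = imem \<sigma> ''off''" "rmem \<tau> ''weight'' = rmem \<sigma> ''weight''"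
    using 9(8) st by (simp_all add: agree_def)
  have off': "imem \<sigma> ''off'' i = cell i 0" "imem \<sigma> ''off'' (s + j) = cell (s + j) 0"
    using 9(1-4) by (auto intro!: off)
  have wt: "rmem \<sigma> ''weight'' (i * t + j) = w i j" using 9(1-4) weight by simp
  show ?case
    using 9(1-4,9) unfolding read_weight_def
    by (auto simp: wp_Seq e 9(5-7) off' wt sum_atLeastLessThan_int_Suc)
next
  case (10 k \<tau>)
  then show ?case by simp
qed (use st big s_nonneg t_nonneg in auto)

lemma wp_read_bounds:
  assumes st: "imem \<sigma> ''s'' 0 = s" "imem \<sigma> ''t'' 0 = t"
    and alpha: "\<And>i. i \<in> {0..<s} \<Longrightarrow> imem \<sigma> ''alpha'' i = L i \<and> imem \<sigma> ''alpha_cap'' i = H i"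
    and beta: "\<And>j. j \<in> {0..<t} \<Longrightarrow> imem \<sigma> ''beta_cap'' j = - L (s + j) \<and> imem \<sigma> ''beta'' j = - H (s + j)"
  shows "wp read_bounds (\<lambda>k \<tau>. k \<le> 18 + 42 * nat s + 42 * nat t \<and>
    (\<forall>v\<in>{0..<s+t}. imem \<tau> ''L'' v = L v \<and> imem \<tau> ''H'' v = H v)) \<sigma>"
  unfolding read_bounds_def
proof (rule wp_SeqI[where R = "\<lambda>\<tau>. \<forall>v\<in>{0..<s}. imem \<tau> ''L'' v = L v \<and> imem \<tau> ''H'' v = H v" and B = "9 + 42 * nat s"],
    goal_cases)
  case 1
  show ?case
  proof (rule wp_For[where n = s and B = 30 and I = "\<lambda>i \<tau>. \<forall>v\<in>{0..<i}. imem \<tau> ''L'' v = L v \<and> imem \<tau> ''H'' v = H v"],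
      goal_cases)
    case (8 i \<tau>)
    have "imem \<tau> ''alpha'' = imem \<sigma> ''alpha''" "imem \<tau> ''alpha_cap'' = imem \<sigma> ''alpha_cap''"
      using 8(4) by (simp_all add: agree_def)
    then show ?case using 8(1-3,5) alpha[of i] by (simp add: wp_Seq)
  qed (use st s_nonneg in auto)
next
  case (2 k1 \<tau>1)
  have e1: "imem \<tau>1 ''s'' 0 = s" "imem \<tau>1 ''t'' 0 = t" "imem \<tau>1 ''beta'' = imem \<sigma> ''beta''"
    "imem \<tau>1 ''beta_cap'' = imem \<sigma> ''beta_cap''"
    using 2(3) st by (simp_all add: agree_def)
  show ?case
  proof (rule wp_For[where n = t and B = 30 and I = "\<lambda>j \<tau>. \<forall>v\<in>{0..<s+j}. imem \<tau> ''L'' v = L v \<and> imem \<tau> ''H'' v = H v"],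
      goal_cases)
    case (8 i \<tau>)
    have "imem \<tau> ''beta'' = imem \<sigma> ''beta''" "imem \<tau> ''beta_cap'' = imem \<sigma> ''beta_cap''" "imem \<tau> ''s'' 0 = s"
      using 8(4) e1 by (simp_all add: agree_def)
    then show ?case using 8(1-3,5) beta[of i] by (simp add: wp_Seq)
  next
    case (9 k \<tau>)
    then show ?case using 2(1) by simp
  qed (use e1 2(2) t_nonneg in auto)
qed

text \<open>At supply 0 the potential of a node is the slope at 1, the price of its first unit. The
  arc from the root is then tight, and the arc back is nonnegative since the slope at 0 is at most
  the slope at 1.\<close>

lemma wp_link_root:
  assumes ready: "ready \<sigma>"
    and zero: "imem \<sigma> ''E'' = (\<lambda>_. 0)" "imem \<sigma> ''z'' = (\<lambda>_. 0)" "rmem \<sigma> ''p'' = (\<lambda>_. 0)"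
    and R: "\<forall>x\<in>{0..<s}. \<forall>y\<in>{s..<s+t}. arc_cost \<sigma> x y = w x (y - s) \<and> arc_cost \<sigma> y x = - w x (y - s)"
  shows "wp (For ''x'' ''r'' link_root) (\<lambda>k \<tau>. k \<le> 9 + 112 * nat (s+t) \<and> consistent \<tau> {} \<and>
    (\<forall>x\<in>{0..<s+t}. excess \<tau> x = 0)) \<sigma>"
proof -
  have st: "0 \<le> s" "0 \<le> t" by (rule s_nonneg t_nonneg)+
  let ?g = "\<lambda>v. slope C (L v) (H v)"
  let ?I = "\<lambda>i \<tau>. (\<forall>u\<in>{0..s+t}. \<forall>v\<in>{0..s+t}. arc \<tau> u v \<longleftrightarrow> u = s+t \<and> v < i \<or> v = s+t \<and> u < i) \<and>
      (\<forall>v\<in>{0..<i}. arc_cost \<tau> (s+t) v = ?g v 1 \<and> arc_cost \<tau> v (s+t) = - ?g v 0 \<and> rmem \<tau> ''p'' v = ?g v 1) \<and>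
      rmem \<tau> ''p'' (s+t) = 0 \<and>
      (\<forall>x\<in>{0..<s}. \<forall>y\<in>{s..<s+t}. arc_cost \<tau> x y = w x (y - s) \<and> arc_cost \<tau> y x = - w x (y - s))"
  show ?thesis
  proof (rule wp_For[where n = "s+t" and B = 100 and I = ?I], goal_cases)
    case (8 i \<tau>)
    note I = conjunct1[OF 8(5)] conjunct1[OF conjunct2[OF 8(5)]]
      conjunct1[OF conjunct2[OF conjunct2[OF 8(5)]]] conjunct2[OF conjunct2[OF conjunct2[OF 8(5)]]]
    define \<tau>1 where "\<tau>1 = iupdate ''E'' (cell (s+t) i) 1 (iupdate ''E'' (cell i (s+t)) 1 \<tau>)"
    have a: "agree {''x'', ''E''} {''p'', ''R''} \<sigma> \<tau>" using 8(4) by simp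
    have rd: "ready \<tau>" by (rule ready_agree[OF ready a]) auto
    have rd1: "ready \<tau>1" by (rule ready_agree[OF rd, of "{''E''}" "{}"]) (auto simp: agree_def \<tau>1_def)
    have i: "i \<in> {0..<s+t}" using 8 by simp
    have e: "imem \<tau> ''r'' 0 = s+t" "imem \<tau> ''off'' i = cell i 0" "imem \<tau> ''off'' (s+t) = cell (s+t) 0"
      using rd i st by (simp_all add: ready_def)
    have z: "imem \<tau>1 ''z'' = (\<lambda>_. 0)" using a zero by (simp add: agree_def \<tau>1_def)
    have x1: "imem \<tau>1 ''x'' 0 = i" using 8 by (simp add: \<tau>1_def)
    define J where "J = ?I (i+1)"
    from wp_agree[OF wp_update_root_costs[OF rd1 x1 i]]
    have "wp update_root_costs (\<lambda>k \<tau>'. k + 30 \<le> 100 \<and> imem \<tau>' ''x'' 0 = i \<and> imem \<tau>' ''off'' (s+t) = cell (s+t) 0 \<and>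
       imem \<tau>' ''r'' 0 = s+t \<and>
       J (rupdate ''p'' i (arc_cost \<tau>' (s+t) i) \<tau>')) \<tau>1"
    proof (rule wp_mono, elim conjE, goal_cases)
      case (1 k \<tau>')
      have e': "imem \<tau>' ''E'' = imem \<tau>1 ''E''" "rmem \<tau>' ''p'' = rmem \<tau> ''p''"
          "imem \<tau>' ''x'' 0 = i" "imem \<tau>' ''off'' (s+t) = cell (s+t) 0" "imem \<tau>' ''r'' 0 = s+t"
        using 1(2) e x1 by (simp_all add: agree_def \<tau>1_def)
      have c: "arc_cost \<tau>' u v = (if u = s+t \<and> v = i then ?g i 1
           else if u = i \<and> v = s+t then - ?g i 0 else arc_cost \<tau> u v)"
        if "u \<in> {0..s+t}" "v \<in> {0..s+t}" for u v using 1(4) that z by (simp add: \<tau>1_def)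
      have E: "arc \<tau>1 u v \<longleftrightarrow> u = s+t \<and> v = i \<or> u = i \<and> v = s+t \<or> arc \<tau> u v"
        if "u \<in> {0..s+t}" "v \<in> {0..s+t}" for u v using that i by (auto simp: \<tau>1_def)
      let ?\<tau> = "rupdate ''p'' i (arc_cost \<tau>' (s+t) i) \<tau>'"
      have "arc ?\<tau> u v \<longleftrightarrow> u = s+t \<and> v < i + 1 \<or> v = s+t \<and> u < i + 1" if "u \<in> {0..s+t}" "v \<in> {0..s+t}" for u v
      proof -
        have "arc ?\<tau> u v = arc \<tau>1 u v" by (simp add: e'(1))
        also have "\<dots> = (u = s+t \<and> v = i \<or> u = i \<and> v = s+t \<or> u = s+t \<and> v < i \<or> v = s+t \<and> u < i)"
          by (simp only: E[OF that] bspec[OF bspec[OF I(1) that(1)] that(2)])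
        also have "\<dots> = (u = s+t \<and> v < i + 1 \<or> v = s+t \<and> u < i + 1)"
          unfolding zless_add1_eq by blast
        finally show ?thesis .
      qed
      moreover have "arc_cost ?\<tau> (s+t) v = ?g v 1 \<and> arc_cost ?\<tau> v (s+t) = - ?g v 0 \<and> rmem ?\<tau> ''p'' v = ?g v 1"
        if "v \<in> {0..<i+1}" for v
      proof (cases "v = i")
        case False
        then have "v \<in> {0..<i}" using that by auto
        then show ?thesis using bspec[OF I(2), of v] i False by (simp add: e' c)
      qed (use i in \<open>simp add: e' c\<close>)
      moreover have "rmem ?\<tau> ''p'' (s+t) = 0" using I(3) i by (simp add: e')
      moreover have "arc_cost ?\<tau> x y = w x (y - s) \<and> arc_cost ?\<tau> y x = - w x (y - s)"
        if "x \<in> {0..<s}" "y \<in> {s..<s+t}" for x y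
        using bspec[OF bspec[OF I(4) that(1)] that(2)] that st by (simp add: e' c)
      ultimately have "J ?\<tau>" unfolding J_def by (intro conjI ballI) blast+
      moreover have "k + 30 \<le> 100" using 1(3) by simp
      ultimately show ?case using e'(3-5) by (intro conjI)
    qed
    then have "wp link_root (\<lambda>k \<tau>'. k \<le> 100 \<and> J \<tau>') \<tau>"
      unfolding link_root_def wp_Seq wp_IAssign
      by (auto simp: e 8(3) simp flip: \<tau>1_def elim!: wp_mono)
    then show ?case unfolding J_def .
  next
    case (9 k \<tau>)
    have z: "imem \<tau> ''z'' = (\<lambda>_. 0)" using 9(3) zero by (simp add: agree_def)
    note I = conjunct1[OF 9(1)] conjunct1[OF conjunct2[OF 9(1)]]
      conjunct1[OF conjunct2[OF conjunct2[OF 9(1)]]] conjunct2[OF conjunct2[OF conjunct2[OF 9(1)]]]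
    have E: "arc \<tau> u v \<longleftrightarrow> u = s+t \<and> v < s+t \<or> v = s+t \<and> u < s+t" if "u \<in> {0..s+t}" "v \<in> {0..s+t}" for u v
      using bspec[OF bspec[OF I(1) that(1)] that(2)] .
    have c: "arc_cost \<tau> (s+t) v = ?g v 1" "arc_cost \<tau> v (s+t) = - ?g v 0" "rmem \<tau> ''p'' v = ?g v 1"
      if "v \<in> {0..<s+t}" for v using bspec[OF I(2) that] by simp_all
    have p: "rmem \<tau> ''p'' (s+t) = 0" using I(3) .
    have w: "arc_cost \<tau> x y = w x (y - s)" "arc_cost \<tau> y x = - w x (y - s)"
      if "x \<in> {0..<s}" "y \<in> {s..<s+t}" for x y using bspec[OF bspec[OF I(4) that(1)] that(2)] by simp_all
    have "consistent \<tau> {}"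
      unfolding residual_def
    proof (intro conjI ballI impI)
      fix u v assume uv: "u \<in> {0..s+t}" "v \<in> {0..s+t}" "arc \<tau> u v"
      then consider "u = s+t" "v \<in> {0..<s+t}" | "v = s+t" "u \<in> {0..<s+t}" using E by force
      then show "0 \<le> reduced \<tau> u v"
      proof cases
        case 1
        then show ?thesis using c[of v] p by simp
      next
        case 2
        then show ?thesis using c[of u] p C_pos slope_mono[of C 0 1 "L u" "H u"] by simp
      qed
    next
      fix v assume v: "v \<in> {0..<s+t}"
      show "arc \<tau> (s+t) v" "arc \<tau> v (s+t)" using E v st by auto
      show "arc_cost \<tau> (s+t) v = ?g v (imem \<tau> ''z'' v + 1)" "arc_cost \<tau> v (s+t) = - ?g v (imem \<tau> ''z'' v)"
        using c[OF v] by (simp_all add: z)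
    next
      fix x y assume xy: "x \<in> {0..<s}" "y \<in> {s..<s+t}"
      show "arc_cost \<tau> x y = w x (y - s)" "arc_cost \<tau> y x = - w x (y - s)" using w[OF xy] .
      have "\<not> arc \<tau> x y" "\<not> arc \<tau> y x" using E[of x y] E[of y x] xy st by auto
      then show "if (x, y) \<in> {} then arc \<tau> x y \<noteq> arc \<tau> y x else \<not> arc \<tau> x y \<and> \<not> arc \<tau> y x" by simp
    next
      fix x y assume "x \<in> {0..<s}" "y \<in> {0..<s}"
      then show "\<not> arc \<tau> x y" using E[of x y] st by auto
    next
      fix x y assume "x \<in> {s..<s+t}" "y \<in> {s..<s+t}"
      then show "\<not> arc \<tau> x y" using E[of x y] st by auto
    next
      show "\<not> arc \<tau> (s+t) (s+t)" using E[of "s+t" "s+t"] st by auto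
    qed
    moreover have "excess \<tau> x = 0" if "x \<in> {0..<s+t}" for x
    proof -
      have "\<not> arc \<tau> u v" if "u \<in> {s..<s+t}" "v \<in> {0..<s}" for u v
        using E[of u v] that st by auto
      then show ?thesis using that by (simp add: outflow_def z)
    qed
    ultimately show ?case using 9(2) by simp
  next
    case (6 i \<tau> v)
    then show ?case by simp
  next
    case 7
    then show ?case using zero R st by simp
  qed (use ready st in \<open>auto simp: ready_def\<close>)
qed

end

text \<open>Bounds a \<open>Pairs\<close> loop whose body takes quadratic time by a fourth power;
  \<open>51 = 12 + 21 + 18\<close> collects the overheads in \<open>wp_Pairs\<close>.\<close>

lemma mult_le_pow4:
  fixes a b m c B :: nat
  assumes "a \<le> m" "b \<le> m" "1 \<le> m" "B \<le> c * m ^ 2"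
  shows "12 + a * (21 + b * (18 + B)) \<le> (51 + c) * m ^ 4"
proof -
  have p: "1 \<le> m ^ 4" "m \<le> m ^ 4" "m ^ 2 \<le> m ^ 4"
    using assms(3) power_increasing[of 1 4 m] power_increasing[of 2 4 m] by auto
  have "a * b * (18 + B) \<le> m * m * (18 + c * m ^ 2)"
    using assms by (intro mult_mono) auto
  also have "\<dots> = 18 * m ^ 2 + c * m ^ 4" by (simp add: algebra_simps power2_eq_square power4_eq_xxxx)
  finally have "12 + a * (21 + b * (18 + B)) \<le> 12 + 21 * m + (18 * m ^ 2 + c * m ^ 4)"
    using assms(1) by (simp add: algebra_simps)
  also have "\<dots> \<le> 12 * m ^ 4 + 21 * m ^ 4 + (18 * m ^ 4 + c * m ^ 4)" using p by linarith
  finally show ?thesis by (simp add: algebra_simps)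
qed

context network
begin

section \<open>The complete run and its optimality certificate\<close>

lemma wp_setup_network:
  assumes st: "imem \<sigma> ''s'' 0 = s" "imem \<sigma> ''t'' 0 = t"
    and zero: "imem \<sigma> ''off'' 0 = 0" "imem \<sigma> ''E'' = (\<lambda>_. 0)" "imem \<sigma> ''z'' = (\<lambda>_. 0)" "rmem \<sigma> ''p'' = (\<lambda>_. 0)"
    and alpha: "\<And>i. i \<in> {0..<s} \<Longrightarrow> imem \<sigma> ''alpha'' i = L i \<and> imem \<sigma> ''alpha_cap'' i = H i"
    and beta: "\<And>j. j \<in> {0..<t} \<Longrightarrow> imem \<sigma> ''beta_cap'' j = - L (s + j) \<and> imem \<sigma> ''beta'' j = - H (s + j)"
    and weight: "\<And>i j. i \<in> {0..<s} \<Longrightarrow> j \<in> {0..<t} \<Longrightarrow> rmem \<sigma> ''weight'' (i * t + j) = w i j"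
    and C: "C = 1 + (\<Sum>i=0..<s. \<Sum>j=0..<t. \<bar>w i j\<bar>)"
  shows "wp setup_network (\<lambda>k \<tau>. k \<le> 500 * (nat (s+t+1) + 1)^4 \<and> ready \<tau> \<and> consistent \<tau> {} \<and>
    (\<forall>x\<in>{0..<s+t}. excess \<tau> x = 0)) \<sigma>"
  unfolding setup_network_def
proof (rule wp_SeqI[OF wp_read_size[OF st zero(1)]])
  let ?m = "nat (s+t+1) + 1"
  fix k1 \<tau>1 assume k1: "k1 \<le> 30 + 40 * nat (s+t+1)"
    and r1: "imem \<tau>1 ''N'' 0 = s+t+1 \<and> imem \<tau>1 ''r'' 0 = s+t \<and>
      rmem \<tau>1 ''big'' 0 = 1 \<and> (\<forall>v\<in>{0..s+t}. imem \<tau>1 ''off'' v = cell v 0)"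
    and a1: "agree (iwrites read_size) (rwrites read_size) \<sigma> \<tau>1"
  show "wp (Seq (Pairs read_weight) (Seq read_bounds (For ''x'' ''r'' link_root)))
    (\<lambda>l \<tau>. k1 + l \<le> 500 * ?m^4 \<and> ready \<tau> \<and> consistent \<tau> {} \<and> (\<forall>x\<in>{0..<s+t}. excess \<tau> x = 0)) \<tau>1"
  proof (rule wp_SeqI[OF wp_read_weight_pairs])
    show "imem \<tau>1 ''s'' 0 = s" "imem \<tau>1 ''t'' 0 = t" "rmem \<tau>1 ''big'' 0 = 1"
      using a1 st r1 by (simp_all add: agree_def)
    show "\<And>v. v \<in> {0..s+t} \<Longrightarrow> imem \<tau>1 ''off'' v = cell v 0" using r1 by simp
    show "\<And>i j. i \<in> {0..<s} \<Longrightarrow> j \<in> {0..<t} \<Longrightarrow> rmem \<tau>1 ''weight'' (i * t + j) = w i j"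
      using a1 weight by (simp add: agree_def)
    fix k2 \<tau>2 assume k2: "k2 \<le> 12 + nat s * (21 + nat t * 78)"
      and r2: "rmem \<tau>2 ''big'' 0 = 1 + (\<Sum>i=0..<s. \<Sum>j=0..<t. \<bar>w i j\<bar>) \<and>
      (\<forall>x\<in>{0..<s}. \<forall>y\<in>{s..<s+t}. arc_cost \<tau>2 x y = w x (y - s) \<and> arc_cost \<tau>2 y x = - w x (y - s))"
      and a2: "agree (iwrites (Pairs read_weight)) (rwrites (Pairs read_weight)) \<tau>1 \<tau>2"
    show "wp (Seq read_bounds (For ''x'' ''r'' link_root))
      (\<lambda>l \<tau>. k1 + (k2 + l) \<le> 500 * ?m^4 \<and> ready \<tau> \<and> consistent \<tau> {} \<and> (\<forall>x\<in>{0..<s+t}. excess \<tau> x = 0)) \<tau>2"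
    proof (rule wp_SeqI[OF wp_read_bounds])
      show "imem \<tau>2 ''s'' 0 = s" "imem \<tau>2 ''t'' 0 = t"
        using a1 a2 st by (simp_all add: agree_def)
      show "\<And>i. i \<in> {0..<s} \<Longrightarrow> imem \<tau>2 ''alpha'' i = L i \<and> imem \<tau>2 ''alpha_cap'' i = H i"
        "\<And>j. j \<in> {0..<t} \<Longrightarrow> imem \<tau>2 ''beta_cap'' j = - L (s + j) \<and> imem \<tau>2 ''beta'' j = - H (s + j)"
        using a1 a2 alpha beta by (simp_all add: agree_def)
      fix k3 \<tau>3 assume k3: "k3 \<le> 18 + 42 * nat s + 42 * nat t"
        and r3: "\<forall>v\<in>{0..<s+t}. imem \<tau>3 ''L'' v = L v \<and> imem \<tau>3 ''H'' v = H v"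
        and a3: "agree (iwrites read_bounds) (rwrites read_bounds) \<tau>2 \<tau>3"
      have e: "imem \<tau>3 ''s'' 0 = s" "imem \<tau>3 ''t'' 0 = t" "imem \<tau>3 ''N'' 0 = s+t+1" "imem \<tau>3 ''r'' 0 = s+t"
          "imem \<tau>3 ''off'' = imem \<tau>1 ''off''" "rmem \<tau>3 ''big'' = rmem \<tau>2 ''big''" "rmem \<tau>3 ''R'' = rmem \<tau>2 ''R''"
          "imem \<tau>3 ''E'' = (\<lambda>_. 0)" "imem \<tau>3 ''z'' = (\<lambda>_. 0)" "rmem \<tau>3 ''p'' = (\<lambda>_. 0)"
        using a1 a2 a3 st r1 zero by (simp_all add: agree_def)
      have rd: "ready \<tau>3" unfolding ready_def using e r1 r2 r3 C by simp
      have "wp (For ''x'' ''r'' link_root) (\<lambda>k \<tau>. (k \<le> 9 + 112 * nat (s+t) \<and> consistent \<tau> {} \<and>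
        (\<forall>x\<in>{0..<s+t}. excess \<tau> x = 0)) \<and> agree {''x'', ''E''} {''p'', ''R''} \<tau>3 \<tau>) \<tau>3"
        using wp_agree[OF wp_link_root[OF rd e(8,9,10)]] r2 e(7) by simp
      then show "wp (For ''x'' ''r'' link_root)
        (\<lambda>l \<tau>. k1 + (k2 + (k3 + l)) \<le> 500 * ?m^4 \<and> ready \<tau> \<and> consistent \<tau> {} \<and> (\<forall>x\<in>{0..<s+t}. excess \<tau> x = 0)) \<tau>3"
      proof (rule wp_mono, elim conjE, intro conjI)
        fix k4 assume k4: "k4 \<le> 9 + 112 * nat (s+t)"
        have le: "nat s \<le> ?m" "nat t \<le> ?m" "nat (s+t) \<le> ?m" "nat (s+t+1) \<le> ?m" "1 \<le> ?m"
          using s_nonneg t_nonneg by auto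
        \<comment> \<open>The 78 units per pair in the bound on \<open>k2\<close> are 18 for the
          loop and 60 for the body.\<close>
        have "(60::nat) \<le> 60 * ?m ^ 2" by simp
        from mult_le_pow4[OF le(1,2,5) this] have "k2 \<le> 111 * ?m ^ 4" using k2 by simp
        moreover have "?m \<le> ?m ^ 4" by (rule self_le_power) auto
        ultimately show "k1 + (k2 + (k3 + k4)) \<le> 500 * ?m ^ 4" using le k1 k3 k4 by linarith
      next
        fix \<tau> assume "agree {''x'', ''E''} {''p'', ''R''} \<tau>3 \<tau>"
        then show "ready \<tau>" by (rule ready_agree[OF rd]) auto
      qed
    qed
  qed
qed

definition inserted :: "int \<Rightarrow> int \<Rightarrow> (int \<times> int) set" where
  "inserted i j = {(x, y). x \<in> {0..<s} \<and> y \<in> {s..<s+t} \<and> (x < i \<or> x = i \<and> y < s + j)}"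

lemma wp_insert_pairs:
  assumes ready: "ready \<sigma>" and res: "consistent \<sigma> {}" and bal: "\<forall>x\<in>{0..<s+t}. excess \<sigma> x = 0"
  shows "wp (Pairs insert_pair) (\<lambda>k \<tau>. k \<le> 751 * (nat (s+t+1) + 1)^4 \<and>
    consistent \<tau> ({0..<s} \<times> {s..<s+t}) \<and> (\<forall>x\<in>{0..<s+t}. excess \<tau> x = 0)) \<sigma>"
proof (rule wp_Pairs[where s = s and t = t and B = "700 * (nat (s+t+1) + 1)^2" and
    I = "\<lambda>i j \<tau>. consistent \<tau> (inserted i j) \<and> (\<forall>x\<in>{0..<s+t}. excess \<tau> x = 0)"], goal_cases)
  case (7 i \<tau>)
  have "inserted i t = inserted (i + 1) 0" by (auto simp: inserted_def)
  then show ?case using 7 by simp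
next
  case 8
  have "inserted 0 0 = {}" by (auto simp: inserted_def)
  then show ?case using res bal by simp
next
  case (9 i j \<tau>)
  have "ready \<tau>" by (rule ready_agree[OF ready 9(8)]) auto
  moreover have "(i, s + j) \<notin> inserted i j" by (simp add: inserted_def)
  moreover have "insert (i, s + j) (inserted i j) = inserted i (j + 1)"
    using 9(1-4) by (auto simp: inserted_def)
  ultimately show ?case using wp_insert_pair[of \<tau> i j "inserted i j"] 9(1-6,9) by simp
next
  case (10 k \<tau>)
  have "inserted s 0 = {0..<s} \<times> {s..<s+t}" by (auto simp: inserted_def)
  moreover have "12 + nat s * (21 + nat t * (18 + 700 * (nat (s+t+1) + 1)^2)) \<le> (51 + 700) * (nat (s+t+1) + 1)^4"
    by (rule mult_le_pow4) (use s_nonneg t_nonneg in auto)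
  ultimately show ?case using 10 by simp
qed (use ready s_nonneg t_nonneg in \<open>auto simp: ready_def\<close>)

lemma wp_extract_matching:
  assumes ready: "ready \<sigma>" and M: "imem \<sigma> ''M'' = (\<lambda>_. 0)"
  shows "wp extract_matching (\<lambda>k \<tau>. k \<le> 91 * (nat (s+t+1) + 1)^4 \<and>
    (\<forall>i\<in>{0..<s}. \<forall>j\<in>{0..<t}. imem \<tau> ''M'' (i * t + j) = 1 \<longleftrightarrow> arc \<sigma> (s + j) i)) \<sigma>"
  unfolding extract_matching_def
proof (rule wp_Pairs[where s = s and t = t and B = 40 and
    I = "\<lambda>i j \<tau>. \<forall>x\<in>{0..<s}. \<forall>y\<in>{0..<t}. imem \<tau> ''M'' (x * t + y) =
      (if (x < i \<or> x = i \<and> y < j) \<and> arc \<sigma> (s + y) x then 1 else 0)"], goal_cases)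
  case (7 i \<tau>)
  have "(x < i \<or> x = i \<and> y < t) = (x < i + 1 \<or> x = i + 1 \<and> y < 0)" if "y \<in> {0..<t}" for x y
    using that by auto
  then show ?case using 7(3) by simp
next
  case (9 i j \<tau>)
  have e: "imem \<tau> ''E'' = imem \<sigma> ''E''" "imem \<tau> ''s'' 0 = s" "imem \<tau> ''off'' (s + j) = cell (s + j) 0"
    using 9(1-4,8) ready by (simp_all add: agree_def ready_def)
  have eq: "i * t + j = x * t + y \<longleftrightarrow> i = x \<and> j = y" "x * t + y = i * t + j \<longleftrightarrow> i = x \<and> j = y"
    if "y \<in> {0..<t}" for x y
    using that 9(3,4) row_major_eq_iff[of j t y i x] by auto
  have step: "(x < i \<or> x = i \<and> y < j + 1) \<longleftrightarrow> (x < i \<or> x = i \<and> y < j) \<or> i = x \<and> j = y" for x y by auto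
  let ?M = "\<lambda>x y. if (x < i \<or> x = i \<and> y < j + 1) \<and> arc \<sigma> (s + y) x then 1 else 0 :: int"
  have old: "imem \<tau> ''M'' (x * t + y) = ?M x y"
    if "x \<in> {0..<s}" "y \<in> {0..<t}" "\<not> (i = x \<and> j = y) \<or> \<not> arc \<sigma> (s + j) i" for x y
    using bspec[OF bspec[OF 9(9) that(1)] that(2)] that(3) step[of x y] by auto
  show ?case
  proof (cases "arc \<sigma> (s + j) i")
    case True
    have "((imem \<tau> ''M'')(i * t + j := 1)) (x * t + y) = ?M x y" if "x \<in> {0..<s}" "y \<in> {0..<t}" for x y
    proof (cases "i = x \<and> j = y")
      case False
      then have "x * t + y \<noteq> i * t + j" using eq(2)[OF that(2), of x] by blast
      moreover have "imem \<tau> ''M'' (x * t + y) = ?M x y" by (rule old[OF that]) (use False in blast)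
      ultimately show ?thesis by (subst fun_upd_other)
    qed (use True in auto)
    then show ?thesis using True by (simp add: e 9(5-7))
  next
    case False
    then show ?thesis using old by (simp add: e 9(5-7))
  qed
next
  case (10 k \<tau>)
  have "12 + nat s * (21 + nat t * (18 + 40)) \<le> (51 + 40) * (nat (s+t+1) + 1)^4"
    by (rule mult_le_pow4) (use s_nonneg t_nonneg in auto)
  then show ?case using 10 by simp
qed (use ready M s_nonneg t_nonneg in \<open>auto simp: ready_def\<close>)

text \<open>The postcondition keeps only the certificate behind the output. Optimality can thus be
  proved about residual networks without reference to stores.\<close>

lemma wp_mmdc_program:
  assumes st: "imem \<sigma> ''s'' 0 = s" "imem \<sigma> ''t'' 0 = t"
    and zero: "imem \<sigma> ''off'' 0 = 0" "imem \<sigma> ''E'' = (\<lambda>_. 0)" "imem \<sigma> ''z'' = (\<lambda>_. 0)" "rmem \<sigma> ''p'' = (\<lambda>_. 0)"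
      "imem \<sigma> ''M'' = (\<lambda>_. 0)"
    and alpha: "\<And>i. i \<in> {0..<s} \<Longrightarrow> imem \<sigma> ''alpha'' i = L i \<and> imem \<sigma> ''alpha_cap'' i = H i"
    and beta: "\<And>j. j \<in> {0..<t} \<Longrightarrow> imem \<sigma> ''beta_cap'' j = - L (s + j) \<and> imem \<sigma> ''beta'' j = - H (s + j)"
    and weight: "\<And>i j. i \<in> {0..<s} \<Longrightarrow> j \<in> {0..<t} \<Longrightarrow> rmem \<sigma> ''weight'' (i * t + j) = w i j"
    and C: "C = 1 + (\<Sum>i=0..<s. \<Sum>j=0..<t. \<bar>w i j\<bar>)"
  shows "wp mmdc_program (\<lambda>k \<tau>. k \<le> 1400 * (nat (s+t+1) + 1)^4 \<and> (\<exists>E R p z.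
    residual E R p z ({0..<s} \<times> {s..<s+t}) \<and> (\<forall>v\<in>{0..<s+t}. outflow E v = z v) \<and>
    (\<forall>i\<in>{0..<s}. \<forall>j\<in>{0..<t}. imem \<tau> ''M'' (i * t + j) = 1 \<longleftrightarrow> E (s + j) i))) \<sigma>"
  unfolding mmdc_program_def
proof (rule wp_SeqI[OF wp_setup_network[OF st zero(1-4) alpha beta weight C]])
  let ?m = "(nat (s+t+1) + 1)^4"
  fix k1 \<tau>1 assume k1: "k1 \<le> 500 * ?m"
    and r1: "ready \<tau>1 \<and> consistent \<tau>1 {} \<and> (\<forall>x\<in>{0..<s+t}. excess \<tau>1 x = 0)"
    and a1: "agree (iwrites setup_network) (rwrites setup_network) \<sigma> \<tau>1"
  show "wp (Seq (Pairs insert_pair) extract_matching) (\<lambda>k \<tau>. k1 + k \<le> 1400 * ?m \<and> (\<exists>E R p z.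
    residual E R p z ({0..<s} \<times> {s..<s+t}) \<and> (\<forall>v\<in>{0..<s+t}. outflow E v = z v) \<and>
    (\<forall>i\<in>{0..<s}. \<forall>j\<in>{0..<t}. imem \<tau> ''M'' (i * t + j) = 1 \<longleftrightarrow> E (s + j) i))) \<tau>1"
  proof (rule wp_SeqI[OF wp_insert_pairs])
    fix k2 \<tau>2 assume k2: "k2 \<le> 751 * ?m"
      and r2: "consistent \<tau>2 ({0..<s} \<times> {s..<s+t}) \<and> (\<forall>x\<in>{0..<s+t}. excess \<tau>2 x = 0)"
      and a2: "agree (iwrites (Pairs insert_pair)) (rwrites (Pairs insert_pair)) \<tau>1 \<tau>2"
    have rd2: "ready \<tau>2" by (rule ready_agree[OF conjunct1[OF r1] a2]) auto
    have M2: "imem \<tau>2 ''M'' = (\<lambda>_. 0)" using a1 a2 zero by (simp add: agree_def)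
    have r2': "\<forall>v\<in>{0..<s+t}. outflow (arc \<tau>2) v = imem \<tau>2 ''z'' v" using r2 by simp
    show "wp extract_matching (\<lambda>l \<tau>. k1 + (k2 + l) \<le> 1400 * ?m \<and> (\<exists>E R p z.
      residual E R p z ({0..<s} \<times> {s..<s+t}) \<and> (\<forall>v\<in>{0..<s+t}. outflow E v = z v) \<and>
      (\<forall>i\<in>{0..<s}. \<forall>j\<in>{0..<t}. imem \<tau> ''M'' (i * t + j) = 1 \<longleftrightarrow> E (s + j) i))) \<tau>2"
    proof (rule wp_mono[OF wp_extract_matching[OF rd2 M2]], elim conjE, intro conjI)
      fix l assume "l \<le> 91 * ?m"
      \<comment> \<open>\<open>500 + 751 + 91 = 1342\<close>.\<close>
      then show "k1 + (k2 + l) \<le> 1400 * ?m" using k1 k2 by linarith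
    next
      fix \<tau> assume "\<forall>i\<in>{0..<s}. \<forall>j\<in>{0..<t}. imem \<tau> ''M'' (i * t + j) = 1 \<longleftrightarrow> arc \<tau>2 (s + j) i"
      with r2 r2' show "\<exists>E R p z.
      residual E R p z ({0..<s} \<times> {s..<s+t}) \<and> (\<forall>v\<in>{0..<s+t}. outflow E v = z v) \<and>
      (\<forall>i\<in>{0..<s}. \<forall>j\<in>{0..<t}. imem \<tau> ''M'' (i * t + j) = 1 \<longleftrightarrow> E (s + j) i)" by blast
    qed
  qed (use r1 in auto)
qed

text \<open>With the penalty exceeding the total absolute weight, one unit of violation outweighs any difference in cost.\<close>

lemma certificate_optimal:
  fixes m' :: "int \<Rightarrow> int \<Rightarrow> bool"
  assumes res: "residual E R p z ({0..<s} \<times> {s..<s+t})"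
    and out: "\<And>v. v \<in> {0..<s+t} \<Longrightarrow> outflow E v = z v"
    and C: "C = 1 + (\<Sum>i=0..<s. \<Sum>j=0..<t. \<bar>w i j\<bar>)"
    and rows: "\<And>i. i \<in> {0..<s} \<Longrightarrow> (\<Sum>j=0..<t. of_bool (m' i j)) \<in> {L i..H i}"
    and cols: "\<And>j. j \<in> {0..<t} \<Longrightarrow> - (\<Sum>i=0..<s. of_bool (m' i j)) \<in> {L (s+j)..H (s+j)}"
  shows "i \<in> {0..<s} \<Longrightarrow> (\<Sum>j=0..<t. of_bool (E (s+j) i)) \<in> {L i..H i}"
    and "j \<in> {0..<t} \<Longrightarrow> - (\<Sum>i=0..<s. of_bool (E (s+j) i)) \<in> {L (s+j)..H (s+j)}"
    and "(\<Sum>i=0..<s. \<Sum>j=0..<t. of_bool (E (s+j) i) * w i j) \<le> (\<Sum>i=0..<s. \<Sum>j=0..<t. of_bool (m' i j) * w i j)"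
proof -
  let ?V = "(\<Sum>i=0..<s. violation (L i) (H i) (z i)) + (\<Sum>j=0..<t. violation (L (s+j)) (H (s+j)) (z (s+j)))"
  let ?cost = "\<Sum>i=0..<s. \<Sum>j=0..<t. of_bool (E (s+j) i) * w i j"
  let ?cost' = "\<Sum>i=0..<s. \<Sum>j=0..<t. of_bool (m' i j) * w i j"
  have viol0: "violation l h x = 0 \<longleftrightarrow> x \<in> {l..h}" for l h x by (auto simp: violation_def)
  have viol_ge: "0 \<le> violation l h x" for l h x by (simp add: violation_def)
  have z1: "(\<Sum>i=0..<s. violation (L i) (H i) (\<Sum>j=0..<t. of_bool (m' i j))) = 0"
    by (rule sum.neutral) (use rows viol0 in blast)
  have z2: "(\<Sum>j=0..<t. violation (L (s+j)) (H (s+j)) (- (\<Sum>i=0..<s. of_bool (m' i j)))) = 0"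
    by (rule sum.neutral) (use cols viol0 in blast)
  have opt: "?cost + C * real_of_int ?V \<le> ?cost'"
    using penalized_optimal[OF res out, of m'] unfolding z1 z2 by simp
  \<comment> \<open>Two sets of pairs differ in cost by at most the total absolute weight, which is
    \<open>C - 1\<close>.\<close>
  have "?cost' - ?cost = (\<Sum>i=0..<s. \<Sum>j=0..<t. (of_bool (m' i j) - of_bool (E (s+j) i)) * w i j)"
    by (simp add: left_diff_distrib sum_subtractf)
  also have "\<dots> \<le> (\<Sum>i=0..<s. \<Sum>j=0..<t. \<bar>w i j\<bar>)" by (intro sum_mono) auto
  finally have lt: "?cost' - ?cost < C" using C by simp
  have Vge: "0 \<le> ?V" by (intro add_nonneg_nonneg sum_nonneg viol_ge)
  have V0: "?V = 0"
  proof (rule ccontr)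
    assume "?V \<noteq> 0"
    \<comment> \<open>Integrality: a nonzero total violation is at least 1 and so costs at least
      \<open>C\<close>.\<close>
    then have "1 \<le> ?V" using Vge by linarith
    then have "real_of_int 1 \<le> real_of_int ?V" by (simp only: of_int_le_iff)
    then have "C * real_of_int 1 \<le> C * real_of_int ?V" using C_pos by (intro mult_left_mono) auto
    then show False using opt lt by simp
  qed
  then show "?cost \<le> ?cost'" using opt by simp
  have "(\<Sum>i=0..<s. violation (L i) (H i) (z i)) = 0" "(\<Sum>j=0..<t. violation (L (s+j)) (H (s+j)) (z (s+j))) = 0"
    using V0 sum_nonneg[of "{0..<s}" "\<lambda>i. violation (L i) (H i) (z i)"]
      sum_nonneg[of "{0..<t}" "\<lambda>j. violation (L (s+j)) (H (s+j)) (z (s+j))"] viol_ge by auto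
  then have nul: "\<And>i. i \<in> {0..<s} \<Longrightarrow> z i \<in> {L i..H i}" "\<And>j. j \<in> {0..<t} \<Longrightarrow> z (s+j) \<in> {L (s+j)..H (s+j)}"
    using viol_ge viol0 by (simp_all add: sum_nonneg_eq_0_iff)
  show "(\<Sum>j=0..<t. of_bool (E (s+j) i)) \<in> {L i..H i}" if "i \<in> {0..<s}"
    using nul(1)[OF that] out[of i] that t_nonneg by (simp add: outflow_def sum_shift del: sum_of_bool_eq)
  show "- (\<Sum>i=0..<s. of_bool (E (s+j) i)) \<in> {L (s+j)..H (s+j)}" if "j \<in> {0..<t}"
    using nul(2)[OF that] out[of "s+j"] that s_nonneg by (simp add: outflow_def del: sum_of_bool_eq)
qed

end

section \<open>From indices to matchings\<close>

lemma bij_betw_nth_int: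
  assumes "distinct xs"
  shows "bij_betw (\<lambda>i. xs ! nat i) {0..<int (length xs)} (set xs)"
proof -
  have "bij_betw nat {0..<int (length xs)} {..<length xs}"
    by (rule bij_betw_byWitness[where f' = int]) auto
  from bij_betw_trans[OF this bij_betw_nth[OF assms refl refl]] show ?thesis by (simp add: o_def)
qed

lemma sum_nth_int:
  "distinct xs \<Longrightarrow> (\<Sum>i=0..<int (length xs). f (xs ! nat i)) = (\<Sum>x\<in>set xs. f x)"
  by (rule sum.reindex_bij_betw[OF bij_betw_nth_int])

lemma int_card_row:
  assumes "M \<subseteq> A \<times> B" "finite B"
  shows "int (card {p \<in> M. fst p = a}) = (\<Sum>b\<in>B. of_bool ((a, b) \<in> M))"
proof -
  have "{p \<in> M. fst p = a} = Pair a ` (B \<inter> {b. (a, b) \<in> M})" using assms(1) by auto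
  moreover have "card (Pair a ` (B \<inter> {b. (a, b) \<in> M})) = card (B \<inter> {b. (a, b) \<in> M})"
    by (rule card_image) (auto simp: inj_on_def)
  ultimately show ?thesis using assms(2) by simp
qed

lemma int_card_col:
  assumes "M \<subseteq> A \<times> B" "finite A"
  shows "int (card {p \<in> M. snd p = b}) = (\<Sum>a\<in>A. of_bool ((a, b) \<in> M))"
proof -
  have "{p \<in> M. snd p = b} = (\<lambda>a. (a, b)) ` (A \<inter> {a. (a, b) \<in> M})" using assms(1) by auto
  moreover have "card ((\<lambda>a. (a, b)) ` (A \<inter> {a. (a, b) \<in> M})) = card (A \<inter> {a. (a, b) \<in> M})"
    by (rule card_image) (auto simp: inj_on_def)
  ultimately show ?thesis using assms(2) by simp
qed

lemma matching_cost_eq_sum: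
  assumes "M \<subseteq> A \<times> B" "finite A" "finite B"
  shows "matching_cost W M = (\<Sum>a\<in>A. \<Sum>b\<in>B. of_bool ((a, b) \<in> M) * W a b)"
proof -
  have "(\<Sum>a\<in>A. \<Sum>b\<in>B. of_bool ((a, b) \<in> M) * W a b) = (\<Sum>p\<in>A \<times> B. if p \<in> M then W (fst p) (snd p) else 0)"
    by (simp add: sum.cartesian_product case_prod_unfold) (rule sum.cong, auto)
  also have "\<dots> = (\<Sum>p\<in>M. W (fst p) (snd p))"
    using assms by (simp add: sum.inter_restrict[symmetric] Int_absorb1)
  finally show ?thesis by (simp add: matching_cost_def case_prod_unfold)
qed

lemma output_matching_iff:
  assumes "distinct as" "distinct bs" "i < length as" "j < length bs"
  shows "(as ! i, bs ! j) \<in> output_matching as bs \<sigma> \<longleftrightarrow> imem \<sigma> ''M'' (int (i * length bs + j)) = 1"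
  using assms by (auto simp: output_matching_def nth_eq_iff_index_eq)

lemma mmdc_program_correct:
  fixes "as" :: "'a list" and bs :: "'b list" and W :: "'a \<Rightarrow> 'b \<Rightarrow> real"
  assumes dist: "distinct as" "distinct bs"
    and le: "\<forall>a\<in>set as. \<alpha> a \<le> \<alpha>' a" "\<forall>b\<in>set bs. \<beta> b \<le> \<beta>' b"
  shows "wp mmdc_program (\<lambda>k \<sigma>. k \<le> 1400 * (length as + length bs + 2) ^ 4 \<and>
    ((\<exists>M. MMDC_matching (set as) (set bs) W \<alpha> \<alpha>' \<beta> \<beta>' M) \<longrightarrow>
      MMDC_matching (set as) (set bs) W \<alpha> \<alpha>' \<beta> \<beta>' (output_matching as bs \<sigma>)))
    (input_store as bs W \<alpha> \<alpha>' \<beta> \<beta>')"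
proof -
  define s where "s = int (length as)"
  define t where "t = int (length bs)"
  define w where "w i j = W (as ! nat i) (bs ! nat j)" for i j
  define L where "L v = (if v < s then int (\<alpha> (as ! nat v)) else - int (\<beta>' (bs ! nat (v - s))))" for v
  define H where "H v = (if v < s then int (\<alpha>' (as ! nat v)) else - int (\<beta> (bs ! nat (v - s))))" for v
  \<comment> \<open>The value that the program accumulates in \<open>big\<close>.\<close>
  define C where "C = 1 + (\<Sum>i=0..<s. \<Sum>j=0..<t. \<bar>w i j\<bar>)"
  let ?\<sigma> = "input_store as bs W \<alpha> \<alpha>' \<beta> \<beta>'"
  have C_pos: "0 < C" unfolding C_def by (intro add_pos_nonneg sum_nonneg) auto
  interpret network s t w L H C
  proof
    show "0 \<le> s" "0 \<le> t" by (simp_all add: s_def t_def)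
    show "0 < C" by (rule C_pos)
    fix v assume "0 \<le> v" "v < s + t"
    then show "L v \<le> H v" using le by (auto simp: L_def H_def s_def t_def)
  qed
  have weight: "rmem ?\<sigma> ''weight'' (i * t + j) = w i j" if "i \<in> {0..<s}" "j \<in> {0..<t}" for i j
  proof -
    have "nat i < length as" "nat j < length bs" using that by (auto simp: s_def t_def)
    from input_store_weight[OF this] show ?thesis using that by (simp add: t_def w_def)
  qed
  have feasible: "feasible_matching (set as) (set bs) \<alpha> \<alpha>' \<beta> \<beta>' M \<longleftrightarrow>
      (\<forall>i\<in>{0..<s}. (\<Sum>j=0..<t. of_bool ((as ! nat i, bs ! nat j) \<in> M)) \<in> {L i..H i}) \<and>
      (\<forall>j\<in>{0..<t}. - (\<Sum>i=0..<s. of_bool ((as ! nat i, bs ! nat j) \<in> M)) \<in> {L (s+j)..H (s+j)})"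
    if M: "M \<subseteq> set as \<times> set bs" for M
  proof -
    have row: "(\<Sum>j=0..<t. of_bool ((a, bs ! nat j) \<in> M)) = int (card {p \<in> M. fst p = a})" for a
      using sum_nth_int[OF dist(2), of "\<lambda>b. of_bool ((a, b) \<in> M) :: int"] int_card_row[OF M]
      by (simp add: t_def)
    have col: "(\<Sum>i=0..<s. of_bool ((as ! nat i, b) \<in> M)) = int (card {p \<in> M. snd p = b})" for b
      using sum_nth_int[OF dist(1), of "\<lambda>a. of_bool ((a, b) \<in> M) :: int"] int_card_col[OF M]
      by (simp add: s_def)
    have A: "(\<forall>i\<in>{0..<s}. P (as ! nat i)) \<longleftrightarrow> (\<forall>a\<in>set as. P a)" for P
      unfolding s_def bij_betw_imp_surj_on[OF bij_betw_nth_int[OF dist(1)], symmetric] by simp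
    have B: "(\<forall>j\<in>{0..<t}. P (bs ! nat j)) \<longleftrightarrow> (\<forall>b\<in>set bs. P b)" for P
      unfolding t_def bij_betw_imp_surj_on[OF bij_betw_nth_int[OF dist(2)], symmetric] by simp
    show ?thesis
      unfolding row col feasible_matching_def A[symmetric] B[symmetric]
      using M by (auto simp: L_def H_def)
  qed
  have cost: "matching_cost W M = (\<Sum>i=0..<s. \<Sum>j=0..<t. of_bool ((as ! nat i, bs ! nat j) \<in> M) * w i j)"
    if M: "M \<subseteq> set as \<times> set bs" for M
    unfolding matching_cost_eq_sum[OF M finite_set finite_set] sum_nth_int[OF dist(1), symmetric]
      sum_nth_int[OF dist(2), symmetric] s_def t_def w_def ..
  have "wp mmdc_program (\<lambda>k \<tau>. k \<le> 1400 * (nat (s+t+1) + 1)^4 \<and> (\<exists>E R p z.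
    residual E R p z ({0..<s} \<times> {s..<s+t}) \<and> (\<forall>v\<in>{0..<s+t}. outflow E v = z v) \<and>
    (\<forall>i\<in>{0..<s}. \<forall>j\<in>{0..<t}. imem \<tau> ''M'' (i * t + j) = 1 \<longleftrightarrow> E (s + j) i))) ?\<sigma>"
    by (rule wp_mmdc_program)
      (use weight in \<open>auto simp: C_def L_def H_def s_def t_def\<close>, auto simp: input_store_def)
  then show ?thesis
  proof (rule wp_mono, elim conjE exE, intro conjI impI)
    fix k assume "k \<le> 1400 * (nat (s+t+1) + 1)^4"
    moreover have "nat (s+t+1) + 1 = length as + length bs + 2" by (simp add: s_def t_def)
    ultimately show "k \<le> 1400 * (length as + length bs + 2) ^ 4" by simp
  next
    fix \<tau> :: store and E R p z
    assume res: "residual E R p z ({0..<s} \<times> {s..<s+t})" and out: "\<forall>v\<in>{0..<s+t}. outflow E v = z v"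
      and M: "\<forall>i\<in>{0..<s}. \<forall>j\<in>{0..<t}. imem \<tau> ''M'' (i * t + j) = 1 \<longleftrightarrow> E (s + j) i"
      and ex: "\<exists>M. MMDC_matching (set as) (set bs) W \<alpha> \<alpha>' \<beta> \<beta>' M"
    let ?M = "output_matching as bs \<tau>"
    have sub: "?M \<subseteq> set as \<times> set bs" by (auto simp: output_matching_def)
    have E: "(as ! nat i, bs ! nat j) \<in> ?M \<longleftrightarrow> E (s + j) i" if "i \<in> {0..<s}" "j \<in> {0..<t}" for i j
    proof -
      have "int (nat i * length bs + nat j) = i * t + j" using that by (simp add: t_def)
      moreover have "nat i < length as" "nat j < length bs" using that by (auto simp: s_def t_def)
      ultimately show ?thesis using output_matching_iff[OF dist, of "nat i" "nat j" \<tau>] M that by simp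
    qed
    have row: "(\<Sum>j=0..<t. of_bool ((as ! nat i, bs ! nat j) \<in> ?M)) = (\<Sum>j=0..<t. of_bool (E (s+j) i) :: int)"
      if "i \<in> {0..<s}" for i by (rule sum.cong) (use E that in auto)
    have col: "(\<Sum>i=0..<s. of_bool ((as ! nat i, bs ! nat j) \<in> ?M)) = (\<Sum>i=0..<s. of_bool (E (s+j) i) :: int)"
      if "j \<in> {0..<t}" for j by (rule sum.cong) (use E that in auto)
    have cost_out: "matching_cost W ?M = (\<Sum>i=0..<s. \<Sum>j=0..<t. of_bool (E (s+j) i) * w i j)"
      unfolding cost[OF sub] by (intro sum.cong refl) (use E in auto)
    \<comment> \<open>\<open>M'\<close> has two roles: its feasibility forces the violation of the
      output to be zero, and it is the competitor in cost. By \<open>ex\<close> there is at least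
      one such \<open>M'\<close>.\<close>
    have "feasible_matching (set as) (set bs) \<alpha> \<alpha>' \<beta> \<beta>' ?M \<and> matching_cost W ?M \<le> matching_cost W M'"
      if f': "feasible_matching (set as) (set bs) \<alpha> \<alpha>' \<beta> \<beta>' M'" for M'
    proof -
      have sub': "M' \<subseteq> set as \<times> set bs" using f' by (simp add: feasible_matching_def)
      note f = f'[unfolded feasible[OF sub']]
      note opt = certificate_optimal[OF res bspec[OF out] C_def bspec[OF conjunct1[OF f]] bspec[OF conjunct2[OF f]]]
      have "feasible_matching (set as) (set bs) \<alpha> \<alpha>' \<beta> \<beta>' ?M"
        unfolding feasible[OF sub]
      proof (intro conjI ballI)
        fix i assume "i \<in> {0..<s}"
        then show "(\<Sum>j=0..<t. of_bool ((as ! nat i, bs ! nat j) \<in> ?M)) \<in> {L i..H i}"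
          using opt(1) row by (simp only:)
      next
        fix j assume "j \<in> {0..<t}"
        then show "- (\<Sum>i=0..<s. of_bool ((as ! nat i, bs ! nat j) \<in> ?M)) \<in> {L (s+j)..H (s+j)}"
          using opt(2) col by (simp only:)
      qed
      moreover have "matching_cost W ?M \<le> matching_cost W M'"
        unfolding cost_out cost[OF sub'] by (rule opt(3))
      ultimately show ?thesis by blast
    qed
    then show "MMDC_matching (set as) (set bs) W \<alpha> \<alpha>' \<beta> \<beta>' ?M"
      using ex unfolding MMDC_matching_def by blast
  qed
qed

theorem theorem2:
  "\<exists>(P :: com) (T :: nat \<Rightarrow> real).
     T \<in> O(\<lambda>n. real n ^ 4) \<and>
     (\<forall>(as :: 'a list) (bs :: 'b list) (Weight :: 'a \<Rightarrow> 'b \<Rightarrow> real)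
        (\<alpha> :: 'a \<Rightarrow> nat) (\<alpha>' :: 'a \<Rightarrow> nat) (\<beta> :: 'b \<Rightarrow> nat) (\<beta>' :: 'b \<Rightarrow> nat) A B n.
        distinct as \<and> A = set as \<and> distinct bs \<and> B = set bs \<and> n = card A + card B \<and>
        (\<forall>a\<in>A. \<alpha> a \<le> \<alpha>' a) \<and> (\<forall>b\<in>B. \<beta> b \<le> \<beta>' b) \<longrightarrow>
        (\<exists>k \<sigma>. exec P (input_store as bs Weight \<alpha> \<alpha>' \<beta> \<beta>') k \<sigma> \<and> real k \<le> T n \<and>
           ((\<exists>M. MMDC_matching A B Weight \<alpha> \<alpha>' \<beta> \<beta>' M) \<longrightarrow>
             MMDC_matching A B Weight \<alpha> \<alpha>' \<beta> \<beta>' (output_matching as bs \<sigma>))))"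
proof (rule exI[of _ mmdc_program], rule exI[of _ "\<lambda>n. 1400 * (real n + 2) ^ 4"], intro conjI allI impI)
  show "(\<lambda>n. 1400 * (real n + 2) ^ 4) \<in> O(\<lambda>n. real n ^ 4)"
  \<comment> \<open>From \<open>n = 1\<close> on, \<open>n + 2 \<le> 3 * n\<close>, and
    \<open>81 = 3 ^ 4\<close>. The 2 comes from the root node and from the bounds being powers of
    the number of nodes plus one.\<close>
  proof (rule bigoI[where c = "1400 * 81"], rule eventually_mono[OF eventually_ge_at_top[of 1]])
    fix n :: nat assume "1 \<le> n"
    then have "(real n + 2) ^ 4 \<le> (3 * real n) ^ 4" by (intro power_mono) auto
    then show "norm (1400 * (real n + 2) ^ 4) \<le> 1400 * 81 * norm (real n ^ 4)"
      by (simp add: power_mult_distrib)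
  qed
next
  fix "as" :: "'a list" and bs :: "'b list" and Weight :: "'a \<Rightarrow> 'b \<Rightarrow> real"
    and \<alpha> \<alpha>' :: "'a \<Rightarrow> nat" and \<beta> \<beta>' :: "'b \<Rightarrow> nat" and A B n
  assume a: "distinct as \<and> A = set as \<and> distinct bs \<and> B = set bs \<and> n = card A + card B \<and>
        (\<forall>a\<in>A. \<alpha> a \<le> \<alpha>' a) \<and> (\<forall>b\<in>B. \<beta> b \<le> \<beta>' b)"
  then have "n = length as + length bs" by (simp add: distinct_card)
  have "wp mmdc_program (\<lambda>k \<sigma>. k \<le> 1400 * (length as + length bs + 2) ^ 4 \<and>
    ((\<exists>M. MMDC_matching A B Weight \<alpha> \<alpha>' \<beta> \<beta>' M) \<longrightarrow>
      MMDC_matching A B Weight \<alpha> \<alpha>' \<beta> \<beta>' (output_matching as bs \<sigma>)))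
    (input_store as bs Weight \<alpha> \<alpha>' \<beta> \<beta>')"
    using mmdc_program_correct a by blast
  then obtain k \<sigma> where k: "exec mmdc_program (input_store as bs Weight \<alpha> \<alpha>' \<beta> \<beta>') k \<sigma>"
      "k \<le> 1400 * (n + 2) ^ 4"
      "(\<exists>M. MMDC_matching A B Weight \<alpha> \<alpha>' \<beta> \<beta>' M) \<longrightarrow>
        MMDC_matching A B Weight \<alpha> \<alpha>' \<beta> \<beta>' (output_matching as bs \<sigma>)"
    unfolding wp_def \<open>n = length as + length bs\<close> by blast
  have "real k \<le> real (1400 * (n + 2) ^ 4)" using k(2) by (simp only: of_nat_le_iff)
  then have "real k \<le> 1400 * (real n + 2) ^ 4" by (simp add: add.commute)
  with k(1,3) show "\<exists>k \<sigma>. exec mmdc_program (input_store as bs Weight \<alpha> \<alpha>' \<beta> \<beta>') k \<sigma> \<and>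
      real k \<le> 1400 * (real n + 2) ^ 4 \<and> ((\<exists>M. MMDC_matching A B Weight \<alpha> \<alpha>' \<beta> \<beta>' M) \<longrightarrow>
        MMDC_matching A B Weight \<alpha> \<alpha>' \<beta> \<beta>' (output_matching as bs \<sigma>))"
    by blast
qed

end
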